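(* Let $k\ge 1$ and let $F$ be a $k$-step groupspace. For $0\le i\le k$ let $F_i:=F/\sim_i$ with the push-forward cubic structure, and for $1\le i\le k$ let $\pi_{i,i-1}:F_i\to F_{i-1}$ be the natural factor map. Then $F_0$ is a one point space, $F_k=F$ (that is, $\sim_k$ is equality), and for every $i$, $F_i$ is the unique largest $i$-step factor of $F$: $F_i$ is an $i$-step groupspace, and $\sim_i$ is contained in every congruence $\sim$ of $F$ for which $F/\sim$ is $i$-step. Moreover, there are groups $G_1,\dots,G_k$, with $G_i$ abelian for every $i\ge 2$, such that for every $1\le i\le k$ the group $G_i$ acts freely on $F_i$ and the orbits of this action are exactly the fibers of $\pi_{i,i-1}$. Here $F_1$ is isomorphic to $\mathcal{D}_1(G_1)$, with $G_1$ acting by multiplication. For $i\ge 2$ each fiber of $\pi_{i,i-1}$ (with the cubes of $F_i$ all of whose values lie in the fiber) is isomorphic to $\mathcal{D}_i(G_i)$ with $G_i$ acting by translation, and the actions on the different fibers are canonically matched in the following sense: for all $x,x'\in F_i$ and $a\in G_i$, if $c:\{0,1\}^i\to F_i$ takes the value $x^a$ at $0^i$ and $x$ elsewhere, and $c':\{0,1\}^i\to F_i$ takes the value $x'^a$ at $0^i$ and $x'$ elsewhere, then $c,c'\in C^i(F_i)$ and $c\approx_1 c'$.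
   Context: Notation: $[n]=\{1,\dots,n\}$; $\{0,1\}^0$ is a one point set; $0^n$ and $1^n$ are the all-zero and all-one vectors; $\{0,1\}^n_*=\{0,1\}^n\setminus\{1^n\}$; $h(v)=\sum_i v_i$. $\mathcal{G}$-morphisms: a map $\phi:\{0,1\}^n\to\{0,1\}^m$ is a morphism in $\mathcal{G}$ if for every $i\in[m]$ the function $v\mapsto\phi(v)_i$ is either constant (then put $\gamma_\phi(i)=0$) or equal to $v\mapsto v_j$ or $v\mapsto 1-v_j$ for some $j\in[n]$ (then put $\gamma_\phi(i)=j$), and for all $1\le i<j\le m$ either $\gamma_\phi(j)=0$ or $\gamma_\phi(i)\le\gamma_\phi(j)$. For $i\in[n]$, $j\in\{0,1\}$ the face embedding $e^n_{i,j}:\{0,1\}^{n-1}\to\{0,1\}^n$ is $e^n_{i,j}(x_1,\dots,x_{n-1})=(x_1,\dots,x_{i-1},j,x_i,\dots,x_{n-1})$. A cube-structure is a set $X$ with subsets $C^n(X)\subseteq X^{\{0,1\}^n}$ for $n=0,1,2,\dots$. It is a groupspace if: (presheaf) $\psi\in C^m(X)$ and $\phi:\{0,1\}^n\to\{0,1\}^m$ a morphism in $\mathcal{G}$ imply $\psi\circ\phi\in C^n(X)$; (ergodicity) $C^1(X)=X^{\{0,1\}}$; (completion) for every $n\ge 0$, if $f:\{0,1\}^n_*\to X$ satisfies $f\circ e^n_{i,0}\in C^{n-1}(X)$ for all $i\in[n]$, then some $\phi\in C^n(X)$ restricts to $f$ on $\{0,1\}^n_*$. A groupspace is $k$-step if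 for $n=k+1$ the completion $\phi$ is always uniquely determined by $f$. Two cube-structures are isomorphic if there is a bijection $m$ between them such that, for all $n$, $c$ is an $n$-cube of the first if and only if $m\circ c$ is an $n$-cube of the second. For an equivalence relation $\sim$ on $X$ with factor map $m:X\to X/\sim$, the push-forward cubic structure is $C^n(X/\sim)=\{m\circ c: c\in C^n(X)\}$; $\sim$ is a congruence if $X/\sim$ with this structure is a groupspace. For $x,y\in X$, $x\sim_i y$ means there are $c_1,c_2\in C^{i+1}(X)$ with $c_1(1^{i+1})=x$, $c_2(1^{i+1})=y$ and $c_1=c_2$ on $\{0,1\}^{i+1}_*$; this is an equivalence relation, and $\sim_i$ refines $\sim_j$ for $j\le i$. For $c_1,c_2\in C^n(X)$, $c_1\approx_1 c_2$ means there is $c_3\in C^{n+1}(X)$ with $c_1=c_3\circ e^{n+1}_{1,0}$ and $c_2=c_3\circ e^{n+1}_{1,1}$. For a group $G$, $\mathcal{D}_1(G)$ is the cube-structure on $G$ whose $n$-cubes are the maps $v\mapsto a_0a_1^{v_1}\cdots a_n^{v_n}$ with $a_0,\dots,a_n\in G$. For an abelian group $A$ and $k\ge1$, $\mathcal{D}_k(A)$ is the cube-structure on $A$ whose $n$-cubes are the maps $f:\{0,1\}^n\to A$ such that $\sum_{u\le v}(-1)^{h(u)}f(u)=0$ for every $v\in\{0,1\}^n$ with $h(v)\ge k+1$ (the sum is over $u\in\{0,1\}^n$ with $u_i\le v_i$ for all $i$). *)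

theory Defs
  imports "HOL-Algebra.Group_Action" "HOL-Algebra.FiniteProduct"
begin

text \<open>
  A vector \<open>v\<close> in \<open>{0,1}^n\<close> is a Boolean list of length \<open>n\<close>; its coordinate \<open>v_i\<close>, for \<open>i\<close> in
  \<open>{1..n}\<close>, is \<open>v ! (i - 1)\<close>.  Maps defined on \<open>{0,1}^n\<close> (or on a subset of it) are extensional
  functions, so that they are determined by their values on that set.
\<close>

definition cube :: "nat \<Rightarrow> bool list set" where
  "cube n = {v. length v = n}"

abbreviation coord :: "bool list \<Rightarrow> nat \<Rightarrow> bool" where
  "coord v i \<equiv> v ! (i - 1)"

definition zeros :: "nat \<Rightarrow> bool list" where
  "zeros n = replicate n False"

definition ones :: "nat \<Rightarrow> bool list" where
  "ones n = replicate n True"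

definition punctured_cube :: "nat \<Rightarrow> bool list set" where
  "punctured_cube n = cube n - {ones n}"

definition height :: "bool list \<Rightarrow> nat" where
  "height v = (\<Sum>i = 1..length v. of_bool (coord v i))"

text \<open>The function \<open>\<gamma>\<close> below is uniquely determined by \<open>\<phi>\<close> on \<open>{1..m}\<close>.\<close>

definition G_morphism :: "nat \<Rightarrow> nat \<Rightarrow> (bool list \<Rightarrow> bool list) \<Rightarrow> bool" where
  "G_morphism n m \<phi> \<longleftrightarrow>
     \<phi> \<in> cube n \<rightarrow> cube m \<and>
     (\<exists>\<gamma> :: nat \<Rightarrow> nat.
        (\<forall>i\<in>{1..m}.
           (\<gamma> i = 0 \<and> (\<exists>b. \<forall>v\<in>cube n. coord (\<phi> v) i = b)) \<or>
           (\<gamma> i \<in> {1..n} \<and>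
              ((\<forall>v\<in>cube n. coord (\<phi> v) i = coord v (\<gamma> i)) \<or>
               (\<forall>v\<in>cube n. coord (\<phi> v) i = (\<not> coord v (\<gamma> i)))))) \<and>
        (\<forall>i j. 1 \<le> i \<and> i < j \<and> j \<le> m \<longrightarrow> \<gamma> j = 0 \<or> \<gamma> i \<le> \<gamma> j))"

text \<open>\<open>face i b\<close> is \<open>e^n_{i,b}\<close>; the dimension \<open>n\<close> is one more than the length of the argument.\<close>

definition face :: "nat \<Rightarrow> bool \<Rightarrow> bool list \<Rightarrow> bool list" where
  "face i b x = take (i - 1) x @ b # drop (i - 1) x"

record 'a cube_structure =
  points :: "'a set"
  cubes :: "nat \<Rightarrow> (bool list \<Rightarrow> 'a) set"

definition is_cube_structure :: "'a cube_structure \<Rightarrow> bool" where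
  "is_cube_structure X \<longleftrightarrow> (\<forall>n. cubes X n \<subseteq> cube n \<rightarrow>\<^sub>E points X)"

definition corner :: "'a cube_structure \<Rightarrow> nat \<Rightarrow> (bool list \<Rightarrow> 'a) \<Rightarrow> bool" where
  "corner X n f \<longleftrightarrow>
     f \<in> punctured_cube n \<rightarrow>\<^sub>E points X \<and>
     (\<forall>i\<in>{1..n}. compose (cube (n - 1)) f (face i False) \<in> cubes X (n - 1))"

definition completes :: "'a cube_structure \<Rightarrow> nat \<Rightarrow> (bool list \<Rightarrow> 'a) \<Rightarrow> (bool list \<Rightarrow> 'a) \<Rightarrow> bool" where
  "completes X n f c \<longleftrightarrow> c \<in> cubes X n \<and> restrict c (punctured_cube n) = f"

definition groupspace :: "'a cube_structure \<Rightarrow> bool" where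
  "groupspace X \<longleftrightarrow>
     is_cube_structure X \<and>
     (\<forall>n m \<psi> \<phi>. \<psi> \<in> cubes X m \<and> G_morphism n m \<phi> \<longrightarrow> compose (cube n) \<psi> \<phi> \<in> cubes X n) \<and>
     cubes X 1 = (cube 1 \<rightarrow>\<^sub>E points X) \<and>
     (\<forall>n f. corner X n f \<longrightarrow> (\<exists>c. completes X n f c))"

definition step_groupspace :: "nat \<Rightarrow> 'a cube_structure \<Rightarrow> bool" where
  "step_groupspace k X \<longleftrightarrow>
     groupspace X \<and>
     (\<forall>f c c'. corner X (k + 1) f \<and> completes X (k + 1) f c \<and> completes X (k + 1) f c' \<longrightarrow> c = c')"

definition cube_iso :: "('a \<Rightarrow> 'b) \<Rightarrow> 'a cube_structure \<Rightarrow> 'b cube_structure \<Rightarrow> bool" where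
  "cube_iso m X Y \<longleftrightarrow>
     bij_betw m (points X) (points Y) \<and>
     (\<forall>n. \<forall>c\<in>cube n \<rightarrow>\<^sub>E points X. c \<in> cubes X n \<longleftrightarrow> compose (cube n) m c \<in> cubes Y n)"

definition induced :: "'a cube_structure \<Rightarrow> 'a set \<Rightarrow> 'a cube_structure" where
  "induced X Y = \<lparr>points = Y, cubes = (\<lambda>n. {c \<in> cubes X n. c ` cube n \<subseteq> Y})\<rparr>"

definition factor :: "'a cube_structure \<Rightarrow> ('a \<times> 'a) set \<Rightarrow> 'a set cube_structure" where
  "factor X R =
     \<lparr>points = points X // R,
      cubes = (\<lambda>n. (\<lambda>c. compose (cube n) (\<lambda>x. R `` {x}) c) ` cubes X n)\<rparr>"

definition cube_congruence :: "'a cube_structure \<Rightarrow> ('a \<times> 'a) set \<Rightarrow> bool" where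
  "cube_congruence X R \<longleftrightarrow> equiv (points X) R \<and> groupspace (factor X R)"

definition sim :: "'a cube_structure \<Rightarrow> nat \<Rightarrow> ('a \<times> 'a) set" where
  "sim X i =
     {(x, y). x \<in> points X \<and> y \<in> points X \<and>
        (\<exists>c\<^sub>1\<in>cubes X (i + 1). \<exists>c\<^sub>2\<in>cubes X (i + 1).
           c\<^sub>1 (ones (i + 1)) = x \<and> c\<^sub>2 (ones (i + 1)) = y \<and>
           (\<forall>v\<in>punctured_cube (i + 1). c\<^sub>1 v = c\<^sub>2 v))}"

abbreviation level :: "'a cube_structure \<Rightarrow> nat \<Rightarrow> 'a set cube_structure" where
  "level X i \<equiv> factor X (sim X i)"

text \<open>
  The natural map \<open>X/\<sim>_i \<rightarrow> X/\<sim>_j\<close> for \<open>j \<le> i\<close>: since \<open>\<sim>_i\<close> refines \<open>\<sim>_j\<close>, the image of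
  a \<open>\<sim>_i\<close>-class under the relation \<open>\<sim>_j\<close> is the \<open>\<sim>_j\<close>-class containing it.
\<close>

definition level_proj :: "'a cube_structure \<Rightarrow> nat \<Rightarrow> 'a set \<Rightarrow> 'a set" where
  "level_proj X j P = sim X j `` P"

definition level_fiber :: "'a cube_structure \<Rightarrow> nat \<Rightarrow> 'a set \<Rightarrow> 'a set set" where
  "level_fiber X i Q = {P \<in> points (level X i). level_proj X (i - 1) P = Q}"

definition approx1 :: "'a cube_structure \<Rightarrow> nat \<Rightarrow> (bool list \<Rightarrow> 'a) \<Rightarrow> (bool list \<Rightarrow> 'a) \<Rightarrow> bool" where
  "approx1 X n c\<^sub>1 c\<^sub>2 \<longleftrightarrow>
     c\<^sub>1 \<in> cubes X n \<and> c\<^sub>2 \<in> cubes X n \<and>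
     (\<exists>c\<^sub>3\<in>cubes X (n + 1).
        c\<^sub>1 = compose (cube n) c\<^sub>3 (face 1 False) \<and> c\<^sub>2 = compose (cube n) c\<^sub>3 (face 1 True))"

definition D1 :: "('g, 'b) monoid_scheme \<Rightarrow> 'g cube_structure" where
  "D1 G =
     \<lparr>points = carrier G,
      cubes = (\<lambda>n. {c. \<exists>a \<in> {0..n} \<rightarrow> carrier G.
        c = (\<lambda>v\<in>cube n.
               foldl (\<lambda>p i. p \<otimes>\<^bsub>G\<^esub> (a i [^]\<^bsub>G\<^esub> (of_bool (coord v i) :: nat))) (a 0) [1..<n + 1])})\<rparr>"

text \<open>The abelian group is written multiplicatively, so the alternating sum is a product.\<close>

definition Dk :: "nat \<Rightarrow> ('g, 'b) monoid_scheme \<Rightarrow> 'g cube_structure" where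
  "Dk k A =
     \<lparr>points = carrier A,
      cubes = (\<lambda>n. {f \<in> cube n \<rightarrow>\<^sub>E carrier A.
        \<forall>v\<in>cube n. height v \<ge> k + 1 \<longrightarrow>
          (\<Otimes>\<^bsub>A\<^esub>u\<in>{u \<in> cube n. list_all2 (\<le>) u v}. f u [^]\<^bsub>A\<^esub> ((- 1) ^ height u :: int)) = \<one>\<^bsub>A\<^esub>})\<rparr>"

definition free_action :: "('g, 'b) monoid_scheme \<Rightarrow> 'a set \<Rightarrow> ('g \<Rightarrow> 'a \<Rightarrow> 'a) \<Rightarrow> bool" where
  "free_action G E \<rho> \<longleftrightarrow> group_action G E \<rho> \<and> (\<forall>x\<in>E. stabilizer G \<rho> x = {\<one>\<^bsub>G\<^esub>})"

text \<open>
  An isomorphism from a cube-structure on the group \<open>G\<close> onto \<open>Y\<close> that carries multiplication in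
  \<open>G\<close> to the action \<open>\<rho>\<close>.
\<close>

definition equivariant_iso ::
  "('g, 'b) monoid_scheme \<Rightarrow> ('g \<Rightarrow> 'a \<Rightarrow> 'a) \<Rightarrow> ('g \<Rightarrow> 'a) \<Rightarrow> 'g cube_structure \<Rightarrow> 'a cube_structure \<Rightarrow> bool" where
  "equivariant_iso G \<rho> m D Y \<longleftrightarrow>
     cube_iso m D Y \<and> (\<forall>a\<in>carrier G. \<forall>g\<in>carrier G. m (a \<otimes>\<^bsub>G\<^esub> g) = \<rho> a (m g))"

definition spike :: "nat \<Rightarrow> 'a \<Rightarrow> 'a \<Rightarrow> bool list \<Rightarrow> 'a" where
  "spike n y x = (\<lambda>v\<in>cube n. if v = zeros n then y else x)"

end

theory Submission
  imports Defs
begin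

text \<open>
  Completing one vertex at a time extends maps from down-sets to cubes, which yields gluing of cubes
  along any coordinate and hence all configurations on larger grids.  Gluing shows that \<open>x \<sim>_i y\<close>
  holds iff the map that is \<open>y\<close> at one vertex and \<open>x\<close> elsewhere is an \<open>(i+1)\<close>-cube, and that cubes of
  dimension at most \<open>i+1\<close> stay cubes under pointwise change modulo \<open>\<sim>_i\<close>; so corners of the factor
  by \<open>\<sim>_i\<close> can be lifted.

  In a 1-step groupspace, \<open>xy\<close> is the value completing the square \<open>(e, x, y, _)\<close>.  In a \<open>k\<close>-step
  groupspace with \<open>k \<ge> 2\<close>, an element \<open>a\<close> of the \<open>\<sim>_{k-1}\<close>-class of a base point \<open>e\<close> sends \<open>x\<close> to the \<open>y\<close>
  for which the spike of \<open>y\<close> over \<open>x\<close> is \<open>\<approx>_1\<close>-equivalent to that of \<open>a\<close> over \<open>e\<close>.  A function from the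
  \<open>k\<close>-dimensional vertices to this group is called null if translating a constant cube by it gives an
  \<open>\<approx>_1\<close>-equivalent cube.  Null functions are closed under products and include every function
  independent of some coordinate.  Two edge functions in different directions overlap in one vertex
  only, so unique completion makes the group commutative; and modulo degenerate functions every function
  is supported at one vertex, where it equals its alternating product up to inversion.  Coordinates
  cannot be permuted, so the action across different fibres always uses the first coordinate.
\<close>

section \<open>Morphisms\<close>

text \<open>Morphisms may not permute coordinates, but neighbouring outputs may read the same input.
  Two constructions exploit this. The antidiagonal that makes a completed corner into a glued cube
  doubles a coordinate in place, so gluing works in every direction; and a block of consecutive
  coordinates collapses to one, which yields the products of a 1-step groupspace in the order of the
  coordinates, without commutativity. For \<open>sim X i\<close> the threshold is dimension i + 1. A
  spike of that dimension changes one value of an (i+1)-cube within its class, whereas on an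
  (i+1)-dimensional face the classes of the other vertices determine that of the top. So
  representatives are free at low heights and forced above, and these two facts carry the factor
  construction. In a fibre of a k-step groupspace they say that every map of dimension at most k is
  a cube and that the condition starts in dimension k + 1, where one equation remains: the
  alternating product.\<close>

lemma mem_cube [simp]: "v \<in> cube n \<longleftrightarrow> length v = n"
  by (simp add: cube_def)

lemma G_morphism_Nil: "G_morphism n 0 (\<lambda>v. [])"
  by (auto simp: G_morphism_def)

lemma G_morphism_cong:
  assumes "G_morphism n m \<phi>" "\<And>v. length v = n \<Longrightarrow> \<phi> v = \<psi> v"
  shows "G_morphism n m \<psi>"
proof -
  have "\<psi> \<in> cube n \<rightarrow> cube m \<longleftrightarrow> \<phi> \<in> cube n \<rightarrow> cube m"
    using assms(2) by (auto simp: Pi_def)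
  moreover have "(\<forall>v\<in>cube n. coord (\<psi> v) i = g v) \<longleftrightarrow> (\<forall>v\<in>cube n. coord (\<phi> v) i = g v)" for i g
    using assms(2) by auto
  ultimately show ?thesis
    using assms(1) unfolding G_morphism_def by simp
qed

lemma G_morphism_const_Cons:
  assumes "G_morphism n m \<phi>"
  shows "G_morphism n (Suc m) (\<lambda>v. b # \<phi> v)"
proof -
  obtain \<gamma> where g: "\<forall>i\<in>{1..m}.
           (\<gamma> i = 0 \<and> (\<exists>b. \<forall>v\<in>cube n. coord (\<phi> v) i = b)) \<or>
           (\<gamma> i \<in> {1..n} \<and>
              ((\<forall>v\<in>cube n. coord (\<phi> v) i = coord v (\<gamma> i)) \<or>
               (\<forall>v\<in>cube n. coord (\<phi> v) i = (\<not> coord v (\<gamma> i)))))"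
    and s: "\<forall>i j. 1 \<le> i \<and> i < j \<and> j \<le> m \<longrightarrow> \<gamma> j = 0 \<or> \<gamma> i \<le> \<gamma> j"
    and p: "\<phi> \<in> cube n \<rightarrow> cube m"
    using assms unfolding G_morphism_def by blast
  define \<gamma>' where "\<gamma>' i = (if i \<le> 1 then 0 else \<gamma> (i - 1))" for i
  show ?thesis
    unfolding G_morphism_def
  proof (intro conjI exI[of _ \<gamma>'] ballI allI impI)
    show "(\<lambda>v. b # \<phi> v) \<in> cube n \<rightarrow> cube (Suc m)"
      using p by auto
  next
    fix i assume i: "i \<in> {1..Suc m}"
    show "(\<gamma>' i = 0 \<and> (\<exists>c. \<forall>v\<in>cube n. coord (b # \<phi> v) i = c)) \<or>
           (\<gamma>' i \<in> {1..n} \<and>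
              ((\<forall>v\<in>cube n. coord (b # \<phi> v) i = coord v (\<gamma>' i)) \<or>
               (\<forall>v\<in>cube n. coord (b # \<phi> v) i = (\<not> coord v (\<gamma>' i)))))"
    proof (cases "i = 1")
      case False
      then have j: "i - 1 \<in> {1..m}" and c: "coord (b # u) i = coord u (i - 1)" for u
        using i by (auto simp: nth_Cons')
      have e: "\<gamma>' i = \<gamma> (i - 1)"
        using False i by (auto simp: \<gamma>'_def)
      show ?thesis
        unfolding c e using bspec[OF g j] .
    qed (auto simp: \<gamma>'_def)
  next
    fix i j assume ij: "1 \<le> i \<and> i < j \<and> j \<le> Suc m"
    show "\<gamma>' j = 0 \<or> \<gamma>' i \<le> \<gamma>' j"
    proof (cases "i = 1")
      case False
      then have "1 \<le> i - 1 \<and> i - 1 < j - 1 \<and> j - 1 \<le> m"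
        using ij by arith
      then show ?thesis
        using s[rule_format, of "i - 1" "j - 1"] ij False by (simp add: \<gamma>'_def)
    qed (use ij in \<open>auto simp: \<gamma>'_def Suc_le_eq\<close>)
  qed
qed

text \<open>Coordinate 1 is the least nonzero value of \<open>\<gamma>\<close>, so a new front
  coordinate that reads it respects the order condition whatever follows. For constant
  \<open>h\<close> the value of \<open>\<gamma>\<close> has to be 0 there instead.\<close>

lemma G_morphism_dup:
  assumes "G_morphism (Suc n) m \<phi>"
  shows "G_morphism (Suc n) (Suc m) (\<lambda>v. h (hd v) # \<phi> v)"
proof (cases "h True = h False")
  case True
  then have "h b = h True" for b
    by (cases b) auto
  then have "(\<lambda>v. h (hd v) # \<phi> v) = (\<lambda>v. h True # \<phi> v)"
    by (intro ext) (rule arg_cong2[where f = Cons], auto)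
  then show ?thesis
    using G_morphism_const_Cons[OF assms, of "h True"] by simp
next
  case False
  obtain \<gamma> where g: "\<forall>i\<in>{1..m}.
           (\<gamma> i = 0 \<and> (\<exists>b. \<forall>v\<in>cube (Suc n). coord (\<phi> v) i = b)) \<or>
           (\<gamma> i \<in> {1..Suc n} \<and>
              ((\<forall>v\<in>cube (Suc n). coord (\<phi> v) i = coord v (\<gamma> i)) \<or>
               (\<forall>v\<in>cube (Suc n). coord (\<phi> v) i = (\<not> coord v (\<gamma> i)))))"
    and s: "\<forall>i j. 1 \<le> i \<and> i < j \<and> j \<le> m \<longrightarrow> \<gamma> j = 0 \<or> \<gamma> i \<le> \<gamma> j"
    and p: "\<phi> \<in> cube (Suc n) \<rightarrow> cube m"
    using assms unfolding G_morphism_def by blast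
  define \<gamma>' where "\<gamma>' i = (if i \<le> 1 then 1 else \<gamma> (i - 1))" for i
  show ?thesis
    unfolding G_morphism_def
  proof (intro conjI exI[of _ \<gamma>'] ballI allI impI)
    show "(\<lambda>v. h (hd v) # \<phi> v) \<in> cube (Suc n) \<rightarrow> cube (Suc m)"
      using p by auto
  next
    fix i assume i: "i \<in> {1..Suc m}"
    show "(\<gamma>' i = 0 \<and> (\<exists>c. \<forall>v\<in>cube (Suc n). coord (h (hd v) # \<phi> v) i = c)) \<or>
           (\<gamma>' i \<in> {1..Suc n} \<and>
              ((\<forall>v\<in>cube (Suc n). coord (h (hd v) # \<phi> v) i = coord v (\<gamma>' i)) \<or>
               (\<forall>v\<in>cube (Suc n). coord (h (hd v) # \<phi> v) i = (\<not> coord v (\<gamma>' i)))))"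
    proof (cases "i = 1")
      case True
      have hh: "(\<forall>b. h b = b) \<or> (\<forall>b. h b = (\<not> b))"
        using False by (metis (full_types))
      have "hd v = coord v (Suc 0)" if "v \<in> cube (Suc n)" for v :: "bool list"
        using that by (cases v) auto
      then show ?thesis
        using True hh by (auto simp: \<gamma>'_def)
    next
      case False
      then have j: "i - 1 \<in> {1..m}" and c: "coord (b # u) i = coord u (i - 1)" for u b
        using i by (auto simp: nth_Cons')
      have e: "\<gamma>' i = \<gamma> (i - 1)"
        using False i by (auto simp: \<gamma>'_def)
      show ?thesis
        unfolding c e using bspec[OF g j] .
    qed
  next
    fix i j assume ij: "1 \<le> i \<and> i < j \<and> j \<le> Suc m"
    show "\<gamma>' j = 0 \<or> \<gamma>' i \<le> \<gamma>' j"
    proof (cases "i = 1")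
      case False
      then have "1 \<le> i - 1 \<and> i - 1 < j - 1 \<and> j - 1 \<le> m"
        using ij by arith
      then show ?thesis
        using s[rule_format, of "i - 1" "j - 1"] ij False by (simp add: \<gamma>'_def)
    next
      case True
      have "\<gamma> (j - 1) = 0 \<or> 1 \<le> \<gamma> (j - 1)"
        by auto
      then show ?thesis
        using True ij by (auto simp: \<gamma>'_def)
    qed
  qed
qed

text \<open>Nonzero indices shift by one, but the value 0 marks a constant coordinate and has to
  stay 0.\<close>

lemma G_morphism_tl:
  assumes "G_morphism n m \<phi>"
  shows "G_morphism (Suc n) m (\<lambda>v. \<phi> (tl v))"
proof -
  obtain \<gamma> where g: "\<forall>i\<in>{1..m}.
           (\<gamma> i = 0 \<and> (\<exists>b. \<forall>v\<in>cube n. coord (\<phi> v) i = b)) \<or>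
           (\<gamma> i \<in> {1..n} \<and>
              ((\<forall>v\<in>cube n. coord (\<phi> v) i = coord v (\<gamma> i)) \<or>
               (\<forall>v\<in>cube n. coord (\<phi> v) i = (\<not> coord v (\<gamma> i)))))"
    and s: "\<forall>i j. 1 \<le> i \<and> i < j \<and> j \<le> m \<longrightarrow> \<gamma> j = 0 \<or> \<gamma> i \<le> \<gamma> j"
    and p: "\<phi> \<in> cube n \<rightarrow> cube m"
    using assms unfolding G_morphism_def by blast
  define \<gamma>' where "\<gamma>' i = (if \<gamma> i = 0 then 0 else Suc (\<gamma> i))" for i
  show ?thesis
    unfolding G_morphism_def
  proof (intro conjI exI[of _ \<gamma>'] ballI allI impI)
    show "(\<lambda>v. \<phi> (tl v)) \<in> cube (Suc n) \<rightarrow> cube m"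
      using p by auto
  next
    fix i assume i: "i \<in> {1..m}"
    have t: "coord v (Suc j) = coord (tl v) j" if "v \<in> cube (Suc n)" "j \<in> {1..n}" for v :: "bool list" and j
      using that by (auto simp: nth_tl)
    have tc: "tl v \<in> cube n" if "v \<in> cube (Suc n)" for v :: "bool list"
      using that by simp
    consider (a) b where "\<gamma> i = 0" "\<forall>v\<in>cube n. coord (\<phi> v) i = b"
      | (b) "\<gamma> i \<in> {1..n}" "\<forall>v\<in>cube n. coord (\<phi> v) i = coord v (\<gamma> i)"
      | (c) "\<gamma> i \<in> {1..n}" "\<forall>v\<in>cube n. coord (\<phi> v) i = (\<not> coord v (\<gamma> i))"
      using bspec[OF g i] by blast
    then show "(\<gamma>' i = 0 \<and> (\<exists>c. \<forall>v\<in>cube (Suc n). coord (\<phi> (tl v)) i = c)) \<or>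
           (\<gamma>' i \<in> {1..Suc n} \<and>
              ((\<forall>v\<in>cube (Suc n). coord (\<phi> (tl v)) i = coord v (\<gamma>' i)) \<or>
               (\<forall>v\<in>cube (Suc n). coord (\<phi> (tl v)) i = (\<not> coord v (\<gamma>' i)))))"
    proof cases
      case a
      then show ?thesis
        using tc by (auto simp: \<gamma>'_def)
    next
      case b
      then have "\<gamma>' i \<in> {1..Suc n}" "\<forall>v\<in>cube (Suc n). coord (\<phi> (tl v)) i = coord v (\<gamma>' i)"
        using tc t[OF _ b(1)] by (auto simp: \<gamma>'_def)
      then show ?thesis
        by blast
    next
      case c
      then have "\<gamma>' i \<in> {1..Suc n}" "\<forall>v\<in>cube (Suc n). coord (\<phi> (tl v)) i = (\<not> coord v (\<gamma>' i))"
        using tc t[OF _ c(1)] by (auto simp: \<gamma>'_def)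
      then show ?thesis
        by blast
    qed
  next
    fix i j assume ij: "1 \<le> i \<and> i < j \<and> j \<le> m"
    show "\<gamma>' j = 0 \<or> \<gamma>' i \<le> \<gamma>' j"
      using s[rule_format, OF ij] by (auto simp: \<gamma>'_def)
  qed
qed

lemma G_morphism_Cons:
  assumes "G_morphism n m \<phi>"
  shows "G_morphism (Suc n) (Suc m) (\<lambda>v. h (hd v) # \<phi> (tl v))"
  by (rule G_morphism_dup) (rule G_morphism_tl[OF assms])

lemma G_morphism_id: "G_morphism n n (\<lambda>v. v)"
proof (induction n)
  case 0
  then show ?case
    by (rule G_morphism_cong[OF G_morphism_Nil]) simp
next
  case (Suc n)
  show ?case
    by (rule G_morphism_cong[OF G_morphism_Cons[OF Suc, of "\<lambda>b. b"]])
      (auto simp: length_Suc_conv)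
qed

text \<open>Coordinate \<open>i\<close> of the image reads only coordinate \<open>i\<close> of the
  argument, through a map \<open>g h\<close> that is the identity, the negation or a constant.
  Reflections, meets and the mixtures used on grid cells are all of this form.\<close>

lemma G_morphism_map2: "G_morphism (length hs) (length hs) (\<lambda>v. map2 g hs v)"
proof (induction hs)
  case Nil
  then show ?case
    by (simp add: G_morphism_Nil)
next
  case (Cons h hs)
  show ?case
    unfolding list.size(4) add_Suc_right add_0_right
    by (rule G_morphism_cong[OF G_morphism_Cons[OF Cons, of "g h"]])
      (auto simp: length_Suc_conv)
qed

lemma G_morphism_drop: "G_morphism (m + n) n (drop m)"
proof (induction m)
  case 0
  show ?case
    using G_morphism_cong[OF G_morphism_id[of n], of "drop 0"] by simp
next
  case (Suc m)
  have e: "drop (Suc m) = (\<lambda>v. drop m (tl v))"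
    by (simp add: fun_eq_iff drop_Suc)
  show ?case
    unfolding e using G_morphism_tl[OF Suc] by simp
qed

lemma G_morphism_append: "G_morphism n (length x + n) (\<lambda>v. x @ v)"
  by (induction x) (simp_all add: G_morphism_id G_morphism_const_Cons)

lemma G_morphism_hd: "G_morphism (Suc n) 1 (\<lambda>v. [hd v])"
  using G_morphism_dup[OF G_morphism_Nil, of n "\<lambda>b. b"] by simp

lemma G_morphism_insert: "i \<le> n \<Longrightarrow> G_morphism n (Suc n) (\<lambda>v. take i v @ b # drop i v)"
proof (induction i arbitrary: n)
  case 0
  then show ?case
    using G_morphism_const_Cons[OF G_morphism_id] by simp
next
  case (Suc i)
  then obtain n' where n: "n = Suc n'" "i \<le> n'"
    by (cases n) auto
  show ?case
    unfolding n(1)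
    by (rule G_morphism_cong[OF G_morphism_Cons[OF Suc.IH[OF n(2)], of "\<lambda>b. b"]])
      (auto simp: length_Suc_conv)
qed

lemma G_morphism_face: "i \<in> {1..Suc n} \<Longrightarrow> G_morphism n (Suc n) (face i b)"
  unfolding face_def by (rule G_morphism_insert) auto

definition delete :: "nat \<Rightarrow> 'b list \<Rightarrow> 'b list" where
  "delete i v = take i v @ drop (Suc i) v"

lemma length_delete [simp]: "i < length v \<Longrightarrow> length (delete i v) = length v - 1"
  by (simp add: delete_def)

lemma delete_append [simp]: "length x = i \<Longrightarrow> delete i (x @ b # y) = x @ y"
  by (simp add: delete_def)

lemma G_morphism_delete: "i \<le> n \<Longrightarrow> G_morphism (Suc n) n (delete i)"
proof (induction i arbitrary: n)
  case 0
  show ?case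
    using G_morphism_tl[OF G_morphism_id] by (rule G_morphism_cong) (simp add: delete_def drop_Suc)
next
  case (Suc i)
  then obtain n' where n: "n = Suc n'" "i \<le> n'"
    by (cases n) auto
  show ?case
    unfolding n(1)
    by (rule G_morphism_cong[OF G_morphism_Cons[OF Suc.IH[OF n(2)], of "\<lambda>b. b"]])
      (auto simp: length_Suc_conv delete_def)
qed

text \<open>The order condition allows equality, so one input may be read twice in adjacent
  positions, once negated. Gluing in every direction rests on this morphism.\<close>

lemma G_morphism_antidiagonal:
  "i < n \<Longrightarrow> G_morphism n (Suc n) (\<lambda>v. take i v @ (\<not> v ! i) # drop i v)"
proof (induction i arbitrary: n)
  case 0
  then obtain n' where n: "n = Suc n'"
    by (cases n) auto
  show ?case
    unfolding n using G_morphism_dup[OF G_morphism_id, of n' "\<lambda>b. \<not> b"]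
    by (rule G_morphism_cong) (auto simp: length_Suc_conv)
next
  case (Suc i)
  then obtain n' where n: "n = Suc n'" "i < n'"
    by (cases n) auto
  show ?case
    unfolding n(1)
    by (rule G_morphism_cong[OF G_morphism_Cons[OF Suc.IH[OF n(2)], of "\<lambda>b. b"]])
      (auto simp: length_Suc_conv)
qed

subsection \<open>The face below a vertex\<close>

lemma height_Nil [simp]: "height [] = 0"
  by (simp add: height_def)

lemma height_Cons [simp]: "height (b # v) = of_bool b + height v"
proof -
  have "height (b # v) = (\<Sum>i = Suc 0..Suc (length v). of_bool ((b # v) ! (i - 1)))"
    by (simp add: height_def)
  also have "\<dots> = of_bool b + (\<Sum>i = Suc (Suc 0)..Suc (length v). of_bool ((b # v) ! (i - 1)))"
    by (subst sum.atLeast_Suc_atMost) simp_all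
  also have "(\<Sum>i = Suc (Suc 0)..Suc (length v). of_bool ((b # v) ! (i - 1)))
      = (\<Sum>i = Suc 0..length v. of_bool ((b # v) ! i))"
    by (subst sum.shift_bounds_cl_Suc_ivl) simp
  also have "\<dots> = height v"
    unfolding height_def by (rule sum.cong) (auto simp: nth_Cons')
  finally show ?thesis .
qed

lemma ones_Suc: "ones (Suc n) = True # ones n" "ones 0 = []"
  and zeros_Suc: "zeros (Suc n) = False # zeros n" "zeros 0 = []"
  by (simp_all add: ones_def zeros_def)

lemma length_ones [simp]: "length (ones n) = n" "length (zeros n) = n"
  by (simp_all add: ones_def zeros_def)

lemma nth_ones [simp]: "i < n \<Longrightarrow> ones n ! i" "i < n \<Longrightarrow> \<not> zeros n ! i"
  by (simp_all add: ones_def zeros_def)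

lemma height_ones [simp]: "height (ones n) = n"
  by (induction n) (simp_all add: ones_Suc)

lemma height_le_length: "height v \<le> length v"
  by (induction v) auto

lemma height_eq_length: "height v = length v \<longleftrightarrow> v = ones (length v)"
proof (induction v)
  case (Cons b v)
  then show ?case
    using height_le_length[of v] by (cases b) (auto simp: ones_Suc)
qed (simp add: ones_Suc)

lemma not_ones_iff: "length v = n \<Longrightarrow> v \<noteq> ones n \<longleftrightarrow> (\<exists>i<n. \<not> v ! i)"
  by (auto simp: list_eq_iff_nth_eq)

text \<open>The vectors below \<open>w\<close> form a cube of dimension \<open>height w\<close>.
  Here \<open>emb w\<close> parametrizes it by spreading \<open>t\<close> over the true positions of
  \<open>w\<close>, and \<open>ret w\<close> reads these positions off. Both keep the order of
  coordinates, as a morphism must.\<close>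

fun emb :: "bool list \<Rightarrow> bool list \<Rightarrow> bool list" where
  "emb [] t = []"
| "emb (b # w) t = (if b then hd t # emb w (tl t) else False # emb w t)"

fun ret :: "bool list \<Rightarrow> bool list \<Rightarrow> bool list" where
  "ret [] u = []"
| "ret (b # w) u = (if b then hd u # ret w (tl u) else ret w (tl u))"

abbreviation meet :: "bool list \<Rightarrow> bool list \<Rightarrow> bool list" where
  "meet \<equiv> map2 (\<and>)"

lemma length_emb [simp]: "length (emb w t) = length w"
  by (induction w t rule: emb.induct) auto

lemma length_ret [simp]: "length (ret w u) = height w"
  by (induction w u rule: ret.induct) auto

lemma G_morphism_emb: "G_morphism (height w) (length w) (emb w)"
proof (induction w)
  case Nil
  then show ?case
    using G_morphism_Nil by (simp add: emb.simps[abs_def])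
next
  case (Cons b w)
  show ?case
  proof (cases b)
    case True
    then show ?thesis
      using G_morphism_Cons[OF Cons, of "\<lambda>b. b"] by simp
  next
    case False
    then show ?thesis
      using G_morphism_const_Cons[OF Cons, of False] by simp
  qed
qed

lemma G_morphism_ret: "G_morphism (length w) (height w) (ret w)"
proof (induction w)
  case Nil
  then show ?case
    using G_morphism_Nil by (simp add: ret.simps[abs_def])
next
  case (Cons b w)
  show ?case
  proof (cases b)
    case True
    then show ?thesis
      using G_morphism_Cons[OF Cons, of "\<lambda>b. b"] by simp
  next
    case False
    then show ?thesis
      using G_morphism_tl[OF Cons] by simp
  qed
qed

lemma emb_ret: "length u = length w \<Longrightarrow> emb w (ret w u) = meet w u"
  by (induction w arbitrary: u) (auto simp: length_Suc_conv)

lemma emb_ones: "emb w (ones (height w)) = w"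
  by (induction w) (auto simp: ones_Suc)

lemma emb_eq_self: "length t = height w \<Longrightarrow> emb w t = w \<longleftrightarrow> t = ones (height w)"
  by (induction w arbitrary: t) (auto simp: length_Suc_conv ones_Suc)

lemma height_emb: "length t = height w \<Longrightarrow> height (emb w t) = height t"
  by (induction w arbitrary: t) (auto simp: length_Suc_conv)

lemma meet_emb: "length t = height w \<Longrightarrow> meet w (emb w t) = emb w t"
  by (induction w arbitrary: t) (auto simp: length_Suc_conv)

text \<open>The side of the face below \<open>w\<close> on which coordinate \<open>i\<close> of
  \<open>t\<close> vanishes is itself the face below another vertex. In \<open>extend\<close> that
  vertex lies in the down-set, where the map is already known to be a cube.\<close>

lemma emb_update:
  assumes "length t = height w"
  shows "emb w (t[i := False]) = meet (emb w ((ones (height w))[i := False])) (emb w t)"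
  using assms
proof (induction w arbitrary: t i)
  case (Cons b w)
  show ?case
  proof (cases b)
    case True
    then obtain c t' where t: "t = c # t'" "length t' = height w"
      using Cons.prems by (cases t) auto
    show ?thesis
    proof (cases i)
      case 0
      then show ?thesis
        using True t meet_emb[OF t(2)] by (simp add: emb_ones ones_Suc)
    next
      case (Suc j)
      then show ?thesis
        using True t Cons.IH[OF t(2), of j] by (simp add: ones_Suc)
    qed
  next
    case False
    then show ?thesis
      using Cons.IH[of t i] Cons.prems by simp
  qed
qed simp

lemma meet_ones: "length u = n \<Longrightarrow> meet (ones n) u = u"
  by (induction n arbitrary: u) (auto simp: length_Suc_conv ones_Suc)

lemma height_meet_le: "length u = length w \<Longrightarrow> height (meet w u) \<le> height w"
  by (induction w arbitrary: u) (auto simp: length_Suc_conv le_SucI)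

lemma height_meet_less:
  "length u = length w \<Longrightarrow> meet w u \<noteq> w \<Longrightarrow> height (meet w u) < height w"
proof (induction w arbitrary: u)
  case (Cons b w)
  then obtain c u' where u: "u = c # u'" "length u' = length w"
    by (auto simp: length_Suc_conv)
  show ?case
    using Cons.IH[OF u(2)] Cons.prems u height_meet_le[OF u(2)] by (cases "meet w u' = w") auto
qed simp

lemma finite_cube [simp]: "finite (cube n)"
  using finite_lists_length_eq[of "UNIV :: bool set" n] by (simp add: cube_def)


section \<open>Cubes\<close>

text \<open>Members of \<open>cubes X n\<close> are extensional, which makes composites awkward to
  write. This predicate ignores values outside the cube, so any lambda term can be called a
  cube.\<close>

definition is_cube :: "'a cube_structure \<Rightarrow> nat \<Rightarrow> (bool list \<Rightarrow> 'a) \<Rightarrow> bool" where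
  "is_cube X n f \<longleftrightarrow> restrict f (cube n) \<in> cubes X n"

lemma is_cube_cong:
  assumes "is_cube X n f" "\<And>v. length v = n \<Longrightarrow> f v = g v"
  shows "is_cube X n g"
proof -
  have "restrict f (cube n) = restrict g (cube n)"
    using assms(2) by (intro restrict_ext) simp
  then show ?thesis
    using assms(1) by (simp add: is_cube_def)
qed

lemma cube_structureD: "is_cube_structure Y \<Longrightarrow> c \<in> cubes Y n \<Longrightarrow> c \<in> cube n \<rightarrow>\<^sub>E points Y"
  by (auto simp: is_cube_structure_def)

text \<open>In place of the face map in dimension \<open>n - 1\<close>, the corner condition uses
  its pullback along the deletion of a coordinate, which is
  \<open>\<lambda>u. f (u[i := False])\<close>. Everything then lives in dimension
  \<open>n\<close>.\<close>

lemma groupspaceI: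
  assumes "is_cube_structure Y"
    and comp: "\<And>n m f \<phi>. is_cube Y m f \<Longrightarrow> G_morphism n m \<phi> \<Longrightarrow> is_cube Y n (\<lambda>v. f (\<phi> v))"
    and erg: "\<And>f. (\<And>v. length v = 1 \<Longrightarrow> f v \<in> points Y) \<Longrightarrow> is_cube Y 1 f"
    and compl: "\<And>n f. (\<And>i. i < n \<Longrightarrow> is_cube Y n (\<lambda>u. f (u[i := False]))) \<Longrightarrow>
      \<exists>g. is_cube Y n g \<and> (\<forall>u. length u = n \<longrightarrow> u \<noteq> ones n \<longrightarrow> g u = f u)"
  shows "groupspace Y"
  unfolding groupspace_def
proof (intro conjI allI impI)
  have ext: "restrict c (cube n) = c" if "c \<in> cubes Y n" for c n
    using cube_structureD[OF assms(1) that] by (simp add: PiE_def extensional_restrict)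
  show "is_cube_structure Y"
    by fact
  show "compose (cube n) \<psi> \<phi> \<in> cubes Y n" if "\<psi> \<in> cubes Y m \<and> G_morphism n m \<phi>" for n m \<psi> \<phi>
    using comp[of m \<psi> n \<phi>] that by (simp add: is_cube_def ext compose_def)
  show "cubes Y 1 = cube 1 \<rightarrow>\<^sub>E points Y"
  proof
    show "cubes Y 1 \<subseteq> cube 1 \<rightarrow>\<^sub>E points Y"
      using assms(1) by (simp add: is_cube_structure_def)
    show "cube 1 \<rightarrow>\<^sub>E points Y \<subseteq> cubes Y 1"
    proof
      fix f assume f: "f \<in> cube 1 \<rightarrow>\<^sub>E points Y"
      then have "is_cube Y 1 f"
        by (intro erg) (auto simp: PiE_def Pi_def)
      then show "f \<in> cubes Y 1"
        using f by (simp add: is_cube_def PiE_def extensional_restrict)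
    qed
  qed
  show "\<exists>c. completes Y n f c" if "corner Y n f" for n f
  proof -
    have "is_cube Y n (\<lambda>u. f (u[i := False]))" if "i < n" for i
    proof -
      obtain n' where n': "n = Suc n'"
        using \<open>i < n\<close> by (cases n) auto
      have "compose (cube n') f (face (Suc i) False) \<in> cubes Y n'"
        using \<open>corner Y n f\<close> \<open>i < n\<close> by (auto simp: corner_def n')
      then have "is_cube Y n' (\<lambda>v. f (face (Suc i) False v))"
        by (simp add: is_cube_def compose_def)
      then have "is_cube Y n (\<lambda>v. f (face (Suc i) False (delete i v)))"
        unfolding n' using \<open>i < n\<close> by (intro comp[OF _ G_morphism_delete]) (simp_all add: n')
      then show ?thesis
        using \<open>i < n\<close> by (elim is_cube_cong) (simp add: face_def delete_def upd_conv_take_nth_drop)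
    qed
    then obtain g where g: "is_cube Y n g" "\<And>u. length u = n \<Longrightarrow> u \<noteq> ones n \<Longrightarrow> g u = f u"
      using compl[of n f] by blast
    have "f \<in> extensional (punctured_cube n)"
      using \<open>corner Y n f\<close> by (simp add: corner_def PiE_def)
    then have "restrict (restrict g (cube n)) (punctured_cube n) = f"
      using g(2) by (auto simp: punctured_cube_def restrict_def extensional_def)
    then show ?thesis
      using g(1) by (auto simp: completes_def is_cube_def)
  qed
qed

section \<open>Consequences of the axioms: completion at any vertex, extension from
  down-sets\<close>

locale gspace =
  fixes X :: "'a cube_structure"
  assumes groupspace: "groupspace X"
begin

lemma cube_structure: "is_cube_structure X"
  using groupspace by (simp add: groupspace_def)

lemma cubes_restrict: "c \<in> cubes X n \<Longrightarrow> restrict c (cube n) = c"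
  using cube_structureD[OF cube_structure] by (simp add: PiE_def extensional_restrict)

lemma cubes_iff: "c \<in> cubes X n \<longleftrightarrow> c \<in> extensional (cube n) \<and> is_cube X n c"
  by (metis cubes_restrict is_cube_def extensional_restrict restrict_extensional)

lemma cubes_is_cube: "c \<in> cubes X n \<Longrightarrow> is_cube X n c"
  by (simp add: cubes_iff)

lemma is_cube_points: "is_cube X n f \<Longrightarrow> length v = n \<Longrightarrow> f v \<in> points X"
proof -
  assume a: "is_cube X n f" "length v = n"
  have "restrict f (cube n) \<in> cube n \<rightarrow>\<^sub>E points X"
    using cube_structureD[OF cube_structure] a(1) unfolding is_cube_def by blast
  then show "f v \<in> points X"
    using a(2) by (simp add: restrict_PiE_iff Pi_iff)
qed

lemma is_cube_comp:
  assumes "is_cube X m f" "G_morphism n m \<phi>"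
  shows "is_cube X n (\<lambda>v. f (\<phi> v))"
proof -
  have "compose (cube n) (restrict f (cube m)) \<phi> \<in> cubes X n"
    using groupspace assms unfolding groupspace_def is_cube_def by blast
  moreover have "length (\<phi> v) = m" if "length v = n" for v
    using assms(2) that by (auto simp: G_morphism_def Pi_def)
  then have "compose (cube n) (restrict f (cube m)) \<phi> = (\<lambda>v\<in>cube n. f (\<phi> v))"
    by (auto simp: compose_def fun_eq_iff)
  ultimately show ?thesis
    by (simp add: is_cube_def)
qed

lemma is_cube_1: "(\<And>v. length v = 1 \<Longrightarrow> f v \<in> points X) \<Longrightarrow> is_cube X 1 f"
  using groupspace by (simp add: groupspace_def is_cube_def restrict_PiE_iff)

lemma is_cube_hd:
  assumes "x \<in> points X" "y \<in> points X"
  shows "is_cube X (Suc n) (\<lambda>u. if hd u then x else y)"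
proof -
  have "is_cube X 1 (\<lambda>u. if hd u then x else y)"
    using assms by (intro is_cube_1) auto
  from is_cube_comp[OF this G_morphism_hd] show ?thesis
    by simp
qed

text \<open>The constant map is restricted from dimension \<open>n + 1\<close>, so that dimension 0
  is covered: ergodicity itself speaks of edges only.\<close>

lemma is_cube_const:
  assumes "x \<in> points X"
  shows "is_cube X n (\<lambda>u. x)"
  using is_cube_comp[OF is_cube_hd[OF assms assms] G_morphism_const_Cons[OF G_morphism_id]] by simp

lemma complete:
  assumes "\<And>i. i < n \<Longrightarrow> is_cube X n (\<lambda>u. f (u[i := False]))"
  shows "\<exists>g. is_cube X n g \<and> (\<forall>u. length u = n \<longrightarrow> u \<noteq> ones n \<longrightarrow> g u = f u)"
proof -
  define h where "h = restrict f (punctured_cube n)"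
  have "corner X n h"
    unfolding corner_def
  proof (intro conjI ballI)
    have "f v \<in> points X" if "v \<in> punctured_cube n" for v
    proof -
      have v: "length v = n" "v \<noteq> ones n"
        using that by (auto simp: punctured_cube_def)
      then obtain i where i: "i < n" "\<not> v ! i" "length v = n"
        using not_ones_iff[of v n] by auto
      have "v[i := False] = v"
        using i(2) by (metis (full_types) list_update_id)
      then show ?thesis
        using is_cube_points[OF assms[OF i(1)] i(3)] by simp
    qed
    then show "h \<in> punctured_cube n \<rightarrow>\<^sub>E points X"
      by (simp add: h_def)
  next
    fix i assume i: "i \<in> {1..n}"
    then obtain j n' where j: "i = Suc j" "j < n" "n = Suc n'"
      by (metis atLeastAtMost_iff Suc_le_D Suc_le_eq One_nat_def le_trans)
    have "is_cube X n' (\<lambda>v. f ((face i False v)[j := False]))"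
      using j i by (intro is_cube_comp[OF assms[OF j(2)]]) (simp add: G_morphism_face)
    moreover have "f ((face i False v)[j := False]) = h (face i False v)" if "length v = n'" for v
    proof -
      have "length (face i False v) = n"
        using that j by (simp add: face_def)
      moreover have l: "\<not> face i False v ! j"
        using that j by (simp add: face_def nth_append)
      ultimately have "face i False v \<in> punctured_cube n"
        using not_ones_iff[of "face i False v" n] j(2) by (auto simp: punctured_cube_def)
      moreover have "(face i False v)[j := False] = face i False v"
        using l by (metis (full_types) list_update_id)
      ultimately show ?thesis
        by (simp add: h_def)
    qed
    ultimately have "is_cube X n' (\<lambda>v. h (face i False v))"
      by (rule is_cube_cong)
    then show "compose (cube (n - 1)) h (face i False) \<in> cubes X (n - 1)"
      by (simp add: is_cube_def compose_def j)
  qed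
  then obtain c where c: "c \<in> cubes X n" "restrict c (punctured_cube n) = h"
    using groupspace unfolding groupspace_def completes_def by blast
  have "c u = f u" if "length u = n" "u \<noteq> ones n" for u
    using fun_cong[OF c(2), of u] that by (simp add: h_def punctured_cube_def)
  then show ?thesis
    using cubes_is_cube[OF c(1)] by blast
qed

text \<open>Reflecting the coordinates in which \<open>p\<close> is false is an involutive morphism
  that carries \<open>p\<close> to the top vertex, where the completion axiom applies.\<close>

lemma complete_vertex:
  assumes p: "length p = n" and f: "\<And>i. i < n \<Longrightarrow> is_cube X n (\<lambda>u. f (u[i := (\<not> p ! i)]))"
  shows "\<exists>g. is_cube X n g \<and> (\<forall>u. length u = n \<longrightarrow> u \<noteq> p \<longrightarrow> g u = f u)"
proof -
  define r where "r u = map2 (=) p u" for u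
  have r: "G_morphism n n r"
    using G_morphism_map2[of p "(=)"] by (simp add: r_def[abs_def] p)
  have rr: "r (r u) = u" if "length u = n" for u
    using that p by (auto simp: r_def intro!: nth_equalityI)
  have rp: "r p = ones n"
    using p by (auto simp: r_def intro!: nth_equalityI)
  have "is_cube X n (\<lambda>u. f (r (u[i := False])))" if i: "i < n" for i
  proof -
    have "r (u[i := False]) = (r u)[i := (\<not> p ! i)]" if "length u = n" for u
      using that p i by (auto simp: r_def nth_list_update intro!: nth_equalityI)
    then show ?thesis
      using is_cube_comp[OF f[OF i] r] by (auto intro: is_cube_cong)
  qed
  then obtain g where g: "is_cube X n g" "\<And>u. length u = n \<Longrightarrow> u \<noteq> ones n \<Longrightarrow> g u = f (r u)"
    using complete[of n "\<lambda>u. f (r u)"] by blast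
  have "g (r u) = f u" if "length u = n" "u \<noteq> p" for u
  proof -
    have "r u \<noteq> ones n"
      using that rr p rp by metis
    then show ?thesis
      using g(2)[of "r u"] rr[of u] that p by (simp add: r_def)
  qed
  then show ?thesis
    using is_cube_comp[OF g(1) r] by blast
qed

text \<open>A vertex of least height outside the down-set has everything strictly below it inside,
  so the face below it is a corner and can be completed. Down-sets are expressed through
  \<open>meet\<close> because \<open>meet w\<close> retracts the whole cube onto the face below
  \<open>w\<close>, which makes every hypothesis a statement about dimension
  \<open>n\<close>.\<close>

lemma extend:
  assumes "D \<subseteq> cube n"
    and down: "\<And>u w. w \<in> D \<Longrightarrow> length u = n \<Longrightarrow> meet w u \<in> D"
    and cube: "\<And>w. w \<in> D \<Longrightarrow> is_cube X n (\<lambda>u. f (meet w u))"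
  shows "\<exists>g. is_cube X n g \<and> (\<forall>w\<in>D. g w = f w)"
  using assms
proof (induction "card (cube n - D)" arbitrary: D f rule: less_induct)
  case less
  show ?case
  proof (cases "D = cube n")
    case True
    then have "is_cube X n (\<lambda>u. f (meet (ones n) u))"
      using less.prems(3) by simp
    then have "is_cube X n f"
      by (rule is_cube_cong) (simp add: meet_ones)
    then show ?thesis
      by blast
  next
    case False
    then have "\<exists>w. w \<in> cube n - D"
      using less.prems(1) by blast
    then obtain w where w: "w \<in> cube n - D" "\<And>u. u \<in> cube n - D \<Longrightarrow> height w \<le> height u"
      using ex_has_least_nat[of "\<lambda>w. w \<in> cube n - D" _ height] by blast
    then have lw: "length w = n"
      by simp
    let ?m = "height w"
    have below: "meet w u \<in> D" if "length u = n" "meet w u \<noteq> w" for u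
    proof (rule ccontr)
      assume "meet w u \<notin> D"
      then have "height w \<le> height (meet w u)"
        using that lw by (intro w(2)) simp
      then show False
        using height_meet_less[of u w] that lw by simp
    qed
    have emb_in: "emb w t \<in> D" if "length t = ?m" "t \<noteq> ones ?m" for t
      using below[of "emb w t"] that lw by (simp add: meet_emb emb_eq_self)
    have "is_cube X ?m (\<lambda>t. f (emb w (t[i := False])))" if i: "i < ?m" for i
    proof -
      let ?w = "emb w ((ones ?m)[i := False])"
      have "(ones ?m)[i := False] \<noteq> ones ?m"
        using i by (subst not_ones_iff) auto
      then have "?w \<in> D"
        by (intro emb_in) simp_all
      then have "is_cube X ?m (\<lambda>t. f (meet ?w (emb w t)))"
        using is_cube_comp[OF less.prems(3)] G_morphism_emb[of w] lw by blast
      then show ?thesis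
        by (rule is_cube_cong) (subst emb_update, simp_all)
    qed
    then obtain c where c: "is_cube X ?m c"
      "\<And>t. length t = ?m \<Longrightarrow> t \<noteq> ones ?m \<Longrightarrow> c t = f (emb w t)"
      using complete[of ?m "\<lambda>t. f (emb w t)"] by blast
    define f' where "f' = f(w := c (ones ?m))"
    have f': "f' u = f u" if "u \<in> D" for u
      using that w(1) by (auto simp: f'_def)
    have "\<exists>g. is_cube X n g \<and> (\<forall>v\<in>insert w D. g v = f' v)"
    proof (rule less.hyps[of "insert w D" f'])
      have "cube n - insert w D \<subset> cube n - D"
        using w(1) by blast
      then show "card (cube n - insert w D) < card (cube n - D)"
        by (rule psubset_card_mono[rotated]) simp
      show "insert w D \<subseteq> cube n"
        using less.prems(1) w(1) by blast
      show "meet v u \<in> insert w D" if "v \<in> insert w D" "length u = n" for v u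
        using that below less.prems(2) by blast
      \<comment> \<open>Below the new vertex stands the completed face, pulled back along
        \<open>ret w\<close>. The face below an old vertex stays inside \<open>D\<close> and so does
        not contain \<open>w\<close>.\<close>
      show "is_cube X n (\<lambda>u. f' (meet v u))" if "v \<in> insert w D" for v
      proof (cases "v = w")
        case True
        have "is_cube X n (\<lambda>u. c (ret w u))"
          using is_cube_comp[OF c(1) G_morphism_ret] lw by simp
        moreover have "c (ret w u) = f' (meet w u)" if "length u = n" for u
        proof (cases "ret w u = ones ?m")
          case True
          then have "meet w u = w"
            using emb_ret[of u w] that lw by (simp add: emb_ones)
          then show ?thesis
            using True by (simp add: f'_def)
        next
          case False
          then have "c (ret w u) = f (emb w (ret w u))" "emb w (ret w u) \<in> D"
            using c(2) emb_in by simp_all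
          then show ?thesis
            using f' emb_ret[of u w] that lw by simp
        qed
        ultimately show ?thesis
          unfolding True by (rule is_cube_cong)
      next
        case False
        then have v: "v \<in> D"
          using that by simp
        show ?thesis
          using less.prems(3)[OF v] by (rule is_cube_cong) (simp add: f' less.prems(2) v)
      qed
    qed
    then show ?thesis
      using f' by (metis insertCI)
  qed
qed

end

section \<open>Gluing, grids and the replacement of columns\<close>

lemma G_morphism_flip:
  assumes "j < n"
  shows "G_morphism n n (\<lambda>v. v[j := (\<not> v ! j)])"
proof -
  have "G_morphism n n (\<lambda>v. map2 (\<lambda>h b. h b) ((replicate n id)[j := Not]) v)"
    using G_morphism_map2[of "(replicate n id)[j := Not]" "\<lambda>h b. h b"] by simp
  then show ?thesis
    using assms by (elim G_morphism_cong) (auto simp: nth_list_update intro!: nth_equalityI)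
qed

lemma split_two:
  assumes "length z = Suc n" "j < n"
  obtains x s t y where "z = x @ s # t # y" "length x = j"
proof
  show "z = take j z @ z ! j # z ! Suc j # drop (Suc (Suc j)) z"
    using assms by (simp add: Cons_nth_drop_Suc)
qed (use assms in simp)


text \<open>A list of pairs gives one interval for each coordinate of a grid; \<open>sel ps\<close>
  parametrizes the cell with these sides.\<close>

definition sel :: "('b \<times> 'b) list \<Rightarrow> bool list \<Rightarrow> 'b list" where
  "sel ps v = map2 (\<lambda>p b. if b then snd p else fst p) ps v"

context gspace
begin

text \<open>
  In one more dimension, with two coordinates in place of the \<open>j\<close>-th one, \<open>f\<close> and \<open>g\<close> form two faces that
  meet in the common side; the glued cube is the antidiagonal of an extension of their union.
\<close>

lemma glue:
  assumes f: "is_cube X n f" and g: "is_cube X n g" and j: "j < n"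
    and fg: "\<And>v. length v = n \<Longrightarrow> f (v[j := True]) = g (v[j := False])"
  shows "is_cube X n (\<lambda>v. if v ! j then g v else f v)"
proof -
  \<comment> \<open>Reflecting \<open>f\<close> in coordinate \<open>j\<close> moves the common side
    to where both new coordinates vanish. The two faces then form a down-set, as
    \<open>extend\<close> requires.\<close>
  define F where "F w = (if w ! Suc j then g (delete j w) else f ((delete (Suc j) w)[j := (\<not> w ! j)]))" for w
  define D where "D = {w \<in> cube (Suc n). \<not> (w ! j \<and> w ! Suc j)}"
  have "\<exists>G. is_cube X (Suc n) G \<and> (\<forall>w\<in>D. G w = F w)"
  proof (rule extend)
    show "D \<subseteq> cube (Suc n)"
      by (auto simp: D_def)
    show "meet w u \<in> D" if "w \<in> D" "length u = Suc n" for u w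
      using that j by (auto simp: D_def)
    show "is_cube X (Suc n) (\<lambda>u. F (meet w u))" if w: "w \<in> D" for w
    proof -
      have lw: "length w = Suc n"
        using w by (simp add: D_def)
      have m: "G_morphism (Suc n) (Suc n) (meet w)"
        using G_morphism_map2[of w "(\<and>)"] lw by simp
      consider "\<not> w ! Suc j" | "\<not> w ! j"
        using w by (auto simp: D_def)
      then show ?thesis
      proof cases
        case 1
        have "is_cube X (Suc n) (\<lambda>w. f ((delete (Suc j) w)[j := (\<not> delete (Suc j) w ! j)]))"
          using is_cube_comp[OF is_cube_comp[OF f G_morphism_flip[OF j]] G_morphism_delete[of "Suc j" n]] j
          by simp
        from is_cube_comp[OF this m] show ?thesis
          using 1 lw j by (elim is_cube_cong) (simp add: F_def delete_def nth_append)
      next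
        case 2
        have "is_cube X (Suc n) (\<lambda>w. g (delete j w))"
          using is_cube_comp[OF g G_morphism_delete[of j n]] j by simp
        from is_cube_comp[OF this m] show ?thesis
        proof (rule is_cube_cong)
          fix u :: "bool list" assume u: "length u = Suc n"
          have "length (meet w u) = Suc n"
            using u lw by simp
          from split_two[OF this j] obtain x s t y where z: "meet w u = x @ s # t # y" "length x = j"
            by blast
          have "\<not> meet w u ! j"
            using 2 u lw j by simp
          then have s: "\<not> s"
            using z by (simp add: nth_append)
          have d: "delete (Suc j) (x @ s # t # y) = x @ s # y"
            using delete_append[of "x @ [s]" "Suc j" t y] z(2) by simp
          have "length (meet w u) = Suc n"
            using u lw by simp
          then have "f (x @ True # y) = g (x @ False # y)" if "\<not> t"
            using fg[of "x @ s # y"] z by (simp add: list_update_append)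
          then show "g (delete j (meet w u)) = F (meet w u)"
            using z s d by (auto simp: F_def nth_append)
        qed
      qed
    qed
  qed
  then obtain G where G: "is_cube X (Suc n) G" "\<And>w. w \<in> D \<Longrightarrow> G w = F w"
    by blast
  from is_cube_comp[OF G(1) G_morphism_antidiagonal[OF j]] show ?thesis
  proof (rule is_cube_cong)
    fix v :: "bool list" assume v: "length v = n"
    obtain x t y where z: "v = x @ t # y" "length x = j"
      using id_take_nth_drop[of j v] v j by (metis length_take min.absorb4)
    let ?w = "x @ (\<not> t) # t # y"
    have w: "take j v @ (\<not> v ! j) # drop j v = ?w"
      using z by (simp add: nth_append)
    have d: "delete (Suc j) ?w = x @ (\<not> t) # y"
      using delete_append[of "x @ [\<not> t]" "Suc j" t y] z(2) by simp
    have "?w \<in> D"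
      using z v by (auto simp: D_def nth_append)
    then have "G ?w = F ?w"
      by (rule G)
    also have "\<dots> = (if v ! j then g v else f v)"
      using z d by (auto simp: F_def nth_append)
    finally show "G (take j v @ (\<not> v ! j) # drop j v) = (if v ! j then g v else f v)"
      unfolding w .
  qed
qed

text \<open>
  A map on a grid all of whose small cells are cubes has cubes as its large cells: glue along the
  coordinates one after the other.
\<close>

lemma grid:
  assumes "\<And>ps. length ps = n \<Longrightarrow> \<forall>i<n. ps ! i \<in> S i \<Longrightarrow> is_cube X n (\<lambda>v. f (sel ps v))"
    and "length ps = n" "\<forall>i<n. ps ! i \<in> S i \<union> S i O S i"
  shows "is_cube X n (\<lambda>v. f (sel ps v))"
proof -
  \<comment> \<open>Coordinates below \<open>j\<close> may already use composite intervals from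
    \<open>S i O S i\<close>, the others only basic ones; raising \<open>j\<close> costs one gluing
    along coordinate \<open>j\<close>.\<close>
  have "is_cube X n (\<lambda>v. f (sel ps v))"
    if "j \<le> n" "length ps = n" "\<forall>i<n. ps ! i \<in> (if i < j then S i \<union> S i O S i else S i)" for j ps
    using that
  proof (induction j arbitrary: ps)
    case 0
    then show ?case
      using assms(1) by simp
  next
    case (Suc j)
    then have j: "j < n" and lp: "length ps = n"
      by simp_all
    have pj: "ps ! j \<in> S j \<union> S j O S j"
      using Suc.prems(3) j by auto
    show ?case
    proof (cases "ps ! j \<in> S j")
      case True
      have "ps ! i \<in> (if i < j then S i \<union> S i O S i else S i)" if "i < n" for i
        using Suc.prems(3)[rule_format, OF that] True by (cases "i = j") (auto split: if_splits)
      then show ?thesis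
        using Suc.IH[of ps] j lp by simp
    next
      case False
      then obtain a b c where abc: "ps ! j = (a, c)" "(a, b) \<in> S j" "(b, c) \<in> S j"
        using pj by auto
      have IH: "is_cube X n (\<lambda>v. f (sel (ps[j := q]) v))" if "q \<in> S j" for q
      proof (rule Suc.IH)
        show "\<forall>i<n. ps[j := q] ! i \<in> (if i < j then S i \<union> S i O S i else S i)"
          using Suc.prems(3) that lp by (auto simp: nth_list_update split: if_splits)
      qed (use j lp in simp_all)
      have "is_cube X n (\<lambda>v. if v ! j then f (sel (ps[j := (b, c)]) v) else f (sel (ps[j := (a, b)]) v))"
      proof (rule glue[OF IH[OF abc(2)] IH[OF abc(3)] j])
        fix v :: "bool list" assume "length v = n"
        then have "sel (ps[j := (a, b)]) (v[j := True]) = sel (ps[j := (b, c)]) (v[j := False])"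
          using lp j by (auto simp: sel_def nth_list_update intro!: nth_equalityI)
        then show "f (sel (ps[j := (a, b)]) (v[j := True])) = f (sel (ps[j := (b, c)]) (v[j := False]))"
          by simp
      qed
      then show ?thesis
      proof (rule is_cube_cong)
        fix v :: "bool list" assume v: "length v = n"
        have "sel (ps[j := (b, c)]) v = sel ps v" if "v ! j"
          using that v lp j abc(1) by (auto simp: sel_def nth_list_update intro!: nth_equalityI)
        moreover have "sel (ps[j := (a, b)]) v = sel ps v" if "\<not> v ! j"
          using that v lp j abc(1) by (auto simp: sel_def nth_list_update intro!: nth_equalityI)
        ultimately show "(if v ! j then f (sel (ps[j := (b, c)]) v) else f (sel (ps[j := (a, b)]) v))
            = f (sel ps v)"
          by auto
      qed
    qed
  qed
  from this[of n ps] assms(2,3) show ?thesis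
    by simp
qed

lemma sel_eq_replicate:
  "length ps = length v \<Longrightarrow> sel ps v = replicate (length v) c \<longleftrightarrow>
    (\<forall>i<length v. (if v ! i then snd (ps ! i) else fst (ps ! i)) = c)"
  by (auto simp: sel_def list_eq_iff_nth_eq)

text \<open>
  Arrange reflected copies of \<open>c1\<close> around the vertex \<open>zeros n\<close> and replace one of them by \<open>c2\<close>: the
  outer vertices of this grid form the spike.
\<close>

lemma spike_of_pair:
  assumes c1: "is_cube X n c1" and c2: "is_cube X n c2"
    and eq: "\<And>v. length v = n \<Longrightarrow> v \<noteq> ones n \<Longrightarrow> c1 v = c2 v"
  shows "is_cube X n (\<lambda>v. if v = ones n then c2 (ones n) else c1 (ones n))"
proof -
  \<comment> \<open>Grid coordinates run through 0, 1, 2. Folding sends the middle value to false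
    and both ends to true, so every outer vertex carries the top value of \<open>c1\<close>. The
    vertex with all entries 2 lies in one cell only and may take the top value of
    \<open>c2\<close>.\<close>
  define f where "f t = (if t = replicate n 2 then c2 (ones n) else c1 (map (\<lambda>x. x \<noteq> 1) t))" for t :: "nat list"
  define S where "S i = {(0 :: nat, 1), (1, 2 :: nat)}" for i :: nat
  have "is_cube X n (\<lambda>v. f (sel (replicate n (0, 2)) v))"
  proof (rule grid)
    fix ps :: "(nat \<times> nat) list" assume ps: "length ps = n" "\<forall>i<n. ps ! i \<in> S i"
    show "is_cube X n (\<lambda>v. f (sel ps v))"
    proof (cases "\<forall>i<n. ps ! i = (1, 2)")
      case True
      show ?thesis
        using c2
      proof (rule is_cube_cong)
        fix v :: "bool list" assume v: "length v = n"
        have "sel ps v = replicate n 2 \<longleftrightarrow> v = ones n"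
          using sel_eq_replicate[of ps v 2] ps v True by (auto simp: list_eq_iff_nth_eq)
        moreover have "map (\<lambda>x. x \<noteq> 1) (sel ps v) = v"
          using ps v True by (auto simp: sel_def intro!: nth_equalityI split: if_splits)
        ultimately show "c2 v = f (sel ps v)"
          using eq[OF v] by (simp add: f_def)
      qed
    next
      case False
      then obtain k where k: "k < n" "ps ! k = (0, 1)"
        using ps by (auto simp: S_def)
      \<comment> \<open>A side (0, 1) runs against the orientation of \<open>c1\<close>, since 0
        folds to true and 1 to false.\<close>
      have "is_cube X n (\<lambda>v. c1 (map2 (\<lambda>p b. if p = (0, 1) then \<not> b else b) ps v))"
        using is_cube_comp[OF c1] G_morphism_map2[of ps] ps(1) by simp
      then show ?thesis
      proof (rule is_cube_cong)
        fix v :: "bool list" assume v: "length v = n"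
        have "sel ps v \<noteq> replicate n 2"
          using sel_eq_replicate[of ps v 2] ps v k by (auto intro!: exI[of _ k])
        moreover have "map (\<lambda>x. x \<noteq> 1) (sel ps v) = map2 (\<lambda>p b. if p = (0, 1) then \<not> b else b) ps v"
        proof (rule nth_equalityI)
          fix i assume "i < length (map (\<lambda>x. x \<noteq> 1) (sel ps v))"
          then have i: "i < n"
            using ps v by (simp add: sel_def)
          then have "ps ! i = (0, 1) \<or> ps ! i = (1, 2)"
            using ps by (simp add: S_def)
          then show "map (\<lambda>x. x \<noteq> 1) (sel ps v) ! i = map2 (\<lambda>p b. if p = (0, 1) then \<not> b else b) ps v ! i"
            using i ps v by (auto simp: sel_def)
        qed (simp add: sel_def)
        ultimately show "c1 (map2 (\<lambda>p b. if p = (0, 1) then \<not> b else b) ps v) = f (sel ps v)"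
          by (simp add: f_def)
      qed
    qed
  next
    show "\<forall>i<n. replicate n (0, 2) ! i \<in> S i \<union> S i O S i"
      by (auto simp: S_def)
  qed simp
  then show ?thesis
  proof (rule is_cube_cong)
    fix v :: "bool list" assume v: "length v = n"
    have "sel (replicate n (0, 2)) v = replicate n (2 :: nat) \<longleftrightarrow> v = ones n"
    proof -
      have "sel (replicate n (0, 2)) v = map (\<lambda>b. if b then 2 else 0 :: nat) v"
        using v by (auto simp: sel_def intro!: nth_equalityI)
      then show ?thesis
        using v by (auto simp: list_eq_iff_nth_eq split: if_splits)
    qed
    moreover have "map (\<lambda>x. x \<noteq> 1) (sel (replicate n (0, 2 :: nat)) v) = ones n"
      using v by (auto simp: sel_def intro!: nth_equalityI split: if_splits)
    ultimately show "f (sel (replicate n (0, 2)) v) = (if v = ones n then c2 (ones n) else c1 (ones n))"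
      by (simp add: f_def)
  qed
qed

text \<open>The last \<open>r\<close> coordinates are subdivided by 0, 1, 2, with \<open>c\<close>
  kept constant between 1 and 2. In the cell whose last sides are all (1, 2) the stretched
  \<open>c\<close> is constant in those directions, and \<open>d\<close> agrees with it except over
  the outermost vertex, so \<open>d\<close> can take its place. The outer vertices of the grid then
  show the column of \<open>d\<close> inside \<open>c\<close>.\<close>

lemma replace_top_column:
  assumes c: "is_cube X (m + r) c" and d: "is_cube X (m + r) d"
    and eq: "\<And>u v. length u = m \<Longrightarrow> length v = r \<Longrightarrow> v \<noteq> ones r \<Longrightarrow> d (u @ v) = c (u @ ones r)"
  shows "is_cube X (m + r) (\<lambda>w. if drop m w = ones r then d w else c w)"
proof -
  define f where "f t = (if drop m t = replicate r 2 then d (map (\<lambda>x. x \<noteq> 0) t)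
    else c (map (\<lambda>x. x \<noteq> 0) t))" for t :: "nat list"
  define S where "S i = (if i < m then {(0 :: nat, 2)} else {(0, 1), (1, 2 :: nat)})" for i :: nat
  have dr: "drop m (sel ps v) = replicate r 2 \<longleftrightarrow>
      (\<forall>i<r. (if v ! (m + i) then snd (ps ! (m + i)) else fst (ps ! (m + i))) = 2)"
    if "length ps = m + r" "length v = m + r" for ps :: "(nat \<times> nat) list" and v
    using that by (auto simp: sel_def list_eq_iff_nth_eq)
  have dv: "drop m v = ones r \<longleftrightarrow> (\<forall>i<r. v ! (m + i))" if "length v = m + r" for v
    using that by (auto simp: list_eq_iff_nth_eq)
  have "is_cube X (m + r) (\<lambda>v. f (sel (replicate (m + r) (0, 2)) v))"
  proof (rule grid)
    fix ps :: "(nat \<times> nat) list" assume ps: "length ps = m + r" "\<forall>i<m + r. ps ! i \<in> S i"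
    have p1: "ps ! i = (0, 2)" if "i < m" for i
      using ps(2)[rule_format, of i] that by (simp add: S_def)
    have p2: "ps ! i = (0, 1) \<or> ps ! i = (1, 2)" if "m \<le> i" "i < m + r" for i
      using ps(2)[rule_format, of i] that by (simp add: S_def)
    show "is_cube X (m + r) (\<lambda>v. f (sel ps v))"
    proof (cases "\<forall>i<r. ps ! (m + i) = (1, 2)")
      case True
      show ?thesis
        using d
      proof (rule is_cube_cong)
        fix v :: "bool list" assume v: "length v = m + r"
        have 1: "drop m (sel ps v) = replicate r 2 \<longleftrightarrow> drop m v = ones r"
          using True by (auto simp: dr[OF ps(1) v] dv[OF v])
        have 2: "map (\<lambda>x. x \<noteq> 0) (sel ps v) = take m v @ ones r"
        proof (rule nth_equalityI)
          fix i assume "i < length (map (\<lambda>x. x \<noteq> 0) (sel ps v))"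
          then have i: "i < m + r"
            using ps v by (simp add: sel_def)
          show "map (\<lambda>x. x \<noteq> 0) (sel ps v) ! i = (take m v @ ones r) ! i"
          proof (cases "i < m")
            case True
            then show ?thesis
              using p1[OF True] i ps v by (simp add: sel_def nth_append)
          next
            case False
            then obtain l where "i = m + l" "l < r"
              using i by (metis add_less_cancel_left le_Suc_ex not_le)
            then show ?thesis
              using \<open>\<forall>i<r. ps ! (m + i) = (1, 2)\<close> ps v by (auto simp: sel_def nth_append)
          qed
        qed (use ps v in \<open>simp add: sel_def\<close>)
        have "take m v @ drop m v = v"
          by simp
        then show "d v = f (sel ps v)"
          using eq[of "take m v" "drop m v"] v 2 unfolding f_def 1 by (cases "drop m v = ones r") auto
      qed
    next
      case False
      then obtain k where k: "k < r" "ps ! (m + k) = (0, 1)"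
        using p2 by (metis add_less_cancel_left le_add1)
      \<comment> \<open>A side (1, 2) freezes its coordinate at true, so this cell is a degenerate
        copy of \<open>c\<close>.\<close>
      have "is_cube X (m + r) (\<lambda>v. c (map2 (\<lambda>p b. p = (1, 2) \<or> b) ps v))"
        using is_cube_comp[OF c] G_morphism_map2[of ps] ps(1) by simp
      then show ?thesis
      proof (rule is_cube_cong)
        fix v :: "bool list" assume v: "length v = m + r"
        have "drop m (sel ps v) \<noteq> replicate r 2"
          using k by (auto simp: dr[OF ps(1) v] intro!: exI[of _ k])
        moreover have "map (\<lambda>x. x \<noteq> 0) (sel ps v) = map2 (\<lambda>p b. p = (1, 2) \<or> b) ps v"
        proof (rule nth_equalityI)
          fix i assume "i < length (map (\<lambda>x. x \<noteq> 0) (sel ps v))"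
          then have i: "i < m + r"
            using ps v by (simp add: sel_def)
          then have "ps ! i = (0, 2) \<or> ps ! i = (0, 1) \<or> ps ! i = (1, 2)"
            using p1[of i] p2[of i] by linarith
          then show "map (\<lambda>x. x \<noteq> 0) (sel ps v) ! i = map2 (\<lambda>p b. p = (1, 2) \<or> b) ps v ! i"
            using i ps v by (auto simp: sel_def)
        qed (simp add: sel_def)
        ultimately show "c (map2 (\<lambda>p b. p = (1, 2) \<or> b) ps v) = f (sel ps v)"
          by (simp add: f_def)
      qed
    qed
  next
    show "\<forall>i<m + r. replicate (m + r) (0, 2) ! i \<in> S i \<union> S i O S i"
      by (auto simp: S_def)
  qed simp
  then show ?thesis
  proof (rule is_cube_cong)
    fix v :: "bool list" assume v: "length v = m + r"
    have "drop m (sel (replicate (m + r) (0, 2)) v) = replicate r (2 :: nat) \<longleftrightarrow> drop m v = ones r"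
      using dr[of "replicate (m + r) (0, 2)" v] dv[OF v] v by auto
    moreover have "map (\<lambda>x. x \<noteq> 0) (sel (replicate (m + r) (0, 2 :: nat)) v) = v"
      using v by (auto simp: sel_def intro!: nth_equalityI split: if_splits)
    ultimately show "f (sel (replicate (m + r) (0, 2)) v) = (if drop m v = ones r then d v else c v)"
      by (simp add: f_def)
  qed
qed

text \<open>Reflections in the last \<open>r\<close> coordinates move the column from
  \<open>ones r\<close> to any \<open>q\<close>. The case \<open>m = 0\<close> changes one vertex,
  the case \<open>m = 1\<close> both ends of an edge in the first direction.\<close>

lemma replace_column:
  assumes c: "is_cube X (m + r) c" and d: "is_cube X (m + r) d" and q: "length q = r"
    and eq: "\<And>u v. length u = m \<Longrightarrow> length v = r \<Longrightarrow> v \<noteq> q \<Longrightarrow> d (u @ v) = c (u @ q)"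
  shows "is_cube X (m + r) (\<lambda>w. if drop m w = q then d w else c w)"
proof -
  define \<rho> where "\<rho> w = map2 (=) (ones m @ q) w" for w
  define \<sigma> where "\<sigma> v = map2 (=) q v" for v
  have \<rho>: "G_morphism (m + r) (m + r) \<rho>"
    using G_morphism_map2[of "ones m @ q" "(=)"] by (simp add: \<rho>_def[abs_def] q)
  have \<rho>\<rho>: "\<rho> (\<rho> w) = w" if "length w = m + r" for w
    using that q by (auto simp: \<rho>_def intro!: nth_equalityI)
  have \<rho>_append: "\<rho> (u @ v) = u @ \<sigma> v" if "length u = m" "length v = r" for u v
    using that q by (auto simp: \<rho>_def \<sigma>_def nth_append intro!: nth_equalityI)
  have \<sigma>\<sigma>: "\<sigma> (\<sigma> v) = v" if "length v = r" for v
    using that q by (auto simp: \<sigma>_def intro!: nth_equalityI)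
  have \<sigma>q: "\<sigma> q = ones r" and \<sigma>1: "\<sigma> (ones r) = q"
    using q by (auto simp: \<sigma>_def intro!: nth_equalityI)
  have "is_cube X (m + r) (\<lambda>w. if drop m w = ones r then d (\<rho> w) else c (\<rho> w))"
  proof (rule replace_top_column[OF is_cube_comp[OF c \<rho>] is_cube_comp[OF d \<rho>]])
    fix u v :: "bool list" assume uv: "length u = m" "length v = r" "v \<noteq> ones r"
    then have "\<sigma> v \<noteq> q"
      using \<sigma>\<sigma> \<sigma>q by metis
    then show "d (\<rho> (u @ v)) = c (\<rho> (u @ ones r))"
      using eq[of u "\<sigma> v"] uv q by (simp add: \<rho>_append \<sigma>1) (simp add: \<sigma>_def)
  qed
  from is_cube_comp[OF this \<rho>] show ?thesis
  proof (rule is_cube_cong)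
    fix w :: "bool list" assume w: "length w = m + r"
    have "\<rho> w = take m w @ \<sigma> (drop m w)"
      using \<rho>_append[of "take m w" "drop m w"] w by simp
    then have "drop m (\<rho> w) = \<sigma> (drop m w)"
      using w by simp
    moreover have "\<sigma> (drop m w) = ones r \<longleftrightarrow> drop m w = q"
      using \<sigma>\<sigma>[of "drop m w"] \<sigma>1 \<sigma>q w by auto
    ultimately show "(if drop m (\<rho> w) = ones r then d (\<rho> (\<rho> w)) else c (\<rho> (\<rho> w)))
        = (if drop m w = q then d w else c w)"
      using \<rho>\<rho>[OF w] by simp
  qed
qed

end


section \<open>The relations \<open>\<sim>_i\<close>\<close>

lemma reflect_eq_ones: "length p = n \<Longrightarrow> length v = n \<Longrightarrow> map2 (=) p v = ones n \<longleftrightarrow> v = p"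
  by (auto simp: list_eq_iff_nth_eq)

context gspace
begin

lemma is_cube_map2: "is_cube X n f \<Longrightarrow> length hs = n \<Longrightarrow> is_cube X n (\<lambda>v. f (map2 g hs v))"
  using is_cube_comp[of n f n "\<lambda>v. map2 g hs v"] G_morphism_map2[of hs g] by blast

lemma simI:
  assumes "is_cube X (Suc i) c" "is_cube X (Suc i) d"
    and "\<And>v. length v = Suc i \<Longrightarrow> v \<noteq> ones (Suc i) \<Longrightarrow> c v = d v"
  shows "(c (ones (Suc i)), d (ones (Suc i))) \<in> sim X i"
proof -
  let ?c = "restrict c (cube (Suc i))" and ?d = "restrict d (cube (Suc i))"
  have "c (ones (Suc i)) \<in> points X" "d (ones (Suc i)) \<in> points X"
    using assms is_cube_points by simp_all
  moreover have "?c \<in> cubes X (Suc i)" "?d \<in> cubes X (Suc i)"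
    using assms by (simp_all add: is_cube_def)
  moreover have "\<forall>v\<in>punctured_cube (Suc i). ?c v = ?d v"
    using assms(3) by (simp add: punctured_cube_def)
  moreover have "?c (ones (Suc i)) = c (ones (Suc i))" "?d (ones (Suc i)) = d (ones (Suc i))"
    by simp_all
  ultimately show ?thesis
    unfolding sim_def Suc_eq_plus1[symmetric] mem_Collect_eq case_prod_conv by blast
qed

lemma simE:
  assumes "(x, y) \<in> sim X i"
  obtains c d where "is_cube X (Suc i) c" "is_cube X (Suc i) d" "c (ones (Suc i)) = x" "d (ones (Suc i)) = y"
    "\<And>v. length v = Suc i \<Longrightarrow> v \<noteq> ones (Suc i) \<Longrightarrow> c v = d v"
  using assms unfolding sim_def punctured_cube_def
  by (auto dest!: cubes_is_cube)

text \<open>Spikes are a normal form: the two witnessing cubes can be traded for one that is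
  constant off the top, and conversely the constant cube serves as the second witness.\<close>

lemma sim_iff:
  "(x, y) \<in> sim X i \<longleftrightarrow> x \<in> points X \<and> y \<in> points X \<and>
    is_cube X (Suc i) (\<lambda>v. if v = ones (Suc i) then y else x)"
proof
  assume "(x, y) \<in> sim X i"
  then obtain c d where cd: "is_cube X (Suc i) c" "is_cube X (Suc i) d" "c (ones (Suc i)) = x"
    "d (ones (Suc i)) = y" "\<And>v. length v = Suc i \<Longrightarrow> v \<noteq> ones (Suc i) \<Longrightarrow> c v = d v"
    by (rule simE) blast
  have "x \<in> points X" "y \<in> points X"
    using is_cube_points[OF cd(1)] is_cube_points[OF cd(2)] cd(3,4) length_ones(1) by blast+
  then show "x \<in> points X \<and> y \<in> points X \<and> is_cube X (Suc i) (\<lambda>v. if v = ones (Suc i) then y else x)"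
    using spike_of_pair[OF cd(1,2,5)] unfolding cd(3,4) by blast
next
  assume a: "x \<in> points X \<and> y \<in> points X \<and> is_cube X (Suc i) (\<lambda>v. if v = ones (Suc i) then y else x)"
  have "((\<lambda>_. x) (ones (Suc i)), (\<lambda>v. if v = ones (Suc i) then y else x) (ones (Suc i))) \<in> sim X i"
    using a is_cube_const by (intro simI) auto
  then show "(x, y) \<in> sim X i"
    by simp
qed

lemma sim_vertex:
  assumes "(x, y) \<in> sim X i" "length p = Suc i"
  shows "is_cube X (Suc i) (\<lambda>v. if v = p then y else x)"
proof -
  have "is_cube X (Suc i) (\<lambda>v. if v = ones (Suc i) then y else x)"
    using assms(1) by (simp add: sim_iff)
  from is_cube_map2[OF this assms(2), of "(=)"] show ?thesis
    by (rule is_cube_cong) (simp add: reflect_eq_ones assms(2))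
qed

lemma sim_vertex_iff:
  assumes "length p = Suc i"
  shows "(x, y) \<in> sim X i \<longleftrightarrow> x \<in> points X \<and> y \<in> points X \<and> is_cube X (Suc i) (\<lambda>v. if v = p then y else x)"
proof
  assume a: "x \<in> points X \<and> y \<in> points X \<and> is_cube X (Suc i) (\<lambda>v. if v = p then y else x)"
  then have "is_cube X (Suc i) (\<lambda>v. if map2 (=) p v = p then y else x)"
    using is_cube_map2[OF _ assms] by blast
  moreover have "map2 (=) p v = p \<longleftrightarrow> v = ones (Suc i)" if "length v = Suc i" for v
    using that assms by (auto simp: list_eq_iff_nth_eq)
  ultimately show "(x, y) \<in> sim X i"
    unfolding sim_iff using a by (auto elim!: is_cube_cong)
qed (use assms sim_vertex sim_iff in blast)

lemma sim_points: "(x, y) \<in> sim X i \<Longrightarrow> x \<in> points X \<and> y \<in> points X"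
  by (simp add: sim_iff)

lemma sim_refl: "x \<in> points X \<Longrightarrow> (x, x) \<in> sim X i"
  by (simp add: sim_iff is_cube_const)

lemma sim_sym:
  assumes "(x, y) \<in> sim X i"
  shows "(y, x) \<in> sim X i"
  using assms
proof (rule simE)
  fix c d
  assume "is_cube X (Suc i) c" "is_cube X (Suc i) d" "c (ones (Suc i)) = x" "d (ones (Suc i)) = y"
    "\<And>v. length v = Suc i \<Longrightarrow> v \<noteq> ones (Suc i) \<Longrightarrow> c v = d v"
  then show ?thesis
    using simI[of i d c] by simp
qed

text \<open>Two spikes over the middle point \<open>y\<close> agree off the top, so they directly
  witness the relation between their tips.\<close>

lemma sim_trans:
  assumes "(x, y) \<in> sim X i" "(y, z) \<in> sim X i"
  shows "(x, z) \<in> sim X i"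
proof -
  have "is_cube X (Suc i) (\<lambda>v. if v = ones (Suc i) then x else y)"
    "is_cube X (Suc i) (\<lambda>v. if v = ones (Suc i) then z else y)"
    using sim_sym[OF assms(1)] assms(2) by (simp_all add: sim_iff)
  from simI[OF this] show ?thesis
    by simp
qed

lemma equiv_sim: "equiv (points X) (sim X i)"
  by (intro equivI refl_onI symI transI)
    (auto simp: sim_refl dest: sim_points intro: sim_sym sim_trans)

lemma sim_class_eq: "x \<in> points X \<Longrightarrow> y \<in> points X \<Longrightarrow> sim X i `` {x} = sim X i `` {y} \<longleftrightarrow> (x, y) \<in> sim X i"
  using eq_equiv_class_iff[OF equiv_sim] by blast

text \<open>Fixing the first \<open>i - j\<close> coordinates at true restricts a spike of dimension
  \<open>i + 1\<close> at the top to one of dimension \<open>j + 1\<close>.\<close>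

lemma sim_antimono:
  assumes "j \<le> i"
  shows "sim X i \<subseteq> sim X j"
proof
  fix p assume "p \<in> sim X i"
  then obtain x y where p: "p = (x, y)" "(x, y) \<in> sim X i"
    by (cases p) auto
  then have xy: "x \<in> points X" "y \<in> points X" "is_cube X (Suc i) (\<lambda>v. if v = ones (Suc i) then y else x)"
    by (simp_all add: sim_iff)
  have "G_morphism (Suc j) (Suc i) (\<lambda>t. ones (i - j) @ t)"
    using G_morphism_append[of "Suc j" "ones (i - j)"] assms by simp
  from is_cube_comp[OF xy(3) this]
  have "is_cube X (Suc j) (\<lambda>t. if ones (i - j) @ t = ones (Suc i) then y else x)" .
  moreover have "ones (i - j) @ t = ones (Suc i) \<longleftrightarrow> t = ones (Suc j)" for t
  proof -
    have "ones (Suc i) = ones (i - j) @ ones (Suc j)"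
      using assms by (simp add: ones_def flip: replicate_add replicate_Suc)
    then show ?thesis
      by simp
  qed
  ultimately show "p \<in> sim X j"
    using p xy by (simp add: sim_iff)
qed

lemma sim_0: "sim X 0 = points X \<times> points X"
  using is_cube_1 by (auto simp: sim_iff)

text \<open>Column replacement with \<open>m = 0\<close>; the inserted cube is the spike at
  \<open>p\<close> over the old value \<open>f p\<close>.\<close>

lemma sim_replace_vertex:
  assumes "is_cube X (Suc i) f" "length p = Suc i" "(f p, y) \<in> sim X i"
  shows "is_cube X (Suc i) (f(p := y))"
  using replace_column[of 0 "Suc i" f "\<lambda>v. if v = p then y else f p" p] assms
    sim_vertex[OF assms(3,2)]
  by (auto elim!: is_cube_cong)

lemma sim_replace_top:
  assumes f: "is_cube X (Suc i) f" and fg: "\<And>v. length v = Suc i \<Longrightarrow> (f v, g v) \<in> sim X i"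
  shows "is_cube X (Suc i) g"
proof -
  have "is_cube X (Suc i) (\<lambda>v. if v \<in> A then g v else f v)" if "A \<subseteq> cube (Suc i)" for A
    using finite_subset[OF that finite_cube] that
  proof induction
    case empty
    then show ?case
      using f by simp
  next
    case (insert p A)
    then have "is_cube X (Suc i) ((\<lambda>v. if v \<in> A then g v else f v)(p := g p))"
      using fg by (intro sim_replace_vertex) auto
    then show ?case
      by (rule is_cube_cong) simp
  qed
  from this[of "cube (Suc i)"] show ?thesis
    by (auto elim: is_cube_cong)
qed

text \<open>A cube of lower dimension is padded with coordinates in front and recovered as a face,
  which reduces the claim to dimension \<open>Suc i\<close>.\<close>

lemma sim_replace:
  assumes f: "is_cube X n f" and n: "n \<le> Suc i" and fg: "\<And>v. length v = n \<Longrightarrow> (f v, g v) \<in> sim X i"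
  shows "is_cube X n g"
proof -
  define m where "m = Suc i - n"
  have m: "m + n = Suc i"
    using n by (simp add: m_def)
  have "is_cube X (Suc i) (\<lambda>v. f (drop m v))"
    using is_cube_comp[OF f G_morphism_drop[of m n]] m by simp
  then have "is_cube X (Suc i) (\<lambda>v. g (drop m v))"
    by (rule sim_replace_top) (use m in \<open>auto intro!: fg\<close>)
  moreover have "G_morphism n (Suc i) (\<lambda>v. ones m @ v)"
    using G_morphism_append[of n "ones m"] m by simp
  ultimately have "is_cube X n (\<lambda>v. g (drop m (ones m @ v)))"
    by (rule is_cube_comp[of "Suc i" "\<lambda>v. g (drop m v)"])
  then show ?thesis
    by simp
qed

text \<open>Above height \<open>i\<close> every vertex is the top of an (i+1)-dimensional face whose
  other vertices are lower. By induction the two cubes are equivalent there, and replacement within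
  classes makes them equal there. Only the tops differ, which is the definition of the
  relation.\<close>

lemma sim_det:
  assumes f: "is_cube X n f" and g: "is_cube X n g"
    and low: "\<And>v. length v = n \<Longrightarrow> height v \<le> i \<Longrightarrow> (f v, g v) \<in> sim X i"
    and "length v = n"
  shows "(f v, g v) \<in> sim X i"
  using \<open>length v = n\<close>
proof (induction "height v" arbitrary: v rule: less_induct)
  case less
  show ?case
  proof (cases "height v \<le> i")
    case True
    then show ?thesis
      using low less.prems by simp
  next
    case False
    define m where "m = height v - Suc i"
    have m: "m + Suc i = height v"
      using False by (simp add: m_def)
    \<comment> \<open>Only the last \<open>i + 1\<close> true positions of \<open>v\<close> vary;
      the others stay true, so the top of this face is \<open>v\<close>.\<close>
    define \<phi> where "\<phi> t = emb v (ones m @ t)" for t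
    have \<phi>: "is_cube X (Suc i) (\<lambda>t. h (\<phi> t))" if "is_cube X n h" for h
      using is_cube_comp[OF is_cube_comp[OF that] G_morphism_append[of "Suc i" "ones m"]]
        G_morphism_emb[of v] m less.prems by (simp add: \<phi>_def)
    have ones: "ones (height v) = ones m @ ones (Suc i)"
      by (simp add: ones_def flip: m replicate_add replicate_Suc)
    have \<phi>1: "\<phi> (ones (Suc i)) = v"
      unfolding \<phi>_def by (simp only: emb_ones flip: ones)
    have IH: "(f (\<phi> t), g (\<phi> t)) \<in> sim X i" if t: "length t = Suc i" "t \<noteq> ones (Suc i)" for t
    proof (rule less.hyps)
      show "length (\<phi> t) = n"
        using less.prems by (simp add: \<phi>_def)
      have l: "length (ones m @ t) = height v"
        using t m by simp
      have "\<phi> t \<noteq> v"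
        unfolding \<phi>_def emb_eq_self[OF l] ones using t by simp
      then show "height (\<phi> t) < height v"
        using height_meet_less[of "\<phi> t" v] meet_emb[OF l] by (simp add: \<phi>_def)
    qed
    have "is_cube X (Suc i) (\<lambda>t. if t = ones (Suc i) then g (\<phi> t) else f (\<phi> t))"
      using \<phi>[OF g]
      by (rule sim_replace_top) (auto intro: IH sim_sym sim_refl is_cube_points[OF \<phi>[OF g]])
    from simI[OF \<phi>[OF f] this] show ?thesis
      using \<phi>1 by simp
  qed
qed

section \<open>The factor by the relation of index k is a k-step groupspace\<close>

lemma factor_is_cube:
  "is_cube (factor X R) n f \<longleftrightarrow> (\<exists>c. is_cube X n c \<and> (\<forall>v. length v = n \<longrightarrow> f v = R `` {c v}))"
proof
  assume "is_cube (factor X R) n f"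
  then obtain c where c: "c \<in> cubes X n" "restrict f (cube n) = compose (cube n) (\<lambda>x. R `` {x}) c"
    by (auto simp: is_cube_def factor_def)
  have "f v = R `` {c v}" if "length v = n" for v
    using fun_cong[OF c(2), of v] that by (simp add: compose_def)
  then show "\<exists>c. is_cube X n c \<and> (\<forall>v. length v = n \<longrightarrow> f v = R `` {c v})"
    using cubes_is_cube[OF c(1)] by blast
next
  assume "\<exists>c. is_cube X n c \<and> (\<forall>v. length v = n \<longrightarrow> f v = R `` {c v})"
  then obtain c where c: "is_cube X n c" "\<And>v. length v = n \<Longrightarrow> f v = R `` {c v}"
    by blast
  have "restrict f (cube n) = compose (cube n) (\<lambda>x. R `` {x}) (restrict c (cube n))"
    unfolding compose_def using c(2) by (intro restrict_ext) simp
  then show "is_cube (factor X R) n f"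
    using c(1) by (auto simp: is_cube_def factor_def)
qed

lemma points_factor: "points (factor X R) = points X // R"
  by (simp add: factor_def)

text \<open>
  Up to height \<open>k + 1\<close> every choice of representatives is a cube on each face, by \<open>sim_replace\<close>; above
  that height \<open>sim_det\<close> forces any completion into the right class.
\<close>

lemma level_complete:
  assumes f: "\<And>i. i < n \<Longrightarrow> is_cube (level X k) n (\<lambda>u. f (u[i := False]))"
  shows "\<exists>g. is_cube (level X k) n g \<and> (\<forall>u. length u = n \<longrightarrow> u \<noteq> ones n \<longrightarrow> g u = f u)"
proof -
  \<comment> \<open>A vertex \<open>w\<close> other than the top has a false coordinate
    \<open>i\<close>, so the face below it lies in the \<open>i\<close>-th lower face, where a lift
    to \<open>X\<close> is given.\<close>
  have face: "\<exists>c. is_cube X n c \<and> (\<forall>u. length u = n \<longrightarrow> f (meet w u) = sim X k `` {c u})"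
    if w: "length w = n" "w \<noteq> ones n" for w
  proof -
    obtain i where i: "i < n" "\<not> w ! i"
      using not_ones_iff[OF w(1)] w(2) by blast
    obtain c where c: "is_cube X n c" "\<And>u. length u = n \<Longrightarrow> f (u[i := False]) = sim X k `` {c u}"
      using f[OF i(1)] unfolding factor_is_cube by blast
    have "is_cube X n (\<lambda>u. c (meet w u))"
      using is_cube_map2[OF c(1) w(1)] .
    moreover have "f (meet w u) = sim X k `` {c (meet w u)}" if "length u = n" for u
    proof -
      have "\<not> meet w u ! i"
        using i that w by simp
      then have "(meet w u)[i := False] = meet w u"
        by (metis (full_types) list_update_id)
      then show ?thesis
        using c(2)[of "meet w u"] that w by simp
    qed
    ultimately show ?thesis
      by blast
  qed
  have "\<exists>x. x \<in> points X \<and> f u = sim X k `` {x}" if "length u = n" "u \<noteq> ones n" for u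
  proof -
    from face[OF that] obtain c
      where "is_cube X n c" "\<And>v. length v = n \<Longrightarrow> f (meet u v) = sim X k `` {c v}"
      by blast
    moreover have "meet u u = u"
      by (rule nth_equalityI) auto
    ultimately show ?thesis
      using is_cube_points that by metis
  qed
  then obtain l where l: "\<And>u. length u = n \<Longrightarrow> u \<noteq> ones n \<Longrightarrow> l u \<in> points X"
    "\<And>u. length u = n \<Longrightarrow> u \<noteq> ones n \<Longrightarrow> f u = sim X k `` {l u}"
    by metis
  have meet_ne: "meet w u \<noteq> ones n" if "length w = n" "w \<noteq> ones n" "length u = n" for w u
    using that by (auto simp: list_eq_iff_nth_eq)
  define D where "D = {w \<in> cube n. w \<noteq> ones n \<and> height w \<le> Suc k}"
  have "\<exists>g. is_cube X n g \<and> (\<forall>w\<in>D. g w = l w)"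
  proof (rule extend)
    show "D \<subseteq> cube n"
      by (auto simp: D_def)
    show "meet w u \<in> D" if "w \<in> D" "length u = n" for u w
      using that meet_ne height_meet_le[of u w] by (auto simp: D_def)
    show "is_cube X n (\<lambda>u. l (meet w u))" if w: "w \<in> D" for w
    proof -
      have w': "length w = n" "w \<noteq> ones n" "height w \<le> Suc k"
        using w by (simp_all add: D_def)
      obtain c where c: "is_cube X n c" "\<And>u. length u = n \<Longrightarrow> f (meet w u) = sim X k `` {c u}"
        using face[OF w'(1,2)] by blast
      have "(c u, l (meet w u)) \<in> sim X k" if "length u = n" for u
        using c(2)[OF that] l[of "meet w u"] meet_ne[OF w'(1,2) that] that w' is_cube_points[OF c(1) that]
        by (subst sim_class_eq[symmetric]) simp_all
      moreover have "is_cube X (height w) (\<lambda>t. c (emb w t))"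
        using is_cube_comp[OF c(1)] G_morphism_emb[of w] w' by blast
      ultimately have "is_cube X (height w) (\<lambda>t. l (emb w t))"
        using w' by (elim sim_replace[where i = k]) (metis length_emb meet_emb)+
      then have "is_cube X n (\<lambda>u. l (emb w (ret w u)))"
        using is_cube_comp G_morphism_ret[of w] w'(1) by blast
      then show ?thesis
        by (rule is_cube_cong) (simp add: emb_ret w')
    qed
  qed
  then obtain g where g: "is_cube X n g" "\<And>w. w \<in> D \<Longrightarrow> g w = l w"
    by blast
  have "sim X k `` {g u} = f u" if u: "length u = n" "u \<noteq> ones n" for u
  proof -
    obtain c where c: "is_cube X n c" "\<And>v. length v = n \<Longrightarrow> f (meet u v) = sim X k `` {c v}"
      using face[OF u] by blast
    have "is_cube X n (\<lambda>v. g (meet u v))"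
      using is_cube_map2[OF g(1) u(1)] .
    then have "(g (meet u v), c v) \<in> sim X k" if "length v = n" for v
      using c(1) _ that
    proof (rule sim_det)
      fix v :: "bool list" assume v: "length v = n" "height v \<le> k"
      have "height (meet u v) \<le> height v"
        using height_meet_le[of u v] u v by (simp add: zip_commute[of u v] case_prod_beta' conj_commute comp_def)
      then have "meet u v \<in> D"
        using meet_ne[OF u v(1)] u v by (simp add: D_def)
      then have "sim X k `` {g (meet u v)} = sim X k `` {c v}"
        using g(2) l(2)[of "meet u v"] meet_ne[OF u v(1)] c(2)[OF v(1)] u v by simp
      then show "(g (meet u v), c v) \<in> sim X k"
        using is_cube_points[OF g(1), of "meet u v"] is_cube_points[OF c(1) v(1)] u v
        by (simp add: sim_class_eq)
    qed
    from this[OF u(1)] have "sim X k `` {g (meet u u)} = f (meet u u)"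
      using sim_points sim_class_eq c(2)[OF u(1)] by metis
    moreover have "meet u u = u"
      by (rule nth_equalityI) auto
    ultimately show ?thesis
      by simp
  qed
  then show ?thesis
    using g(1) by (intro exI[of _ "\<lambda>u. sim X k `` {g u}"]) (auto simp: factor_is_cube)
qed

lemma groupspace_level: "groupspace (level X k)"
proof (rule groupspaceI)
  show "is_cube_structure (level X k)"
    unfolding is_cube_structure_def
  proof (intro allI subsetI)
    fix n c assume "c \<in> cubes (level X k) n"
    then obtain d where d: "d \<in> cubes X n" "c = compose (cube n) (\<lambda>x. sim X k `` {x}) d"
      by (auto simp: factor_def)
    then have "d v \<in> points X" if "length v = n" for v
      using is_cube_points cubes_is_cube that by blast
    then show "c \<in> cube n \<rightarrow>\<^sub>E points (level X k)"
      unfolding d(2) compose_def points_factor by (auto intro!: quotientI)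
  qed
next
  fix n m f \<phi> assume "is_cube (level X k) m f" and \<phi>: "G_morphism n m \<phi>"
  then obtain c where c: "is_cube X m c" "\<And>v. length v = m \<Longrightarrow> f v = sim X k `` {c v}"
    by (auto simp: factor_is_cube)
  have "length (\<phi> v) = m" if "length v = n" for v
    using \<phi> that by (auto simp: G_morphism_def Pi_def)
  then show "is_cube (level X k) n (\<lambda>v. f (\<phi> v))"
    using is_cube_comp[OF c(1) \<phi>] c(2) by (auto simp: factor_is_cube)
next
  fix f assume "\<And>v :: bool list. length v = 1 \<Longrightarrow> f v \<in> points (level X k)"
  then have "\<exists>x. x \<in> points X \<and> f v = sim X k `` {x}" if "length v = 1" for v
    using that unfolding points_factor by (auto elim!: quotientE)
  then obtain c where "\<And>v. length v = 1 \<Longrightarrow> c v \<in> points X \<and> f v = sim X k `` {c v}"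
    by metis
  then show "is_cube (level X k) 1 f"
    unfolding factor_is_cube using is_cube_1[of c] by blast
qed (rule level_complete)

text \<open>In dimension \<open>k + 1\<close> the vertices of height at most \<open>k\<close> are
  all but the top one, so \<open>sim_det\<close>, applied to lifts of two completions, identifies
  their top classes.\<close>

lemma step_groupspace_level: "step_groupspace k (level X k)"
  unfolding step_groupspace_def
proof (intro conjI allI impI)
  show "groupspace (level X k)"
    by (rule groupspace_level)
  fix f c c'
  assume a: "corner (level X k) (k + 1) f \<and> completes (level X k) (k + 1) f c \<and> completes (level X k) (k + 1) f c'"
  interpret Y: gspace "level X k"
    using groupspace_level by unfold_locales
  have ext: "c \<in> extensional (cube (Suc k))" "c' \<in> extensional (cube (Suc k))"
    and cubes: "is_cube (level X k) (Suc k) c" "is_cube (level X k) (Suc k) c'"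
    using a by (simp_all add: completes_def Y.cubes_iff)
  have eq: "c v = c' v" if "length v = Suc k" "v \<noteq> ones (Suc k)" for v
  proof -
    have "restrict c (punctured_cube (Suc k)) v = restrict c' (punctured_cube (Suc k)) v"
      using a by (simp add: completes_def)
    then show ?thesis
      using that by (simp add: punctured_cube_def)
  qed
  obtain d where d: "is_cube X (Suc k) d" "\<And>v. length v = Suc k \<Longrightarrow> c v = sim X k `` {d v}"
    using cubes(1) by (auto simp: factor_is_cube)
  obtain d' where d': "is_cube X (Suc k) d'" "\<And>v. length v = Suc k \<Longrightarrow> c' v = sim X k `` {d' v}"
    using cubes(2) by (auto simp: factor_is_cube)
  have "(d v, d' v) \<in> sim X k" if "length v = Suc k" for v
    using d(1) d'(1) _ that
  proof (rule sim_det)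
    fix v :: "bool list" assume v: "length v = Suc k" "height v \<le> k"
    then have "v \<noteq> ones (Suc k)"
      by (auto)
    then have "sim X k `` {d v} = sim X k `` {d' v}"
      using eq d(2) d'(2) v(1) by simp
    then show "(d v, d' v) \<in> sim X k"
      using is_cube_points[OF d(1) v(1)] is_cube_points[OF d'(1) v(1)] by (simp add: sim_class_eq)
  qed
  then have "c v = c' v" if "length v = Suc k" for v
    using that d(2) d'(2) sim_points sim_class_eq by metis
  then show "c = c'"
    using ext by (intro extensionalityI) auto
qed

end

text \<open>The two cubes that witness the relation complete the same corner.\<close>

lemma step_sim_eq:
  assumes "step_groupspace k X"
  shows "sim X k = Id_on (points X)"
proof -
  interpret gspace X
    using assms by unfold_locales (simp add: step_groupspace_def)
  have "x = y" if xy: "(x, y) \<in> sim X k" for x y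
  proof -
    obtain c d where cd: "is_cube X (Suc k) c" "is_cube X (Suc k) d" "c (ones (Suc k)) = x" "d (ones (Suc k)) = y"
      "\<And>v. length v = Suc k \<Longrightarrow> v \<noteq> ones (Suc k) \<Longrightarrow> c v = d v"
      using xy by (auto elim!: simE)
    let ?c = "restrict c (cube (Suc k))" and ?d = "restrict d (cube (Suc k))"
    let ?f = "restrict ?c (punctured_cube (Suc k))"
    have mem: "?c \<in> cubes X (Suc k)" "?d \<in> cubes X (Suc k)"
      using cd(1,2) by (simp_all add: is_cube_def)
    have "restrict ?d (punctured_cube (Suc k)) = ?f"
      using cd(5) by (intro restrict_ext) (simp add: punctured_cube_def)
    then have compl: "completes X (k + 1) ?f ?c" "completes X (k + 1) ?f ?d"
      using mem by (simp_all add: completes_def)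
    have "corner X (k + 1) ?f"
      unfolding corner_def
    proof (intro conjI ballI)
      show "?f \<in> punctured_cube (k + 1) \<rightarrow>\<^sub>E points X"
        unfolding Suc_eq_plus1[symmetric] restrict_PiE_iff using is_cube_points[OF cd(1)] by (simp add: punctured_cube_def)
      fix i assume i: "i \<in> {1..k + 1}"
      then have gm: "G_morphism k (Suc k) (face i False)"
        by (simp add: G_morphism_face)
      have "?f (face i False v) = c (face i False v)" if "length v = k" for v
      proof -
        have l: "length (face i False v) = Suc k"
          using that i by (auto simp: face_def)
        have "\<not> face i False v ! (i - 1)" "i - 1 < Suc k"
          using that i by (auto simp: face_def nth_append)
        then have "face i False v \<noteq> ones (Suc k)"
          using not_ones_iff[OF l] by blast
        then show ?thesis
          using l by (simp add: punctured_cube_def)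
      qed
      then have "is_cube X k (\<lambda>v. ?f (face i False v))"
        using is_cube_comp[OF cd(1) gm] by (elim is_cube_cong) simp
      then show "compose (cube (k + 1 - 1)) ?f (face i False) \<in> cubes X (k + 1 - 1)"
        by (simp add: is_cube_def compose_def)
    qed
    then have "?c = ?d"
      using assms compl unfolding step_groupspace_def by blast
    from fun_cong[OF this, of "ones (Suc k)"] show "x = y"
      using cd(3,4) by (simp)
  qed
  then show ?thesis
    by (auto simp: Id_on_def sim_refl dest: sim_points)
qed

context gspace
begin

text \<open>The factor map carries a pair of witnessing cubes to such a pair in
  \<open>factor X R\<close>, where \<open>step_sim_eq\<close> turns the relation into
  equality.\<close>

lemma sim_least:
  assumes R: "equiv (points X) R" and "step_groupspace k (factor X R)"
  shows "sim X k \<subseteq> R"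
proof
  fix p assume "p \<in> sim X k"
  then obtain x y where p: "p = (x, y)" "(x, y) \<in> sim X k"
    by (cases p) auto
  then obtain c d where cd: "is_cube X (Suc k) c" "is_cube X (Suc k) d" "c (ones (Suc k)) = x" "d (ones (Suc k)) = y"
    "\<And>v. length v = Suc k \<Longrightarrow> v \<noteq> ones (Suc k) \<Longrightarrow> c v = d v"
    by (auto elim!: simE)
  interpret Y: gspace "factor X R"
    using assms(2) by unfold_locales (simp add: step_groupspace_def)
  have "is_cube (factor X R) (Suc k) (\<lambda>v. R `` {c v})" "is_cube (factor X R) (Suc k) (\<lambda>v. R `` {d v})"
    using cd by (auto simp: factor_is_cube)
  from Y.simI[OF this] have "(R `` {x}, R `` {y}) \<in> sim (factor X R) k"
    using cd by simp
  then have "R `` {x} = R `` {y}"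
    using step_sim_eq[OF assms(2)] by auto
  then show "p \<in> R"
    using eq_equiv_class_iff[OF R] sim_points[OF p(2)] p(1) by blast
qed

end


section \<open>Tools for actions and for k-step groupspaces\<close>

lemma group_actionI:
  assumes G: "group G"
    and cl: "\<And>a x. a \<in> carrier G \<Longrightarrow> x \<in> E \<Longrightarrow> act a x \<in> E"
    and one: "\<And>x. x \<in> E \<Longrightarrow> act \<one>\<^bsub>G\<^esub> x = x"
    and mult: "\<And>a b x. a \<in> carrier G \<Longrightarrow> b \<in> carrier G \<Longrightarrow> x \<in> E \<Longrightarrow> act (a \<otimes>\<^bsub>G\<^esub> b) x = act a (act b x)"
  shows "group_action G E (\<lambda>a. \<lambda>x\<in>E. act a x)"
proof -
  interpret group G by fact
  have bij: "(\<lambda>x\<in>E. act a x) \<in> Bij E" if a: "a \<in> carrier G" for a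
  proof -
    have "bij_betw (act a) E E"
    proof (rule bij_betw_byWitness[where f' = "act (inv\<^bsub>G\<^esub> a)"])
      show "\<forall>x\<in>E. act (inv\<^bsub>G\<^esub> a) (act a x) = x"
        using mult[of "inv\<^bsub>G\<^esub> a" a, symmetric] a one by simp
      show "\<forall>x\<in>E. act a (act (inv\<^bsub>G\<^esub> a) x) = x"
        using mult[of a "inv\<^bsub>G\<^esub> a", symmetric] a one by simp
    qed (use a cl in auto)
    then show ?thesis
      by (simp add: Bij_def)
  qed
  have "(\<lambda>a. \<lambda>x\<in>E. act a x) \<in> hom G (BijGroup E)"
  proof (rule homI)
    show "(\<lambda>x\<in>E. act a x) \<in> carrier (BijGroup E)" if "a \<in> carrier G" for a
      using bij[OF that] by (simp add: BijGroup_def)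
    show "(\<lambda>x\<in>E. act (a \<otimes>\<^bsub>G\<^esub> b) x) = (\<lambda>x\<in>E. act a x) \<otimes>\<^bsub>BijGroup E\<^esub> (\<lambda>x\<in>E. act b x)"
      if "a \<in> carrier G" "b \<in> carrier G" for a b
      using that bij cl mult by (auto simp: BijGroup_def compose_def fun_eq_iff)
  qed
  then show ?thesis
    using G group_BijGroup by (simp add: group_action_def group_hom_def group_hom_axioms_def)
qed

lemma height_zeros [simp]: "height (zeros n) = 0"
  by (induction n) (simp_all add: zeros_Suc)

lemma height_eq_0: "height v = 0 \<longleftrightarrow> v = zeros (length v)"
  by (induction v) (auto simp: zeros_Suc)

lemma height_le_1:
  assumes "height v \<le> 1"
  shows "v = zeros (length v) \<or> (\<exists>i<length v. v = (zeros (length v))[i := True])"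
  using assms
proof (induction v)
  case (Cons b v)
  show ?case
  proof (cases b)
    case True
    then have "v = zeros (length v)"
      using Cons.prems height_eq_0 by simp
    then show ?thesis
      using True by (auto simp: zeros_Suc intro!: exI[of _ 0])
  next
    case False
    then consider "v = zeros (length v)" | i where "i < length v" "v = (zeros (length v))[i := True]"
      using Cons by auto
    then show ?thesis
    proof cases
      case 2
      then have "b # v = (zeros (length (b # v)))[Suc i := True]" "Suc i < length (b # v)"
        using False by (simp_all add: zeros_Suc)
      then show ?thesis
        by blast
    qed (simp add: False zeros_Suc)
  qed
qed (simp add: zeros_Suc)

text \<open>The true entries of \<open>x\<close> all read the first coordinate and the others are
  constantly false, so a block of coordinates collapses to the segment from the origin to
  \<open>x\<close>. The order condition survives because the block is consecutive.\<close>

lemma G_morphism_scale_hd: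
  assumes "G_morphism n m \<phi>"
  shows "G_morphism (Suc n) (length x + m) (\<lambda>u. map (\<lambda>b. b \<and> hd u) x @ \<phi> (tl u))"
proof (induction x)
  case Nil
  then show ?case
    using G_morphism_tl[OF assms] by simp
next
  case (Cons b x)
  then show ?case
    using G_morphism_dup[OF Cons, of "\<lambda>t. b \<and> t"] by simp
qed

locale step_gspace = gspace +
  fixes k :: nat
  assumes step: "step_groupspace k X"
begin

lemma cube_det:
  assumes "is_cube X n f" "is_cube X n g" "\<And>v. length v = n \<Longrightarrow> height v \<le> k \<Longrightarrow> f v = g v" "length v = n"
  shows "f v = g v"
proof -
  have "(f v, g v) \<in> sim X k"
  proof (rule sim_det[OF assms(1,2) _ assms(4)])
    fix v :: "bool list" assume v: "length v = n" "height v \<le> k"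
    then show "(f v, g v) \<in> sim X k"
      using sim_refl[OF is_cube_points[OF assms(1) v(1)]] assms(3) by simp
  qed
  then show ?thesis
    unfolding step_sim_eq[OF step] by auto
qed

text \<open>The \<open>k\<close>-step property speaks of the top vertex; the reflection that carries
  \<open>p\<close> to the top transfers it to every vertex.\<close>

lemma vertex_unique:
  assumes "is_cube X (Suc k) f" "is_cube X (Suc k) g" "length p = Suc k"
    and "\<And>v. length v = Suc k \<Longrightarrow> v \<noteq> p \<Longrightarrow> f v = g v"
  shows "f p = g p"
proof -
  let ?r = "map2 (=) p"
  have r: "?r (ones (Suc k)) = p"
    using assms(3) by (auto intro: nth_equalityI)
  have "(f (?r (ones (Suc k))), g (?r (ones (Suc k)))) \<in> sim X k"
  proof (rule simI)
    show "f (?r v) = g (?r v)" if v: "length v = Suc k" "v \<noteq> ones (Suc k)" for v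
    proof (rule assms(4))
      show "?r v \<noteq> p"
        using v assms(3) by (auto simp: list_eq_iff_nth_eq)
    qed (use v assms(3) in simp)
  qed (use is_cube_map2 assms in blast)+
  then show ?thesis
    unfolding r step_sim_eq[OF step] by auto
qed

text \<open>Vertices of height at most \<open>l\<close> form a down-set, and the retraction onto the
  face below \<open>w\<close> factors through the cube of dimension \<open>height w\<close>. Hence
  only dimensions up to \<open>l\<close> have to be checked.\<close>

lemma extend_low:
  assumes "\<And>w. length w = n \<Longrightarrow> height w \<le> l \<Longrightarrow> is_cube X (height w) (\<lambda>t. f (emb w t))"
  shows "\<exists>g. is_cube X n g \<and> (\<forall>w. length w = n \<longrightarrow> height w \<le> l \<longrightarrow> g w = f w)"
proof -
  define D where "D = {w \<in> cube n. height w \<le> l}"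
  have "\<exists>g. is_cube X n g \<and> (\<forall>w\<in>D. g w = f w)"
  proof (rule extend)
    show "meet w u \<in> D" if "w \<in> D" "length u = n" for u w
      using that height_meet_le[of u w] by (auto simp: D_def)
    show "is_cube X n (\<lambda>u. f (meet w u))" if "w \<in> D" for w
    proof -
      have w: "length w = n" "height w \<le> l"
        using that by (simp_all add: D_def)
      have "is_cube X n (\<lambda>u. f (emb w (ret w u)))"
        using is_cube_comp[OF assms[OF w]] G_morphism_ret[of w] w by blast
      then show ?thesis
        by (rule is_cube_cong) (simp add: emb_ret w)
    qed
  qed (auto simp: D_def)
  then show ?thesis
    by (auto simp: D_def)
qed

end

section \<open>One-step groupspaces\<close>

definition square :: "'a \<Rightarrow> 'a \<Rightarrow> 'a \<Rightarrow> 'a \<Rightarrow> bool list \<Rightarrow> 'a" where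
  "square a x y z v = (if hd v then (if v ! 1 then z else x) else (if v ! 1 then y else a))"

locale one_step = step_gspace X 1 for X :: "'a cube_structure" +
  fixes e :: 'a
  assumes e: "e \<in> points X"
begin

definition mul :: "'a \<Rightarrow> 'a \<Rightarrow> 'a" where
  "mul x y = (SOME z. is_cube X 2 (square e x y z))"

definition mul_group :: "'a monoid" where
  "mul_group = \<lparr>carrier = points X, mult = mul, one = e\<rparr>"

lemma is_cube_second:
  assumes "x \<in> points X" "y \<in> points X"
  shows "is_cube X 2 (\<lambda>u. if u ! 1 then x else y)"
proof -
  have "is_cube X 2 (\<lambda>u. if hd (tl u) then x else y)"
    using is_cube_comp[OF is_cube_hd[OF assms, of 0] G_morphism_tl[OF G_morphism_id]]
    by (simp add: numeral_2_eq_2)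
  then show ?thesis
    by (rule is_cube_cong) (auto simp: length_Suc_conv numeral_2_eq_2)
qed

lemma square_mul:
  assumes x: "x \<in> points X" and y: "y \<in> points X"
  shows "is_cube X 2 (square e x y (mul x y))"
proof -
  have "\<exists>g. is_cube X 2 g \<and> (\<forall>u. length u = 2 \<longrightarrow> u \<noteq> ones 2 \<longrightarrow> g u = square e x y e u)"
  proof (rule complete)
    fix i :: nat assume "i < 2"
    then consider "i = 0" | "i = 1"
      by linarith
    then show "is_cube X 2 (\<lambda>u. square e x y e (u[i := False]))"
    proof cases
      case 1
      show ?thesis
        using is_cube_second[OF y e]
        by (rule is_cube_cong) (auto simp: square_def 1 length_Suc_conv numeral_2_eq_2)
    next
      case 2
      show ?thesis
        using is_cube_hd[OF x e, of 1] unfolding Suc_1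
        by (rule is_cube_cong) (auto simp: square_def 2 length_Suc_conv numeral_2_eq_2)
    qed
  qed
  then obtain g where g: "is_cube X 2 g" "\<And>u. length u = 2 \<Longrightarrow> u \<noteq> ones 2 \<Longrightarrow> g u = square e x y e u"
    by blast
  have gs: "g u = square e x y (g (ones 2)) u" if "length u = 2" for u
    using g(2)[OF that] that
    by (cases "u = ones 2") (auto simp: square_def length_Suc_conv numeral_2_eq_2 ones_Suc)
  have "is_cube X 2 (square e x y (g (ones 2)))"
    using is_cube_cong[OF g(1) gs] by blast
  then show ?thesis
    unfolding mul_def by (rule someI)
qed

lemma mul_eq:
  assumes "is_cube X 2 (square e x y z)"
  shows "mul x y = z"
proof -
  have "x \<in> points X" "y \<in> points X"
    using is_cube_points[OF assms, of "[True, False]"] is_cube_points[OF assms, of "[False, True]"]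
    by (simp_all add: square_def)
  then have "is_cube X 2 (square e x y (mul x y))"
    by (rule square_mul)
  then have "square e x y (mul x y) (ones 2) = square e x y z (ones 2)"
    using assms unfolding Suc_1[symmetric] One_nat_def[symmetric]
  proof (rule vertex_unique)
    fix v :: "bool list" assume "length v = Suc 1" "v \<noteq> ones (Suc 1)"
    then show "square e x y (mul x y) v = square e x y z v"
      by (auto simp: square_def length_Suc_conv ones_Suc)
  qed simp
  then show ?thesis
    by (simp add: square_def numeral_2_eq_2 ones_Suc)
qed

lemma mul_closed: "x \<in> points X \<Longrightarrow> y \<in> points X \<Longrightarrow> mul x y \<in> points X"
  using is_cube_points[OF square_mul, of x y "[True, True]"] by (simp add: square_def)

text \<open>Collapsing two consecutive blocks to one coordinate each pulls the cube back to a square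
  with \<open>e\<close> at the origin, and such a square is a product. The factors keep the order of
  the blocks.\<close>

lemma cube_append:
  assumes f: "is_cube X (p + q) f" and f0: "f (zeros (p + q)) = e" and "length x = p" "length y = q"
  shows "f (x @ y) = mul (f (x @ zeros q)) (f (zeros p @ y))"
proof -
  let ?\<phi> = "\<lambda>u. map (\<lambda>b. b \<and> hd u) x @ map (\<lambda>b. b \<and> hd (tl u)) y"
  have "G_morphism 2 (p + q) ?\<phi>"
    using G_morphism_scale_hd[OF G_morphism_scale_hd[OF G_morphism_Nil, of 0 y], of x] assms
    by (simp add: numeral_2_eq_2)
  from is_cube_comp[OF f this] have c: "is_cube X 2 (\<lambda>u. f (?\<phi> u))" .
  have z: "map (\<lambda>b. False) x = zeros p" "map (\<lambda>b. False) y = zeros q"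
    using assms by (simp_all add: zeros_def map_replicate_const)
  have fs: "f (?\<phi> u) = square e (f (x @ zeros q)) (f (zeros p @ y)) (f (x @ y)) u" if "length u = 2" for u
  proof -
    obtain s t where u: "u = [s, t]"
      using \<open>length u = 2\<close> by (auto simp: length_Suc_conv numeral_2_eq_2)
    have "zeros p @ zeros q = zeros (p + q)"
      by (simp add: zeros_def replicate_add)
    then show ?thesis
      using z f0 by (cases s; cases t) (simp_all add: u square_def)
  qed
  have "is_cube X 2 (square e (f (x @ zeros q)) (f (zeros p @ y)) (f (x @ y)))"
    using is_cube_cong[OF c fs] by blast
  from mul_eq[OF this] show ?thesis
    by simp
qed

text \<open>The prescribed vertices have height at most 1, and maps of dimension at most 1 are cubes
  by ergodicity, so the values may be chosen at will.\<close>

lemma cube_of_units: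
  assumes "\<And>i. i < n \<Longrightarrow> a i \<in> points X"
  shows "\<exists>f. is_cube X n f \<and> f (zeros n) = e \<and> (\<forall>i<n. f ((zeros n)[i := True]) = a i)"
proof -
  \<comment> \<open>\<open>LEAST\<close> reads off the index of a unit vector and yields some point
    at every other nonzero vector.\<close>
  define F where "F v = (if v = zeros n then e else a (LEAST i. i < n \<and> v ! i))" for v
  have F: "F v \<in> points X" if "length v = n" for v
  proof (cases "v = zeros n")
    case False
    then have "\<exists>i. i < n \<and> v ! i"
      using that by (auto simp: list_eq_iff_nth_eq)
    then have "(LEAST i. i < n \<and> v ! i) < n"
      by (rule LeastI2_ex) simp
    then show ?thesis
      using assms False by (simp add: F_def)
  qed (simp add: F_def e)
  have "\<exists>g. is_cube X n g \<and> (\<forall>w. length w = n \<longrightarrow> height w \<le> 1 \<longrightarrow> g w = F w)"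
  proof (rule extend_low)
    fix w :: "bool list" assume w: "length w = n" "height w \<le> 1"
    then consider "height w = 0" | "height w = 1"
      by linarith
    then show "is_cube X (height w) (\<lambda>t. F (emb w t))"
    proof cases
      case 1
      have "is_cube X 0 (\<lambda>t. F (emb w []))"
        using F w by (intro is_cube_const) simp
      then show ?thesis
        unfolding 1 by (rule is_cube_cong) simp
    next
      case 2
      show ?thesis
        unfolding 2 using F w by (intro is_cube_1) simp
    qed
  qed
  then obtain g where g: "is_cube X n g" "\<And>w. length w = n \<Longrightarrow> height w \<le> 1 \<Longrightarrow> g w = F w"
    by blast
  have "g (zeros n) = e"
    using g(2) by (simp add: F_def)
  moreover have "g ((zeros n)[i := True]) = a i" if i: "i < n" for i
  proof -
    let ?v = "(zeros n)[i := True]"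
    have nth: "?v ! j \<longleftrightarrow> j = i" if "j < n" for j
      using that i by (simp add: nth_list_update)
    have "(LEAST j. j < n \<and> ?v ! j) = i"
      using i nth by (intro Least_equality) auto
    moreover have "?v \<noteq> zeros n"
      using i nth by (metis nth_ones(2))
    moreover have "height ((zeros n)[i := True]) = 1"
      using i
    proof (induction n arbitrary: i)
      case (Suc n)
      then show ?case
        by (cases i) (simp_all add: zeros_Suc)
    qed simp
    ultimately show ?thesis
      using g(2) by (simp add: F_def)
  qed
  ultimately show ?thesis
    using g(1) by blast
qed

lemma mul_one: "x \<in> points X \<Longrightarrow> mul x e = x" "x \<in> points X \<Longrightarrow> mul e x = x"
proof -
  assume x: "x \<in> points X"
  show "mul x e = x"
    using is_cube_hd[OF x e, of 1] unfolding Suc_1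
    by (intro mul_eq) (elim is_cube_cong, simp add: square_def)
  show "mul e x = x"
    using is_cube_second[OF x e]
    by (intro mul_eq) (elim is_cube_cong, simp add: square_def)
qed

text \<open>In a 3-cube with \<open>e\<close> at the origin and \<open>x\<close>, \<open>y\<close>,
  \<open>z\<close> at the unit vectors, the top value is read off by splitting the coordinates as 1
  + 2 and as 2 + 1.\<close>

lemma mul_assoc:
  assumes "x \<in> points X" "y \<in> points X" "z \<in> points X"
  shows "mul (mul x y) z = mul x (mul y z)"
proof -
  let ?a = "\<lambda>i. [x, y, z] ! i"
  have "?a i \<in> points X" if "i < 3" for i
    using that assms by (auto simp: numeral_3_eq_3 less_Suc_eq)
  then obtain f where f: "is_cube X 3 f" "f (zeros 3) = e" "\<And>i. i < 3 \<Longrightarrow> f ((zeros 3)[i := True]) = ?a i"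
    using cube_of_units[of 3 ?a] by blast
  have u: "f [True, False, False] = x" "f [False, True, False] = y" "f [False, False, True] = z"
    using f(3)[of 0] f(3)[of 1] f(3)[of 2] by (simp_all add: numeral_3_eq_3 zeros_Suc numeral_2_eq_2)
  have s1: "f ([True] @ y) = mul (f ([True] @ zeros 2)) (f (zeros 1 @ y))" if "length y = 2" for y
    using cube_append[of 1 2 f "[True]" y] f that by (simp add: numeral_3_eq_3)
  have s2: "f (y @ [True]) = mul (f (y @ zeros 1)) (f (zeros 2 @ [True]))" if "length y = 2" for y
    using cube_append[of 2 1 f y "[True]"] f that by (simp add: numeral_3_eq_3)
  show ?thesis
    using s1[of "[True, True]"] s1[of "[True, False]"] s2[of "[True, True]"] s2[of "[False, True]"] u
    by (simp add: numeral_2_eq_2 zeros_Suc)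
qed

text \<open>The square is completed at the vertex of the left factor, with \<open>e\<close>
  prescribed at the top.\<close>

lemma mul_inverse:
  assumes y: "y \<in> points X"
  shows "\<exists>z\<in>points X. mul z y = e"
proof -
  have "\<exists>g. is_cube X 2 g \<and> (\<forall>u. length u = 2 \<longrightarrow> u \<noteq> [True, False] \<longrightarrow> g u = square e e y e u)"
  proof (rule complete_vertex)
    fix i :: nat assume "i < 2"
    then consider "i = 0" | "i = 1"
      by linarith
    then show "is_cube X 2 (\<lambda>u. square e e y e (u[i := (\<not> [True, False] ! i)]))"
    proof cases
      case 1
      show ?thesis
        using is_cube_second[OF y e]
        by (rule is_cube_cong) (auto simp: square_def 1 length_Suc_conv numeral_2_eq_2)
    next
      case 2
      show ?thesis
        using is_cube_hd[OF e y, of 1] unfolding Suc_1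
        by (rule is_cube_cong) (auto simp: square_def 2 length_Suc_conv numeral_2_eq_2)
    qed
  qed simp
  then obtain g where g: "is_cube X 2 g"
    "\<And>u. length u = 2 \<Longrightarrow> u \<noteq> [True, False] \<Longrightarrow> g u = square e e y e u"
    by blast
  have gs: "g u = square e (g [True, False]) y e u" if "length u = 2" for u
    using g(2)[OF that] that
    by (cases "u = [True, False]") (auto simp: square_def length_Suc_conv numeral_2_eq_2)
  have "is_cube X 2 (square e (g [True, False]) y e)"
    using is_cube_cong[OF g(1) gs] by blast
  then show ?thesis
    using mul_eq is_cube_points[OF g(1), of "[True, False]"] by auto
qed

lemma group_mul: "group mul_group"
  by (rule groupI) (simp_all add: mul_group_def mul_closed e mul_assoc mul_one mul_inverse)

section \<open>The cubes of a 1-step groupspace\<close>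

lemma D1_iso: "cube_iso (\<lambda>x. x) (D1 mul_group) X"
proof -
  interpret G: group mul_group
    by (rule group_mul)
  let ?D = "\<lambda>n a. \<lambda>v\<in>cube n. foldl (\<lambda>p i. p \<otimes>\<^bsub>mul_group\<^esub>
      (a i [^]\<^bsub>mul_group\<^esub> (of_bool (coord v i) :: nat))) (a 0) [1..<n + 1]"
  have carrier [simp]: "carrier mul_group = points X" and mult: "x \<otimes>\<^bsub>mul_group\<^esub> y = mul x y"
    and one: "\<one>\<^bsub>mul_group\<^esub> = e" for x y
    by (simp_all add: mul_group_def)
  \<comment> \<open>A cube of \<open>D1\<close> is the face with first coordinate true of an
    (n+1)-cube based at \<open>e\<close> whose unit values are the coefficients \<open>a 0\<close>
    to \<open>a n\<close>. Peeling off one coordinate at a time with \<open>cube_append\<close>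
    multiplies its values out from left to right.\<close>
  have D: "is_cube X n (?D n a) \<and> ?D n a (zeros n) = a 0 \<and>
      (\<forall>i<n. ?D n a ((zeros n)[i := True]) = mul (a 0) (a (Suc i)))"
    if a: "a \<in> {0..n} \<rightarrow> points X" for n a
  proof -
    have a': "a i \<in> points X" if "i < Suc n" for i
      using a that by auto
    then obtain f where f: "is_cube X (Suc n) f" "f (zeros (Suc n)) = e"
      "\<And>i. i < Suc n \<Longrightarrow> f ((zeros (Suc n))[i := True]) = a i"
      using cube_of_units[of "Suc n" a] by blast
    have f0: "f (True # zeros n) = a 0"
      using f(3)[of 0] by (simp add: zeros_Suc)
    have fi: "f (False # (zeros n)[i := True]) = a (Suc i)" if "i < n" for i
      using f(3)[of "Suc i"] that by (simp add: zeros_Suc)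
    have unit: "zeros (Suc j) @ True # zeros (n - Suc j) = False # (zeros n)[j := True]" if "j < n" for j
      using that by (auto simp: zeros_def list_eq_iff_nth_eq nth_append nth_Cons' nth_list_update)
    have prefix: "f (True # take j v @ zeros (n - j)) = foldl (\<lambda>p i. p \<otimes>\<^bsub>mul_group\<^esub>
        (a i [^]\<^bsub>mul_group\<^esub> (of_bool (coord v i) :: nat))) (a 0) [1..<j + 1]"
      if v: "length v = n" and "j \<le> n" for v j
      using \<open>j \<le> n\<close>
    proof (induction j)
      case 0
      then show ?case
        by (simp add: f0)
    next
      case (Suc j)
      let ?x = "True # take j v" and ?y = "v ! j # zeros (n - Suc j)"
      have "True # take (Suc j) v @ zeros (n - Suc j) = ?x @ ?y"
        using Suc.prems v by (simp add: take_Suc_conv_app_nth)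
      moreover have "f (?x @ ?y) = mul (f (?x @ zeros (n - j))) (f (zeros (Suc j) @ ?y))"
        using cube_append[of "Suc j" "n - j" f ?x ?y] f Suc.prems v by simp
      moreover have "f (zeros (Suc j) @ ?y) = a (Suc j) [^]\<^bsub>mul_group\<^esub> (of_bool (v ! j) :: nat)"
      proof (cases "v ! j")
        case True
        then show ?thesis
          using unit[of j] fi[of j] Suc.prems a'[of "Suc j"] by simp
      next
        case False
        have "zeros (Suc j) @ False # zeros (n - Suc j) = zeros (Suc n)"
          using Suc.prems by (auto simp: zeros_def list_eq_iff_nth_eq nth_append nth_Cons')
        then show ?thesis
          using False f(2) by (simp add: one)
      qed
      ultimately show ?case
        using Suc by (simp add: mult)
    qed
    have eq: "f (True # v) = ?D n a v" if "length v = n" for v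
      using prefix[OF that, of n] that by (simp add: zeros_Suc)
    have "is_cube X n (\<lambda>v. f (True # v))"
      using is_cube_comp[OF f(1) G_morphism_const_Cons[OF G_morphism_id]] .
    then have "is_cube X n (?D n a)"
      by (rule is_cube_cong) (rule eq)
    moreover have "?D n a (zeros n) = a 0"
      using eq[of "zeros n"] f0 by simp
    moreover have "?D n a ((zeros n)[i := True]) = mul (a 0) (a (Suc i))" if "i < n" for i
    proof -
      have "f ([True] @ (zeros n)[i := True]) = mul (f ([True] @ zeros n)) (f (zeros 1 @ (zeros n)[i := True]))"
        using cube_append[of 1 n f "[True]" "(zeros n)[i := True]"] f by simp
      then show ?thesis
        using eq[of "(zeros n)[i := True]"] f0 fi[OF that] by (simp add: zeros_Suc)
    qed
    ultimately show ?thesis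
      by blast
  qed
  have "c \<in> cubes (D1 mul_group) n \<longleftrightarrow> compose (cube n) (\<lambda>x. x) c \<in> cubes X n"
    if c: "c \<in> cube n \<rightarrow>\<^sub>E points X" for n c
  proof -
    have "compose (cube n) (\<lambda>x. x) c = restrict c (cube n)"
      by (simp add: compose_def)
    then have "compose (cube n) (\<lambda>x. x) c \<in> cubes X n \<longleftrightarrow> is_cube X n c"
      by (simp add: is_cube_def)
    moreover have "c \<in> cubes (D1 mul_group) n \<longleftrightarrow> (\<exists>a\<in>{0..n} \<rightarrow> points X. c = ?D n a)"
      by (simp add: D1_def)
    moreover have "is_cube X n c \<longleftrightarrow> (\<exists>a\<in>{0..n} \<rightarrow> points X. c = ?D n a)"
    proof
      assume cube: "is_cube X n c"
      \<comment> \<open>A cube of a 1-step groupspace is determined by its values at height at most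
        1. Comparing there gives the value at the origin for \<open>a 0\<close> and left quotients
        by it for the other coefficients.\<close>
      define a where "a i = (if i = 0 then c (zeros n)
        else inv\<^bsub>mul_group\<^esub> (c (zeros n)) \<otimes>\<^bsub>mul_group\<^esub> c ((zeros n)[i - 1 := True]))" for i
      have pt: "c v \<in> points X" if "length v = n" for v
        using is_cube_points[OF cube that] .
      have a: "a \<in> {0..n} \<rightarrow> points X"
        using pt G.inv_closed G.m_closed by (auto simp: a_def)
      note Da = D[OF a]
      have "c v = ?D n a v" if "length v = n" for v
      proof (rule cube_det[OF cube _ _ that])
        show "is_cube X n (?D n a)"
          using Da by blast
        fix v :: "bool list" assume v: "length v = n" "height v \<le> 1"
        consider "v = zeros n" | i where "i < n" "v = (zeros n)[i := True]"
          using height_le_1[OF v(2)] v(1) by blast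
        then show "c v = ?D n a v"
        proof cases
          case 1
          then show ?thesis
            using Da by (simp add: a_def)
        next
          case 2
          have "mul (a 0) (a (Suc i)) = c v"
            using pt[of "zeros n"] pt[OF v(1)] 2 G.inv_closed[of "c (zeros n)"] G.m_assoc[of "c (zeros n)" "inv\<^bsub>mul_group\<^esub> (c (zeros n))" "c v"]
            by (simp add: a_def flip: mult)
          moreover have "?D n a v = mul (a 0) (a (Suc i))"
            using Da 2 by blast
          ultimately show ?thesis
            by simp
        qed
      qed
      then have "c = ?D n a"
        using c by (intro extensionalityI[of _ "cube n"]) (auto simp: PiE_def)
      then show "\<exists>a\<in>{0..n} \<rightarrow> points X. c = ?D n a"
        using a by blast
    qed (use D in blast)
    ultimately show ?thesis
      by blast
  qed
  moreover have "points (D1 mul_group) = points X"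
    by (simp add: D1_def)
  ultimately show ?thesis
    using bij_betw_id[of "points X"] by (simp add: cube_iso_def id_def)
qed

end

lemma one_step_structure:
  fixes X :: "'a cube_structure"
  assumes "step_groupspace 1 X"
  shows "\<exists>(G :: 'a monoid) \<rho>. group G \<and> free_action G (points X) \<rho> \<and>
    orbits G (points X) \<rho> = points X // sim X 0 \<and> (\<exists>m. equivariant_iso G \<rho> m (D1 G) X)"
proof -
  interpret gspace X
    using assms by unfold_locales (simp add: step_groupspace_def)
  \<comment> \<open>In dimension 0 the corner condition is empty, so completion provides a cube and
    thereby a base point.\<close>
  have "\<exists>g. is_cube X 0 g"
    using complete[of 0] by auto
  then obtain e where e: "e \<in> points X"
    using is_cube_points[of 0 _ "[]"] by auto
  interpret one_step X e
    using assms e by unfold_locales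
  interpret G: group mul_group
    by (rule group_mul)
  have carrier [simp]: "carrier mul_group = points X" and mult: "x \<otimes>\<^bsub>mul_group\<^esub> y = mul x y"
    and one: "\<one>\<^bsub>mul_group\<^esub> = e" for x y
    by (simp_all add: mul_group_def)
  let ?\<rho> = "\<lambda>a. \<lambda>x\<in>points X. mul a x"
  have act: "group_action mul_group (points X) ?\<rho>"
    by (rule group_actionI[OF group_mul]) (simp_all add: mult one mul_closed mul_one mul_assoc)
  have "a = e" if "a \<in> points X" "x \<in> points X" "mul a x = x" for a x
    using G.r_cancel_one[of x a] that by (simp add: mult one)
  then have "free_action mul_group (points X) ?\<rho>"
    using act by (auto simp: free_action_def stabilizer_def one e mul_one)
  moreover have "orbit mul_group ?\<rho> x = points X" if x: "x \<in> points X" for x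
  proof -
    have "y \<in> orbit mul_group ?\<rho> x" if y: "y \<in> points X" for y
    proof -
      have "mul (mul y (inv\<^bsub>mul_group\<^esub> x)) x = y"
        using x y G.m_assoc[of y "inv\<^bsub>mul_group\<^esub> x" x] G.inv_closed[of x] by (simp flip: mult)
      moreover have "mul y (inv\<^bsub>mul_group\<^esub> x) \<in> points X"
        using x y G.inv_closed[of x] by (intro mul_closed) simp_all
      ultimately show ?thesis
        using x unfolding orbit_def by (auto intro!: exI[of _ "mul y (inv\<^bsub>mul_group\<^esub> x)"])
    qed
    then show ?thesis
      using x by (auto simp: orbit_def mul_closed)
  qed
  then have "orbits mul_group (points X) ?\<rho> = points X // sim X 0"
    by (auto simp: orbits_def quotient_def sim_0)
  moreover have "equivariant_iso mul_group ?\<rho> (\<lambda>x. x) (D1 mul_group) X"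
    using D1_iso by (simp add: equivariant_iso_def mult)
  ultimately show ?thesis
    using group_mul by blast
qed


section \<open>Alternating products\<close>

text \<open>In an abelian group this is the product of \<open>f v\<close> with exponent (-1)^height
  over the whole cube. Splitting along the first coordinate lets inductions on the dimension do
  without index sets.\<close>

primrec alt_prod :: "('g, 'b) monoid_scheme \<Rightarrow> nat \<Rightarrow> (bool list \<Rightarrow> 'g) \<Rightarrow> 'g" where
  "alt_prod G 0 f = f []"
| "alt_prod G (Suc n) f =
    alt_prod G n (\<lambda>v. f (False # v)) \<otimes>\<^bsub>G\<^esub> inv\<^bsub>G\<^esub> (alt_prod G n (\<lambda>v. f (True # v)))"

lemma alt_prod_cong: "(\<And>v. length v = n \<Longrightarrow> f v = g v) \<Longrightarrow> alt_prod G n f = alt_prod G n g"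
proof (induction n arbitrary: f g)
  case (Suc n)
  have "alt_prod G n (\<lambda>v. f (b # v)) = alt_prod G n (\<lambda>v. g (b # v))" for b
    by (rule Suc.IH) (simp add: Suc.prems)
  then show ?case
    by simp
qed simp

context comm_group
begin

lemma alt_prod_closed: "(\<And>v. length v = n \<Longrightarrow> f v \<in> carrier G) \<Longrightarrow> alt_prod G n f \<in> carrier G"
proof (induction n arbitrary: f)
  case (Suc n)
  have "alt_prod G n (\<lambda>v. f (b # v)) \<in> carrier G" for b
    by (rule Suc.IH) (simp add: Suc.prems)
  then show ?case
    by simp
qed simp

lemma alt_prod_mult:
  assumes "\<And>v. length v = n \<Longrightarrow> f v \<in> carrier G" "\<And>v. length v = n \<Longrightarrow> g v \<in> carrier G"
  shows "alt_prod G n (\<lambda>v. f v \<otimes> g v) = alt_prod G n f \<otimes> alt_prod G n g"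
  using assms
proof (induction n arbitrary: f g)
  case (Suc n)
  have IH: "alt_prod G n (\<lambda>v. f (b # v) \<otimes> g (b # v)) = alt_prod G n (\<lambda>v. f (b # v)) \<otimes> alt_prod G n (\<lambda>v. g (b # v))" for b
    by (rule Suc.IH) (simp_all add: Suc.prems)
  have cl: "alt_prod G n (\<lambda>v. f (b # v)) \<in> carrier G" "alt_prod G n (\<lambda>v. g (b # v)) \<in> carrier G" for b
    by (rule alt_prod_closed, simp add: Suc.prems)+
  show ?case
    using cl by (simp add: IH inv_mult m_ac)
qed simp

lemma alt_prod_inv:
  assumes "\<And>v. length v = n \<Longrightarrow> f v \<in> carrier G"
  shows "alt_prod G n (\<lambda>v. inv (f v)) = inv (alt_prod G n f)"
  using assms
proof (induction n arbitrary: f)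
  case (Suc n)
  have IH: "alt_prod G n (\<lambda>v. inv (f (b # v))) = inv (alt_prod G n (\<lambda>v. f (b # v)))" for b
    by (rule Suc.IH) (simp_all add: Suc.prems)
  have cl: "alt_prod G n (\<lambda>v. f (b # v)) \<in> carrier G" for b
    by (rule alt_prod_closed) (simp add: Suc.prems)
  show ?case
    using cl by (simp add: IH inv_mult)
qed simp

lemma alt_prod_one: "alt_prod G n (\<lambda>v. \<one>) = \<one>"
  by (induction n) simp_all

text \<open>The two ends of each edge in direction \<open>j\<close> carry the same value with
  opposite exponents.\<close>

lemma alt_prod_degenerate:
  assumes "\<And>v. length v = n \<Longrightarrow> f v \<in> carrier G" "j < n" "\<And>v. length v = n \<Longrightarrow> f (v[j := False]) = f v"
  shows "alt_prod G n f = \<one>"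
  using assms
proof (induction n arbitrary: f j)
  case (Suc n)
  have cl: "alt_prod G n (\<lambda>v. f (b # v)) \<in> carrier G" for b
    by (rule alt_prod_closed) (simp add: Suc.prems)
  show ?case
  proof (cases j)
    case 0
    have "alt_prod G n (\<lambda>v. f (True # v)) = alt_prod G n (\<lambda>v. f (False # v))"
      using Suc.prems(3)[of "True # _"] 0 by (intro alt_prod_cong) simp
    then show ?thesis
      using cl by simp
  next
    case (Suc i)
    have "alt_prod G n (\<lambda>v. f (b # v)) = \<one>" for b
      using Suc.prems(1,2) Suc.prems(3)[of "b # _"] Suc by (intro Suc.IH[of _ i]) simp_all
    then show ?thesis
      by simp
  qed
qed simp

text \<open>The top vertex enters the product once, with exponent 1 or -1, so equal products and
  equal values elsewhere leave no freedom there.\<close>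

lemma alt_prod_cancel:
  assumes "\<And>v. length v = n \<Longrightarrow> f v \<in> carrier G" "\<And>v. length v = n \<Longrightarrow> g v \<in> carrier G"
    and "\<And>v. length v = n \<Longrightarrow> v \<noteq> ones n \<Longrightarrow> f v = g v" "alt_prod G n f = alt_prod G n g"
  shows "f (ones n) = g (ones n)"
  using assms
proof (induction n arbitrary: f g)
  case (Suc n)
  have cl: "alt_prod G n (\<lambda>v. f (b # v)) \<in> carrier G" "alt_prod G n (\<lambda>v. g (b # v)) \<in> carrier G" for b
    by (rule alt_prod_closed, simp add: Suc.prems)+
  have "alt_prod G n (\<lambda>v. f (False # v)) = alt_prod G n (\<lambda>v. g (False # v))"
    by (rule alt_prod_cong) (simp add: Suc.prems(3) ones_Suc)
  then have "inv (alt_prod G n (\<lambda>v. f (True # v))) = inv (alt_prod G n (\<lambda>v. g (True # v)))"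
    using Suc.prems(4) cl by simp
  then have "alt_prod G n (\<lambda>v. f (True # v)) = alt_prod G n (\<lambda>v. g (True # v))"
    using cl inv_inv by metis
  then have "f (True # ones n) = g (True # ones n)"
    using Suc.prems(1-3) by (intro Suc.IH[of "\<lambda>v. f (True # v)" "\<lambda>v. g (True # v)"]) (simp_all add: ones_Suc)
  then show ?case
    by (simp add: ones_Suc)
qed (simp add: ones_Suc)

lemma finprod_inv:
  assumes "h \<in> A \<rightarrow> carrier G"
  shows "(\<Otimes>u\<in>A. inv (h u)) = inv (\<Otimes>u\<in>A. h u)"
proof -
  have "(\<Otimes>u\<in>A. inv (h u)) \<otimes> (\<Otimes>u\<in>A. h u) = (\<Otimes>u\<in>A. inv (h u) \<otimes> h u)"
    using assms by (subst finprod_multf) auto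
  also have "\<dots> = (\<Otimes>u\<in>A. \<one>)"
    using assms by (intro finprod_cong') (auto simp: Pi_iff)
  finally have "(\<Otimes>u\<in>A. inv (h u)) \<otimes> (\<Otimes>u\<in>A. h u) = \<one>"
    by simp
  then show ?thesis
    using assms by (intro inv_equality[symmetric] finprod_closed) auto
qed

text \<open>Vectors below \<open>b # v\<close> start with false, and also with true if
  \<open>b\<close> holds; the second half contributes with reversed exponents. This turns the
  condition in \<open>Dk\<close> into alternating products over the faces parametrized by
  \<open>emb v\<close>.\<close>

lemma finprod_below:
  assumes "\<And>u. length u = length v \<Longrightarrow> f u \<in> carrier G"
  shows "(\<Otimes>u\<in>{u \<in> cube (length v). list_all2 (\<le>) u v}. f u [^] ((- 1) ^ height u :: int))
    = alt_prod G (height v) (\<lambda>t. f (emb v t))"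
  using assms
proof (induction v arbitrary: f)
  case Nil
  have "{u :: bool list. u = []} = {[]}"
    by auto
  then show ?case
    using Nil[of "[]"] by simp
next
  case (Cons b v)
  let ?S = "{u \<in> cube (length v). list_all2 (\<le>) u v}"
  let ?h = "\<lambda>u. f u [^] ((- 1) ^ height u :: int)"
  have fin: "finite ?S"
    by (rule finite_subset[OF _ finite_cube[of "length v"]]) auto
  have cl: "?h (c # u) \<in> carrier G" "f (c # u) \<in> carrier G" if "u \<in> ?S" for c u
    using Cons.prems[of "c # u"] that by simp_all
  have False_part: "(\<Otimes>u\<in>(#) False ` ?S. ?h u) = alt_prod G (height v) (\<lambda>t. f (False # emb v t))"
  proof -
    have "(\<Otimes>u\<in>(#) False ` ?S. ?h u) = (\<Otimes>u\<in>?S. ?h (False # u))"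
      using cl by (intro finprod_reindex) auto
    also have "\<dots> = (\<Otimes>u\<in>?S. f (False # u) [^] ((- 1) ^ height u :: int))"
      using cl by (intro finprod_cong') auto
    also have "\<dots> = alt_prod G (height v) (\<lambda>t. f (False # emb v t))"
      by (rule Cons.IH) (simp add: Cons.prems)
    finally show ?thesis .
  qed
  show ?case
  proof (cases b)
    case False
    have S: "{u \<in> cube (length (b # v)). list_all2 (\<le>) u (b # v)} = (#) False ` ?S"
      using False by (auto simp: list_all2_Cons2)
    show ?thesis
      unfolding S False_part using False by simp
  next
    case True
    have S: "{u \<in> cube (length (b # v)). list_all2 (\<le>) u (b # v)} = (#) False ` ?S \<union> (#) True ` ?S"
      using True by (auto simp: list_all2_Cons2)
    have "(\<Otimes>u\<in>(#) False ` ?S \<union> (#) True ` ?S. ?h u)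
        = (\<Otimes>u\<in>(#) False ` ?S. ?h u) \<otimes> (\<Otimes>u\<in>(#) True ` ?S. ?h u)"
      using fin cl by (intro finprod_Un_disjoint) auto
    moreover have "(\<Otimes>u\<in>(#) True ` ?S. ?h u) = inv (alt_prod G (height v) (\<lambda>t. f (True # emb v t)))"
    proof -
      have "(\<Otimes>u\<in>(#) True ` ?S. ?h u) = (\<Otimes>u\<in>?S. ?h (True # u))"
        using cl by (intro finprod_reindex) auto
      also have "\<dots> = (\<Otimes>u\<in>?S. inv (f (True # u) [^] ((- 1) ^ height u :: int)))"
        using cl by (intro finprod_cong') (auto simp: int_pow_neg)
      also have "\<dots> = inv (\<Otimes>u\<in>?S. f (True # u) [^] ((- 1) ^ height u :: int))"
        using cl by (intro finprod_inv) auto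
      also have "(\<Otimes>u\<in>?S. f (True # u) [^] ((- 1) ^ height u :: int)) = alt_prod G (height v) (\<lambda>t. f (True # emb v t))"
        by (rule Cons.IH) (simp add: Cons.prems)
      finally show ?thesis .
    qed
    ultimately show ?thesis
      unfolding S False_part using True by simp
  qed
qed

end

section \<open>The structure group of a higher-step groupspace\<close>

text \<open>Two \<open>k\<close>-dimensional spikes at the origin, \<open>z\<close> over
  \<open>x\<close> and \<open>z'\<close> over \<open>x'\<close>, placed on the two sides of the
  first coordinate. That this is a cube expresses that the spikes are related by
  \<open>approx1\<close>.\<close>

definition prism :: "nat \<Rightarrow> 'a \<Rightarrow> 'a \<Rightarrow> 'a \<Rightarrow> 'a \<Rightarrow> bool list \<Rightarrow> 'a" where
  "prism k z x z' x' u =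
    (if tl u = zeros k then (if hd u then z' else z) else (if hd u then x' else x))"

locale pointed = step_gspace +
  fixes e :: 'a
  assumes k: "k \<ge> 1" and e: "e \<in> points X"
begin

abbreviation R :: "('a \<times> 'a) set" where
  "R \<equiv> sim X (k - 1)"

definition parallel :: "'a \<Rightarrow> 'a \<Rightarrow> 'a \<Rightarrow> 'a \<Rightarrow> bool" where
  "parallel z x z' x' \<longleftrightarrow> is_cube X (Suc k) (prism k z x z' x')"

lemma Suc_k: "Suc (k - 1) = k"
  using k by simp

section \<open>Parallel spikes in a k-step groupspace\<close>

lemma R_replace:
  assumes "is_cube X n f" "n \<le> k" "\<And>v. length v = n \<Longrightarrow> (f v, g v) \<in> R"
  shows "is_cube X n g"
  using sim_replace[of n f "k - 1" g] assms Suc_k by simp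

lemma R_iff:
  "(x, y) \<in> R \<longleftrightarrow> x \<in> points X \<and> y \<in> points X \<and> is_cube X k (\<lambda>v. if v = zeros k then y else x)"
  using sim_vertex_iff[of "zeros k" "k - 1" x y] Suc_k by simp

lemma parallel_sides:
  assumes "parallel z x z' x'"
  shows "(x, z) \<in> R" "(x', z') \<in> R"
proof -
  have c: "is_cube X (Suc k) (prism k z x z' x')"
    using assms by (simp add: parallel_def)
  have face: "is_cube X k (\<lambda>v. prism k z x z' x' (b # v))" for b
    using is_cube_comp[OF c G_morphism_const_Cons[OF G_morphism_id]] .
  have "ones k \<noteq> zeros k"
    using k by (cases k) (simp_all add: ones_Suc zeros_Suc)
  then have "x \<in> points X" "z \<in> points X" "x' \<in> points X" "z' \<in> points X"
    using is_cube_points[OF c, of "False # ones k"] is_cube_points[OF c, of "False # zeros k"]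
      is_cube_points[OF c, of "True # ones k"] is_cube_points[OF c, of "True # zeros k"]
    by (simp_all add: prism_def)
  then show "(x, z) \<in> R" "(x', z') \<in> R"
    using face[of False] face[of True] unfolding prism_def list.sel if_True if_False R_iff by blast+
qed

lemma parallel_refl: "(x, z) \<in> R \<Longrightarrow> parallel z x z x"
  using is_cube_comp[OF _ G_morphism_tl[OF G_morphism_id], of k "\<lambda>v. if v = zeros k then z else x"]
  unfolding parallel_def R_iff by (auto simp: prism_def elim: is_cube_cong)

lemma parallel_sym:
  assumes "parallel z x z' x'"
  shows "parallel z' x' z x"
proof -
  have "is_cube X (Suc k) (\<lambda>u. prism k z x z' x' ((\<not> hd u) # tl u))"
    using is_cube_comp[OF _ G_morphism_Cons[OF G_morphism_id]] assms unfolding parallel_def by blast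
  then show ?thesis
    unfolding parallel_def by (rule is_cube_cong) (simp add: prism_def)
qed

lemma parallel_trans:
  assumes "parallel z x z' x'" "parallel z' x' z'' x''"
  shows "parallel z x z'' x''"
proof -
  have "is_cube X (Suc k) (\<lambda>v. if v ! 0 then prism k z' x' z'' x'' v else prism k z x z' x' v)"
  proof (rule glue)
    fix v :: "bool list" assume "length v = Suc k"
    then show "prism k z x z' x' (v[0 := True]) = prism k z' x' z'' x'' (v[0 := False])"
      by (cases v) (simp_all add: prism_def)
  qed (use assms in \<open>simp_all add: parallel_def\<close>)
  then show ?thesis
    unfolding parallel_def by (rule is_cube_cong) (auto simp: prism_def length_Suc_conv)
qed

text \<open>Of the faces that avoid the missing vertex, one is the given spike and the others depend
  on the first coordinate only, so all of them are cubes and completion applies.\<close>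

lemma parallel_exists:
  assumes ax: "(x, z) \<in> R" and x': "x' \<in> points X"
  shows "\<exists>z'. parallel z x z' x'"
proof -
  let ?p = "True # zeros k"
  have x: "x \<in> points X"
    using sim_points[OF ax] by simp
  have "\<exists>g. is_cube X (Suc k) g \<and> (\<forall>u. length u = Suc k \<longrightarrow> u \<noteq> ?p \<longrightarrow> g u = prism k z x x' x' u)"
  proof (rule complete_vertex)
    fix i assume i: "i < Suc k"
    show "is_cube X (Suc k) (\<lambda>u. prism k z x x' x' (u[i := (\<not> ?p ! i)]))"
    proof (cases i)
      case 0
      show ?thesis
        using parallel_refl[OF ax] unfolding parallel_def
        by (rule is_cube_cong) (auto simp: 0 prism_def length_Suc_conv)
    next
      case (Suc j)
      show ?thesis
        using is_cube_hd[OF x' x, of k]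
      proof (rule is_cube_cong)
        fix u :: "bool list" assume u: "length u = Suc k"
        then obtain b v where b: "u = b # v" "length v = k"
          by (auto simp: length_Suc_conv)
        have "v[j := True] \<noteq> zeros k"
          using Suc i b by (metis Suc_less_eq nth_list_update_eq nth_ones(2))
        then show "(if hd u then x' else x) = prism k z x x' x' (u[i := (\<not> ?p ! i)])"
          using i Suc b by (simp add: prism_def)
      qed
    qed
  qed simp
  then obtain g where g: "is_cube X (Suc k) g"
    "\<And>u. length u = Suc k \<Longrightarrow> u \<noteq> ?p \<Longrightarrow> g u = prism k z x x' x' u"
    by blast
  have gs: "g u = prism k z x (g ?p) x' u" if "length u = Suc k" for u
    using g(2)[OF that] that by (cases "u = ?p") (auto simp: prism_def length_Suc_conv)
  show ?thesis
    using is_cube_cong[OF g(1) gs] unfolding parallel_def by blast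
qed

lemma parallel_unique:
  assumes "parallel z x z' x'" "parallel z x z'' x'"
  shows "z' = z''"
proof -
  have "prism k z x z' x' (True # zeros k) = prism k z x z'' x' (True # zeros k)"
    using assms unfolding parallel_def
    by (rule vertex_unique) (auto simp: prism_def length_Suc_conv)
  then show ?thesis
    by (simp add: prism_def)
qed

text \<open>The prism, reflected so that its column stands at \<open>q\<close>, is inserted by
  \<open>replace_column\<close> with \<open>m = 1\<close>. Thus an edge in the first direction may
  be exchanged for a parallel one.\<close>

lemma column_move:
  assumes c: "is_cube X (Suc k) c" and q: "length q = k"
    and par: "parallel z (c (False # q)) z' (c (True # q))"
  shows "is_cube X (Suc k) (\<lambda>u. if tl u = q then (if hd u then z' else z) else c u)"
proof -
  let ?d = "\<lambda>u. prism k z (c (False # q)) z' (c (True # q)) (hd u # map2 (\<noteq>) q (tl u))"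
  have "G_morphism k k (map2 (\<noteq>) q)"
    using G_morphism_map2[of q "(\<noteq>)"] q by simp
  from is_cube_comp[OF _ G_morphism_Cons[OF this, of "\<lambda>b. b"]] par
  have d: "is_cube X (Suc k) ?d"
    unfolding parallel_def by blast
  have z: "map2 (\<noteq>) q v = zeros k \<longleftrightarrow> v = q" if "length v = k" for v
    using that q by (auto simp: list_eq_iff_nth_eq)
  have "is_cube X (1 + k) (\<lambda>w. if drop 1 w = q then ?d w else c w)"
  proof (rule replace_column)
    fix u v :: "bool list" assume "length u = 1" "length v = k" "v \<noteq> q"
    then show "?d (u @ v) = c (u @ q)"
      using z[of v] by (auto simp: length_Suc_conv prism_def)
  qed (use c d q in simp_all)
  then have "is_cube X (Suc k) (\<lambda>w. if drop 1 w = q then ?d w else c w)"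
    by simp
  then show ?thesis
  proof (rule is_cube_cong)
    fix w :: "bool list" assume "length w = Suc k"
    then show "(if drop 1 w = q then ?d w else c w) = (if tl w = q then (if hd w then z' else z) else c w)"
      using z[OF q] by (simp add: drop_Suc prism_def)
  qed
qed

text \<open>The column of the lower prism is exchanged for that of the upper one. This stacking of
  spikes becomes the group law.\<close>

lemma parallel_comp:
  assumes "parallel y x y' x'" "parallel z y z' y'"
  shows "parallel z x z' x'"
proof -
  have "is_cube X (Suc k) (\<lambda>u. if tl u = zeros k then (if hd u then z' else z) else prism k y x y' x' u)"
    using assms by (intro column_move) (simp_all add: parallel_def, simp add: prism_def)
  then show ?thesis
    unfolding parallel_def by (rule is_cube_cong) (simp add: prism_def)
qed

section \<open>The structure group and its action\<close>

definition A :: "'a set" where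
  "A = R `` {e}"

definition act :: "'a \<Rightarrow> 'a \<Rightarrow> 'a" where
  "act a x = (THE y. parallel a e y x)"

text \<open>An element is a class of parallel spikes, represented by the tip of its unique spike
  over \<open>e\<close>; so the base point is the unit and \<open>act\<close> doubles as
  multiplication.\<close>

definition act_group :: "'a monoid" where
  "act_group = \<lparr>carrier = A, mult = act, one = e\<rparr>"

lemma A_iff: "a \<in> A \<longleftrightarrow> (e, a) \<in> R"
  by (simp add: A_def)

lemma act_eq: "parallel a e y x \<Longrightarrow> act a x = y"
  unfolding act_def using parallel_unique by blast

lemma parallel_act: "a \<in> A \<Longrightarrow> x \<in> points X \<Longrightarrow> parallel a e (act a x) x"
  using parallel_exists[of e a x] act_eq by (auto simp: A_iff)

lemma act_R: "a \<in> A \<Longrightarrow> x \<in> points X \<Longrightarrow> (x, act a x) \<in> R"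
  using parallel_act parallel_sides by blast

lemma act_points: "a \<in> A \<Longrightarrow> x \<in> points X \<Longrightarrow> act a x \<in> points X"
  using act_R sim_points by blast

lemma A_points: "a \<in> A \<Longrightarrow> a \<in> points X"
  using A_iff sim_points by blast

lemma e_A: "e \<in> A"
  by (simp add: A_iff sim_refl e)

lemma act_act_parallel: "a \<in> A \<Longrightarrow> x \<in> points X \<Longrightarrow> y \<in> points X \<Longrightarrow> parallel (act a x) x (act a y) y"
  using parallel_trans parallel_sym parallel_act by blast

lemma act_one:
  assumes "x \<in> points X"
  shows "act e x = x"
proof (rule act_eq)
  show "parallel e e x x"
    using is_cube_hd[OF assms e, of k] unfolding parallel_def
    by (rule is_cube_cong) (simp add: prism_def)
qed

lemma act_A: "a \<in> A \<Longrightarrow> b \<in> A \<Longrightarrow> act a b \<in> A"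
  using sim_trans[OF _ act_R[OF _ A_points]] A_iff by blast

lemma act_surj: "(x, y) \<in> R \<Longrightarrow> \<exists>a\<in>A. act a x = y"
  using parallel_exists[of x y e] e parallel_sym parallel_sides(2) act_eq by (meson A_iff)

lemma act_inj:
  assumes "a \<in> A" "b \<in> A" "x \<in> points X" "act a x = act b x"
  shows "a = b"
  using parallel_unique[of "act a x" x a e b] parallel_sym parallel_act assms by metis

text \<open>Translating \<open>b\<close> and \<open>act b x\<close> by \<open>a\<close> gives
  parallel spikes over these two points, which are stacked on the parallel spikes of
  \<open>b\<close> over \<open>e\<close> and of \<open>act b x\<close> over
  \<open>x\<close>.\<close>

lemma act_act:
  assumes "a \<in> A" "b \<in> A" "x \<in> points X"
  shows "act (act a b) x = act a (act b x)"
proof -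
  have "parallel (act a b) b (act a (act b x)) (act b x)"
    using assms act_points A_points by (intro act_act_parallel) auto
  then show ?thesis
    using parallel_comp[OF parallel_act[OF assms(2,3)]] act_eq by blast
qed

lemma group_act: "group act_group"
proof (rule groupI; simp add: act_group_def)
  show "\<exists>y\<in>A. act y x = e" if "x \<in> A" for x
    using that act_surj[of x e] sim_sym by (simp add: A_iff)
qed (simp_all add: act_A e_A act_act A_points act_one)

text \<open>Columns in the first direction are moved one after the other; each move is a parallel
  pair because both ends are translated by the same element. This is why \<open>\<chi>\<close> is a
  function of \<open>tl u\<close>.\<close>

lemma move_all:
  assumes c: "is_cube X (Suc k) c" and \<chi>: "\<And>v. length v = k \<Longrightarrow> \<chi> v \<in> A"
  shows "is_cube X (Suc k) (\<lambda>u. act (\<chi> (tl u)) (c u))"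
proof -
  have "is_cube X (Suc k) (\<lambda>u. if tl u \<in> B then act (\<chi> (tl u)) (c u) else c u)" if "B \<subseteq> cube k" for B
    using finite_subset[OF that finite_cube] that
  proof induction
    case empty
    then show ?case
      using c by simp
  next
    case (insert p B)
    let ?c = "\<lambda>u. if tl u \<in> B then act (\<chi> (tl u)) (c u) else c u"
    have p: "length p = k" "p \<notin> B"
      using insert by auto
    have cp: "c (b # p) \<in> points X" for b
      using is_cube_points[OF c] p by simp
    have "is_cube X (Suc k) (\<lambda>u. if tl u = p then
        (if hd u then act (\<chi> p) (c (True # p)) else act (\<chi> p) (c (False # p))) else ?c u)"
    proof (rule column_move)
      show "is_cube X (Suc k) ?c"
        using insert by blast
      show "parallel (act (\<chi> p) (c (False # p))) (?c (False # p)) (act (\<chi> p) (c (True # p))) (?c (True # p))"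
        using p cp \<chi> by (simp add: act_act_parallel)
    qed (rule p)
    then show ?case
      by (rule is_cube_cong) (auto simp: length_Suc_conv)
  qed
  from this[of "cube k"] have "is_cube X (Suc k) (\<lambda>u. if tl u \<in> cube k then act (\<chi> (tl u)) (c u) else c u)"
    by simp
  then show ?thesis
    by (rule is_cube_cong) simp
qed

text \<open>Such a map is a pointwise change of a constant cube modulo \<open>R\<close>.
  Restrictions on cubes in a fibre therefore begin in dimension \<open>k + 1\<close>.\<close>

lemma fiber_low:
  assumes "\<And>v. length v = n \<Longrightarrow> (x, g v) \<in> R" "n \<le> k" "x \<in> points X"
  shows "is_cube X n g"
  using R_replace[OF is_cube_const[OF assms(3)] assms(2)] assms(1) by blast

lemma fiber_degenerate:
  assumes x: "x \<in> points X" and g: "\<And>u. length u = Suc k \<Longrightarrow> (x, g u) \<in> R" and j: "j \<le> k"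
    and deg: "\<And>u. length u = Suc k \<Longrightarrow> g (u[j := False]) = g u"
  shows "is_cube X (Suc k) g"
proof -
  have "is_cube X k (\<lambda>w. g (face (Suc j) False w))"
    using x g j by (intro fiber_low[of _ x]) (auto simp: face_def)
  from is_cube_comp[OF this G_morphism_delete[OF j]] show ?thesis
  proof (rule is_cube_cong)
    fix u :: "bool list" assume u: "length u = Suc k"
    have "face (Suc j) False (delete j u) = u[j := False]"
      using u j by (simp add: face_def delete_def upd_conv_take_nth_drop)
    then show "g (face (Suc j) False (delete j u)) = g u"
      using deg[OF u] by simp
  qed
qed

text \<open>
  \<open>null x \<phi>\<close> says that the translate of the constant cube \<open>x\<close> by \<open>\<phi>\<close> is \<open>\<approx>\<^sub>1\<close>-equivalent to it.  These
  \<open>\<phi>\<close> form a group under pointwise multiplication that contains every \<open>\<phi>\<close> not depending on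
  some coordinate.
\<close>

definition null :: "'a \<Rightarrow> (bool list \<Rightarrow> 'a) \<Rightarrow> bool" where
  "null x \<phi> \<longleftrightarrow> is_cube X (Suc k) (\<lambda>u. if hd u then x else act (\<phi> (tl u)) x)"

text \<open>Translating the witness of \<open>null x \<phi>\<close> by \<open>\<psi>\<close> joins
  the translate of \<open>x\<close> by both functions to the translate by \<open>\<psi>\<close>, and
  the witness of \<open>null x \<psi>\<close> joins the latter to \<open>x\<close>. The two are
  glued along the first coordinate.\<close>

lemma null_mult:
  assumes x: "x \<in> points X" and A: "\<And>v. length v = k \<Longrightarrow> \<phi> v \<in> A" "\<And>v. length v = k \<Longrightarrow> \<psi> v \<in> A"
    and "null x \<phi>" "null x \<psi>"
  shows "null x (\<lambda>v. act (\<psi> v) (\<phi> v))"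
proof -
  let ?f = "\<lambda>u. act (\<psi> (tl u)) (if hd u then x else act (\<phi> (tl u)) x)"
  let ?g = "\<lambda>u. if hd u then x else act (\<psi> (tl u)) x"
  have "is_cube X (Suc k) (\<lambda>u. if u ! 0 then ?g u else ?f u)"
  proof (rule glue)
    show "is_cube X (Suc k) ?f"
      using assms(4) A(2) unfolding null_def by (rule move_all)
    show "is_cube X (Suc k) ?g"
      using assms(5) unfolding null_def .
    show "?f (v[0 := True]) = ?g (v[0 := False])" if "length v = Suc k" for v
      using that by (auto simp: length_Suc_conv)
  qed simp
  then show ?thesis
    unfolding null_def
  proof (rule is_cube_cong)
    fix u :: "bool list" assume "length u = Suc k"
    then have "length (tl u) = k" "u ! 0 = hd u"
      by (auto simp: length_Suc_conv)
    then show "(if u ! 0 then ?g u else ?f u) = (if hd u then x else act (act (\<psi> (tl u)) (\<phi> (tl u))) x)"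
      by (simp add: act_act A x)
  qed
qed

text \<open>The required cube does not depend on entry \<open>Suc j\<close>, so it is pulled back
  from dimension \<open>k\<close>, where every map into a fibre is a cube.\<close>

lemma null_degenerate:
  assumes x: "x \<in> points X" and A: "\<And>v. length v = k \<Longrightarrow> \<phi> v \<in> A" and j: "j < k"
    and deg: "\<And>v. length v = k \<Longrightarrow> \<phi> (v[j := False]) = \<phi> v"
  shows "null x \<phi>"
  unfolding null_def
proof (rule fiber_degenerate[OF x, of _ "Suc j"])
  show "(x, if hd u then x else act (\<phi> (tl u)) x) \<in> R" if "length u = Suc k" for u
    using act_R[OF A x, of "tl u"] sim_refl[OF x, of "k - 1"] that by simp
  show "(if hd (u[Suc j := False]) then x else act (\<phi> (tl (u[Suc j := False]))) x)
      = (if hd u then x else act (\<phi> (tl u)) x)" if "length u = Suc k" for u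
    using that deg by (auto simp: length_Suc_conv)
qed (use j in simp)

lemma null_unique:
  assumes x: "x \<in> points X" and A: "\<And>v. length v = k \<Longrightarrow> \<phi> v \<in> A" "\<And>v. length v = k \<Longrightarrow> \<psi> v \<in> A"
    and n: "null x \<phi>" "null x \<psi>" and p: "length p = k"
    and eq: "\<And>v. length v = k \<Longrightarrow> v \<noteq> p \<Longrightarrow> \<phi> v = \<psi> v"
  shows "\<phi> p = \<psi> p"
proof -
  let ?f = "\<lambda>\<phi> u. if hd u then x else act (\<phi> (tl u)) x"
  have "?f \<phi> (False # p) = ?f \<psi> (False # p)"
    using n unfolding null_def
  proof (rule vertex_unique)
    fix u assume u: "length u = Suc k" "u \<noteq> False # p"
    then obtain b v where "u = b # v" "length v = k"
      by (auto simp: length_Suc_conv)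
    then show "?f \<phi> u = ?f \<psi> u"
      using u eq[of v] by auto
  qed (simp add: p)
  then show ?thesis
    using act_inj A p x by simp
qed

lemma act_commute:
  assumes k2: "k \<ge> 2" and a: "a \<in> A" and b: "b \<in> A"
  shows "act a b = act b a"
proof -
  \<comment> \<open>Supports: \<open>\<phi>\<close> lives on the edge at the origin in direction 0,
    \<open>\<psi>\<close> on the edge in direction 1. The second direction exists because
    \<open>k \<ge> 2\<close>.\<close>
  define \<phi> where "\<phi> v = (if tl v = zeros (k - 1) then a else e)" for v
  define \<psi> where "\<psi> v = (if v[1 := False] = zeros k then b else e)" for v
  have A: "\<phi> v \<in> A" "\<psi> v \<in> A" for v
    using a b e_A by (simp_all add: \<phi>_def \<psi>_def)
  have "null e \<phi>"
  proof (rule null_degenerate[OF e A(1), of 0])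
    fix v :: "bool list" assume "length v = k"
    then show "\<phi> (v[0 := False]) = \<phi> v"
      by (cases v) (simp_all add: \<phi>_def)
  qed (use k2 in simp)
  moreover have "null e \<psi>"
    using k2 by (intro null_degenerate[where j = 1] e A) (simp_all add: \<psi>_def)
  \<comment> \<open>The product is null in either order, and away from the origin one factor is
    \<open>e\<close>, so the two orders agree there.\<close>
  ultimately have n: "null e (\<lambda>v. act (\<phi> v) (\<psi> v))" "null e (\<lambda>v. act (\<psi> v) (\<phi> v))"
    using A e by (simp_all add: null_mult)
  have "act (\<phi> (zeros k)) (\<psi> (zeros k)) = act (\<psi> (zeros k)) (\<phi> (zeros k))"
  proof (rule null_unique[OF e _ _ n])
    fix v :: "bool list" assume v: "length v = k" "v \<noteq> zeros k"
    then obtain c w where c: "v = c # w" "length w = k - 1"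
      using k by (cases v) auto
    have "zeros k = False # zeros (k - 1)"
      using zeros_Suc(1)[of "k - 1"] Suc_k by simp
    then have "\<phi> v = e \<or> \<psi> v = e"
      using c v k2 by (auto simp: \<phi>_def \<psi>_def)
    moreover have "act e (\<phi> v) = \<phi> v" "act e (\<psi> v) = \<psi> v" "act (\<phi> v) e = \<phi> v" "act (\<psi> v) e = \<psi> v"
    proof -
      have "act c e = c" if "c \<in> A" for c
        using that by (intro act_eq parallel_refl) (simp add: A_iff)
      then show "act (\<phi> v) e = \<phi> v" "act (\<psi> v) e = \<psi> v"
        using A by simp_all
    qed (simp_all add: act_one A_points A)
    ultimately show "act (\<phi> v) (\<psi> v) = act (\<psi> v) (\<phi> v)"
      by auto
  qed (simp_all add: act_A A)
  moreover have "\<phi> (zeros k) = a" "\<psi> (zeros k) = b"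
    using k2 Suc_k by (auto simp: \<phi>_def \<psi>_def zeros_def list_eq_iff_nth_eq nth_list_update nth_tl)
  ultimately show ?thesis
    by simp
qed

end


section \<open>The fibres of a k-step groupspace for k at least 2\<close>

locale higher_step = pointed +
  assumes k2: "k \<ge> 2"
begin

lemma comm_group_act: "comm_group act_group"
  using group.group_comm_groupI[OF group_act] act_commute[OF k2] by (simp add: act_group_def)

sublocale G: comm_group act_group
  by (rule comm_group_act)

lemma act_group_simps [simp]:
  "carrier act_group = A" "x \<otimes>\<^bsub>act_group\<^esub> y = act x y" "\<one>\<^bsub>act_group\<^esub> = e"
  by (simp_all add: act_group_def)

lemma inv_A [simp]: "a \<in> A \<Longrightarrow> inv\<^bsub>act_group\<^esub> a \<in> A"
  using G.inv_closed[of a] by simp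

lemma inv_act [simp]: "a \<in> A \<Longrightarrow> act (inv\<^bsub>act_group\<^esub> a) a = e"
  using G.l_inv[of a] by simp

text \<open>
  Dividing by a function that does not depend on the \<open>j\<close>-th coordinate makes \<open>\<phi>\<close> trivial where that
  coordinate vanishes; after all coordinates only the value at the top vertex is left.
\<close>

lemma null_alt_prod:
  assumes x: "x \<in> points X" and "\<And>v. length v = k \<Longrightarrow> \<phi> v \<in> A" and "null x \<phi>"
  shows "alt_prod act_group k \<phi> = e"
proof -
  have "\<exists>\<psi>. (\<forall>v. length v = k \<longrightarrow> \<psi> v \<in> A) \<and> null x \<psi> \<and> alt_prod act_group k \<psi> = alt_prod act_group k \<phi> \<and>
      (\<forall>v. length v = k \<longrightarrow> (\<exists>i<j. \<not> v ! i) \<longrightarrow> \<psi> v = e)" if "j \<le> k" for j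
    using that
  proof (induction j)
    case 0
    then show ?case
      using assms by auto
  next
    case (Suc j)
    then obtain \<psi> where A: "\<And>v. length v = k \<Longrightarrow> \<psi> v \<in> A" and n: "null x \<psi>"
      and alt: "alt_prod act_group k \<psi> = alt_prod act_group k \<phi>"
      and triv: "\<And>v i. length v = k \<Longrightarrow> i < j \<Longrightarrow> \<not> v ! i \<Longrightarrow> \<psi> v = e"
      by auto
    \<comment> \<open>Clearing entry \<open>j\<close> leaves the earlier entries alone, so at
      vertices where \<open>\<psi>\<close> is already trivial because of an index below
      \<open>j\<close>, \<open>\<chi>\<close> is trivial too and the progress made so far is
      kept.\<close>
    define \<chi> where "\<chi> v = inv\<^bsub>act_group\<^esub> (\<psi> (v[j := False]))" for v
    have \<chi>A: "\<chi> v \<in> A" if "length v = k" for v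
      using A that by (simp add: \<chi>_def)
    have "null x \<chi>"
      by (rule null_degenerate[OF x \<chi>A, where j = j]) (use Suc.prems in \<open>simp_all add: \<chi>_def\<close>)
    then have "null x (\<lambda>v. act (\<chi> v) (\<psi> v))"
      using null_mult[of x \<psi> \<chi>] x A \<chi>A n by blast
    moreover have "alt_prod act_group k (\<lambda>v. act (\<chi> v) (\<psi> v)) = alt_prod act_group k \<phi>"
    proof -
      have "alt_prod act_group k \<chi> = e"
        using G.alt_prod_degenerate[of k \<chi> j] Suc.prems \<chi>A by (simp add: \<chi>_def)
      then show ?thesis
        using G.alt_prod_mult[of k \<chi> \<psi>] G.alt_prod_closed[of k \<psi>] A \<chi>A alt A_points
        by (simp add: act_one)
    qed
    moreover have "act (\<chi> v) (\<psi> v) = e" if v: "length v = k" "i < Suc j" "\<not> v ! i" for v i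
    proof (cases "i = j")
      case True
      then have "v[j := False] = v"
        using v by (metis (full_types) list_update_id)
      then show ?thesis
        using A v by (simp add: \<chi>_def)
    next
      case False
      then have "\<psi> v = e" "\<psi> (v[j := False]) = e"
        using triv[of v i] triv[of "v[j := False]" i] v by simp_all
      then show ?thesis
        using e_A by (simp add: \<chi>_def)
    qed
    ultimately show ?case
      using act_A A \<chi>A by (intro exI[of _ "\<lambda>v. act (\<chi> v) (\<psi> v)"]) blast
  qed
  from this[of k] obtain \<psi> where A: "\<And>v. length v = k \<Longrightarrow> \<psi> v \<in> A" and n: "null x \<psi>"
      and alt: "alt_prod act_group k \<psi> = alt_prod act_group k \<phi>"
      and triv: "\<And>v i. length v = k \<Longrightarrow> i < k \<Longrightarrow> \<not> v ! i \<Longrightarrow> \<psi> v = e"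
    by auto
  have triv': "\<psi> v = e" if "length v = k" "v \<noteq> ones k" for v
    using not_ones_iff[OF that(1)] that triv by blast
  \<comment> \<open>The trivial function is null and agrees with \<open>\<psi>\<close> off the top,
    so unique completion forces the top value.\<close>
  have "null x (\<lambda>v. e)"
    using x e_A k by (intro null_degenerate[where j = 0]) simp_all
  then have "\<psi> (ones k) = e"
    using null_unique[OF x A _ n, of "\<lambda>v. e" "ones k"] e_A triv' by simp
  then have "alt_prod act_group k \<psi> = alt_prod act_group k (\<lambda>v. e)"
    using triv' by (intro alt_prod_cong) metis
  then show ?thesis
    using alt G.alt_prod_one[of k] by simp
qed

text \<open>In dimension \<open>k + 1\<close>, dividing both sides of the first coordinate by the
  values on its true side turns the cube into a witness of \<open>null\<close>, whose alternating
  product is the one sought. In higher dimension both faces of the first coordinate already have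
  trivial product.\<close>

lemma cube_alt_prod:
  assumes x: "x \<in> points X" and "Suc k \<le> n" and "\<And>v. length v = n \<Longrightarrow> f v \<in> A"
    and "is_cube X n (\<lambda>v. act (f v) x)"
  shows "alt_prod act_group n f = e"
  using assms(2-4)
proof (induction n arbitrary: f rule: dec_induct)
  case base
  have A: "f (b # v) \<in> A" if "length v = k" for b v
    using base(1) that by simp
  let ?\<chi> = "\<lambda>v. inv\<^bsub>act_group\<^esub> (f (True # v))"
  let ?\<phi> = "\<lambda>v. act (?\<chi> v) (f (False # v))"
  have "is_cube X (Suc k) (\<lambda>u. act (?\<chi> (tl u)) (act (f u) x))"
    using base(2) by (rule move_all) (simp add: A)
  then have "null x ?\<phi>"
    unfolding null_def
  proof (rule is_cube_cong)
    fix u :: "bool list" assume "length u = Suc k"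
    then obtain b v where "u = b # v" "length v = k"
      by (auto simp: length_Suc_conv)
    then show "act (?\<chi> (tl u)) (act (f u) x) = (if hd u then x else act (?\<phi> (tl u)) x)"
      using A[of v] x by (cases b) (simp_all add: act_one flip: act_act)
  qed
  then have "alt_prod act_group k ?\<phi> = e"
    using x by (intro null_alt_prod) (simp_all add: A act_A)
  moreover have "alt_prod act_group k ?\<phi> =
      inv\<^bsub>act_group\<^esub> (alt_prod act_group k (\<lambda>v. f (True # v))) \<otimes>\<^bsub>act_group\<^esub> alt_prod act_group k (\<lambda>v. f (False # v))"
    using G.alt_prod_mult[of k ?\<chi> "\<lambda>v. f (False # v)"] G.alt_prod_inv[of k "\<lambda>v. f (True # v)"] A by simp
  ultimately show ?case
    using G.alt_prod_closed[of k "\<lambda>v. f (b # v)" for b] A G.m_comm by (simp del: act_group_simps(2))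
next
  case (step n)
  have "alt_prod act_group n (\<lambda>v. f (b # v)) = e" for b
  proof (rule step.IH)
    show "is_cube X n (\<lambda>v. act (f (b # v)) x)"
      using is_cube_comp[OF step.prems(2) G_morphism_const_Cons[OF G_morphism_id]] .
  qed (simp add: step.prems(1))
  then show ?case
    using e_A G.inv_one by (simp add: act_one e)
qed

text \<open>From the equations to cubes: the values up to height \<open>k\<close> extend to a cube,
  which stays in the fibre and so is given by some \<open>h\<close>. Both \<open>f\<close> and
  \<open>h\<close> have trivial alternating product over the face below each higher vertex, and this
  determines the value there from the lower ones; hence \<open>f\<close> and \<open>h\<close>
  agree.\<close>

lemma cube_iff_Dk:
  assumes x: "x \<in> points X" and f: "f \<in> cube n \<rightarrow>\<^sub>E A"
  shows "f \<in> cubes (Dk k act_group) n \<longleftrightarrow> is_cube X n (\<lambda>v. act (f v) x)"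
proof -
  have fA: "f v \<in> A" if "length v = n" for v
    using f that by auto
  have Dk: "f \<in> cubes (Dk k act_group) n \<longleftrightarrow>
      (\<forall>v. length v = n \<longrightarrow> height v \<ge> Suc k \<longrightarrow> alt_prod act_group (height v) (\<lambda>t. f (emb v t)) = e)"
    (is "_ \<longleftrightarrow> ?alt f")
  proof -
    have "(\<Otimes>\<^bsub>act_group\<^esub>u\<in>{u \<in> cube n. list_all2 (\<le>) u v}. f u [^]\<^bsub>act_group\<^esub> ((- 1) ^ height u :: int))
        = alt_prod act_group (height v) (\<lambda>t. f (emb v t))" if "length v = n" for v
      using G.finprod_below[of v f] fA that by simp
    then show ?thesis
      using f by (simp add: Dk_def Ball_def)
  qed
  have alt: "?alt g" if g: "is_cube X n (\<lambda>v. act (g v) x)" "\<And>v. length v = n \<Longrightarrow> g v \<in> A" for g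
  proof (intro allI impI)
    fix v :: "bool list" assume v: "length v = n" "Suc k \<le> height v"
    then have "G_morphism (height v) n (emb v)"
      using G_morphism_emb[of v] by simp
    from is_cube_comp[OF g(1) this] show "alt_prod act_group (height v) (\<lambda>t. g (emb v t)) = e"
      using x v g(2) by (intro cube_alt_prod) simp_all
  qed
  have "is_cube X n (\<lambda>v. act (f v) x)" if "?alt f"
  proof -
    have "\<exists>g. is_cube X n g \<and> (\<forall>w. length w = n \<longrightarrow> height w \<le> k \<longrightarrow> g w = act (f w) x)"
      by (rule extend_low, rule fiber_low[of _ x]) (use x fA act_R in auto)
    then obtain g where g: "is_cube X n g" "\<And>w. length w = n \<Longrightarrow> height w \<le> k \<Longrightarrow> g w = act (f w) x"
      by blast
    \<comment> \<open>\<open>R\<close> has index \<open>k - 1\<close>, so comparison with the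
      constant cube up to height \<open>k - 1\<close> already keeps \<open>g\<close> in the
      fibre.\<close>
    have "(x, g v) \<in> R" if "length v = n" for v
    proof (rule sim_det[OF is_cube_const[OF x] g(1) _ that])
      show "(x, g v) \<in> R" if "length v = n" "height v \<le> k - 1" for v
        using g(2)[of v] act_R[OF fA x, of v] that by simp
    qed
    then have "\<exists>a\<in>A. act a x = g v" if "length v = n" for v
      using act_surj that by blast
    then obtain h where h: "\<And>v. length v = n \<Longrightarrow> h v \<in> A" "\<And>v. length v = n \<Longrightarrow> act (h v) x = g v"
      by metis
    have hc: "is_cube X n (\<lambda>v. act (h v) x)"
      using g(1) by (rule is_cube_cong) (simp add: h)
    have "f v = h v" if "length v = n" for v
      using that
    proof (induction "height v" arbitrary: v rule: less_induct)
      case less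
      show ?case
      proof (cases "height v \<le> k")
        case True
        then show ?thesis
          using g(2)[OF less.prems] h[OF less.prems] act_inj[OF fA _ x] less.prems by metis
      next
        case False
        let ?m = "height v"
        have "(\<lambda>t. f (emb v t)) (ones ?m) = (\<lambda>t. h (emb v t)) (ones ?m)"
        proof (rule G.alt_prod_cancel[of ?m])
          show "alt_prod act_group ?m (\<lambda>t. f (emb v t)) = alt_prod act_group ?m (\<lambda>t. h (emb v t))"
            using \<open>?alt f\<close> alt[OF hc h(1)] less.prems False by simp
          show "f (emb v t) = h (emb v t)" if t: "length t = ?m" "t \<noteq> ones ?m" for t
          proof (rule less.hyps)
            show "height (emb v t) < ?m"
              using height_emb[OF t(1)] height_le_length[of t] height_eq_length[of t] t by (simp add: le_neq_implies_less)
          qed (simp add: less.prems)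
        qed (simp_all add: fA h less.prems)
        then show ?thesis
          by (simp add: emb_ones)
      qed
    qed
    then show ?thesis
      by (intro is_cube_cong[OF hc]) simp
  qed
  then show ?thesis
    using Dk alt[of f] fA by blast
qed

text \<open>Elements of \<open>BijGroup\<close> are extensional maps, hence the restriction of
  \<open>act\<close> to the points.\<close>

definition \<rho> :: "'a \<Rightarrow> 'a \<Rightarrow> 'a" where
  "\<rho> a = (\<lambda>x\<in>points X. act a x)"

lemma free_action_act: "free_action act_group (points X) \<rho>"
proof -
  have "group_action act_group (points X) \<rho>"
    unfolding \<rho>_def[abs_def]
    by (rule group_actionI[OF group_act]) (simp_all add: act_points act_one act_act)
  moreover have "a = e" if "a \<in> A" "x \<in> points X" "act a x = x" for a x
    using act_inj[OF that(1) e_A that(2)] that act_one by simp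
  ultimately show ?thesis
    by (auto simp: free_action_def stabilizer_def \<rho>_def e_A act_one)
qed

lemma orbits_act: "orbits act_group (points X) \<rho> = points X // R"
proof -
  have "orbit act_group \<rho> x = R `` {x}" if "x \<in> points X" for x
    using that act_R act_surj by (fastforce simp: orbit_def \<rho>_def)
  then show ?thesis
    by (auto simp: orbits_def quotient_def)
qed

lemma fiber_iso:
  assumes x: "x \<in> points X"
  shows "equivariant_iso act_group \<rho> (\<lambda>a. act a x) (Dk k act_group) (induced X (R `` {x}))"
proof -
  have "bij_betw (\<lambda>a. act a x) A (R `` {x})"
    using act_R act_surj act_inj x by (fastforce simp: bij_betw_def inj_on_def)
  moreover have "c \<in> cubes (Dk k act_group) n \<longleftrightarrow> compose (cube n) (\<lambda>a. act a x) c \<in> cubes (induced X (R `` {x})) n"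
    if c: "c \<in> cube n \<rightarrow>\<^sub>E A" for n c
  proof -
    have "compose (cube n) (\<lambda>a. act a x) c ` cube n \<subseteq> R `` {x}"
      using c x act_R by (auto simp: compose_def)
    then show ?thesis
      using cube_iff_Dk[OF x c] by (simp add: induced_def is_cube_def compose_def)
  qed
  ultimately show ?thesis
    using x act_points act_act by (simp add: equivariant_iso_def cube_iso_def Dk_def induced_def \<rho>_def)
qed

lemma spike_approx:
  assumes "a \<in> A" "x \<in> points X" "x' \<in> points X"
  shows "approx1 X k (spike k (\<rho> a x) x) (spike k (\<rho> a x') x')"
proof -
  let ?c = "restrict (prism k (act a x) x (act a x') x') (cube (Suc k))"
  have par: "parallel (act a x) x (act a x') x'"
    using assms by (rule act_act_parallel)
  have sp: "spike k (\<rho> a y) y \<in> cubes X k" if "y \<in> points X" for y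
    using act_R[OF assms(1) that, unfolded R_iff] that by (simp add: is_cube_def spike_def \<rho>_def)
  have "?c \<in> cubes X (k + 1)"
    using par by (simp add: parallel_def is_cube_def)
  moreover have "spike k (\<rho> a x) x = compose (cube k) ?c (face 1 False)"
    "spike k (\<rho> a x') x' = compose (cube k) ?c (face 1 True)"
    using assms by (auto simp: spike_def compose_def face_def prism_def \<rho>_def fun_eq_iff)
  ultimately show ?thesis
    using sp assms unfolding approx1_def by blast
qed

end

lemma higher_step_structure:
  fixes X :: "'a cube_structure"
  assumes "step_groupspace k X" "k \<ge> 2"
  shows "\<exists>(G :: 'a monoid) \<rho>. comm_group G \<and> free_action G (points X) \<rho> \<and>
    orbits G (points X) \<rho> = points X // sim X (k - 1) \<and>
    (\<forall>Q\<in>points X // sim X (k - 1). \<exists>m. equivariant_iso G \<rho> m (Dk k G) (induced X Q)) \<and>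
    (\<forall>x\<in>points X. \<forall>x'\<in>points X. \<forall>a\<in>carrier G. approx1 X k (spike k (\<rho> a x) x) (spike k (\<rho> a x') x'))"
proof -
  interpret gspace X
    using assms by unfold_locales (simp add: step_groupspace_def)
  have "\<exists>g. is_cube X 0 g"
    using complete[of 0] by auto
  then obtain e where e: "e \<in> points X"
    using is_cube_points[of 0 _ "[]"] by auto
  interpret higher_step X k e
    using assms e by unfold_locales simp_all
  have "\<exists>m. equivariant_iso act_group \<rho> m (Dk k act_group) (induced X Q)" if "Q \<in> points X // R" for Q
    using that fiber_iso by (auto elim!: quotientE)
  then show ?thesis
    using comm_group_act free_action_act orbits_act spike_approx
    by (intro exI[of _ act_group] exI[of _ \<rho>]) simp
qed

section \<open>The tower of factors\<close>

context gspace
begin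

lemma points_nonempty: "\<exists>x. x \<in> points X"
  using complete[of 0] is_cube_points[of 0 _ "[]"] by auto

text \<open>A spike in the factor lifts to a cube of \<open>X\<close> that differs from the spike of
  \<open>y\<close> over \<open>x\<close> only modulo \<open>sim X i\<close>. Its dimension
  \<open>j + 1\<close> is at most \<open>i + 1\<close>, so \<open>sim_replace\<close> turns the lift
  into that spike.\<close>

lemma sim_level:
  assumes ji: "j \<le> i" and x: "x \<in> points X" and y: "y \<in> points X"
  shows "(sim X i `` {x}, sim X i `` {y}) \<in> sim (level X i) j \<longleftrightarrow> (x, y) \<in> sim X j"
proof -
  interpret Y: gspace "level X i"
    using groupspace_level by unfold_locales
  let ?s = "\<lambda>v. if v = ones (Suc j) then y else x"
  have pts: "sim X i `` {x} \<in> points (level X i)" "sim X i `` {y} \<in> points (level X i)"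
    using x y by (simp_all add: points_factor quotientI)
  have "is_cube (level X i) (Suc j) (\<lambda>v. if v = ones (Suc j) then sim X i `` {y} else sim X i `` {x})
      \<longleftrightarrow> is_cube X (Suc j) ?s"
  proof
    assume "is_cube (level X i) (Suc j) (\<lambda>v. if v = ones (Suc j) then sim X i `` {y} else sim X i `` {x})"
    then obtain c where c: "is_cube X (Suc j) c" "\<And>v. length v = Suc j \<Longrightarrow>
        (if v = ones (Suc j) then sim X i `` {y} else sim X i `` {x}) = sim X i `` {c v}"
      unfolding factor_is_cube by blast
    show "is_cube X (Suc j) ?s"
    proof (rule sim_replace[OF c(1)])
      show "(c v, ?s v) \<in> sim X i" if "length v = Suc j" for v
        using c(2)[OF that] is_cube_points[OF c(1) that] x y
        by (subst sim_class_eq[symmetric]) (auto split: if_splits)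
    qed (use ji in simp)
  next
    assume "is_cube X (Suc j) ?s"
    then show "is_cube (level X i) (Suc j) (\<lambda>v. if v = ones (Suc j) then sim X i `` {y} else sim X i `` {x})"
      unfolding factor_is_cube by (intro exI[of _ ?s]) auto
  qed
  then show ?thesis
    unfolding Y.sim_iff sim_iff using pts x y by blast
qed

lemma level_proj_class: "j \<le> i \<Longrightarrow> x \<in> points X \<Longrightarrow> level_proj X j (sim X i `` {x}) = sim X j `` {x}"
  unfolding level_proj_def using sim_antimono[of j i] sim_trans sim_refl by blast

text \<open>The fibres are thereby described inside \<open>level X i\<close> alone, as classes of
  its own relation of index \<open>i - 1\<close>, so that the structure theorems apply to this
  groupspace.\<close>

lemma level_fiber_class:
  assumes x: "x \<in> points X"
  shows "level_fiber X i (sim X (i - 1) `` {x}) = sim (level X i) (i - 1) `` {sim X i `` {x}}"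
proof -
  interpret Y: gspace "level X i"
    using groupspace_level by unfold_locales
  have "P \<in> level_fiber X i (sim X (i - 1) `` {x}) \<longleftrightarrow> (sim X i `` {x}, P) \<in> sim (level X i) (i - 1)"
    if P: "P \<in> points (level X i)" for P
  proof -
    obtain y where y: "y \<in> points X" "P = sim X i `` {y}"
      using P by (auto simp: points_factor elim!: quotientE)
    have "P \<in> level_fiber X i (sim X (i - 1) `` {x}) \<longleftrightarrow> sim X (i - 1) `` {y} = sim X (i - 1) `` {x}"
      using P level_proj_class[of "i - 1" i y] y by (simp add: level_fiber_def)
    also have "\<dots> \<longleftrightarrow> (x, y) \<in> sim X (i - 1)"
      using sim_class_eq[OF x y(1), of "i - 1"] by auto
    also have "\<dots> \<longleftrightarrow> (sim X i `` {x}, P) \<in> sim (level X i) (i - 1)"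
      using sim_level[of "i - 1" i x y] x y by simp
    finally show ?thesis .
  qed
  moreover have "level_fiber X i Q \<subseteq> points (level X i)" for Q
    by (auto simp: level_fiber_def)
  ultimately show ?thesis
    using Y.sim_points by blast
qed

lemma level_fibers:
  "level_fiber X i ` points (level X (i - 1)) = points (level X i) // sim (level X i) (i - 1)"
proof -
  have "level_fiber X i ` points (level X (i - 1)) = (\<lambda>x. level_fiber X i (sim X (i - 1) `` {x})) ` points X"
    by (auto simp: points_factor quotient_def)
  also have "\<dots> = (\<lambda>x. sim (level X i) (i - 1) `` {sim X i `` {x}}) ` points X"
    by (intro image_cong refl level_fiber_class)
  also have "\<dots> = points (level X i) // sim (level X i) (i - 1)"
    by (auto simp: points_factor quotient_def)
  finally show ?thesis .
qed

end

text \<open>Everything asserted about one level, for an arbitrary groupspace and with classes in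
  place of fibres, so that the groups and actions for all \<open>i\<close> come from a single
  choice.\<close>

definition structure_group ::
  "'a cube_structure \<Rightarrow> nat \<Rightarrow> 'a monoid \<Rightarrow> ('a \<Rightarrow> 'a \<Rightarrow> 'a) \<Rightarrow> bool" where
  "structure_group X i G \<rho> \<longleftrightarrow>
     group G \<and> (i \<ge> 2 \<longrightarrow> comm_group G) \<and> free_action G (points X) \<rho> \<and>
     orbits G (points X) \<rho> = points X // sim X (i - 1) \<and>
     (i = 1 \<longrightarrow> (\<exists>m. equivariant_iso G \<rho> m (D1 G) X)) \<and>
     (i \<ge> 2 \<longrightarrow>
       (\<forall>Q\<in>points X // sim X (i - 1). \<exists>m. equivariant_iso G \<rho> m (Dk i G) (induced X Q)) \<and>
       (\<forall>x\<in>points X. \<forall>x'\<in>points X. \<forall>a\<in>carrier G.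
          approx1 X i (spike i (\<rho> a x) x) (spike i (\<rho> a x') x')))"

lemma structure_group_exists:
  assumes "step_groupspace i X" "i \<ge> 1"
  shows "\<exists>G \<rho>. structure_group X i G \<rho>"
proof (cases "i = 1")
  case True
  then show ?thesis
    using one_step_structure[of X] assms by (simp add: structure_group_def)
next
  case False
  then have "i \<ge> 2"
    using assms(2) by simp
  from higher_step_structure[OF assms(1) this] show ?thesis
    unfolding structure_group_def using False comm_group.axioms(2) by metis
qed

theorem mainTheorem1:
  fixes F :: "'a cube_structure" and k :: nat
  assumes "k \<ge> 1" and "step_groupspace k F"
  shows
    "(\<exists>p. points (level F 0) = {p}) \<and>
     sim F k = Id_on (points F) \<and>
     (\<forall>i\<le>k.
        cube_congruence F (sim F i) \<and>
        step_groupspace i (level F i) \<and>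
        (\<forall>R. cube_congruence F R \<and> step_groupspace i (factor F R) \<longrightarrow> sim F i \<subseteq> R)) \<and>
     (\<exists>(G :: nat \<Rightarrow> 'a set monoid) (\<rho> :: nat \<Rightarrow> 'a set \<Rightarrow> 'a set \<Rightarrow> 'a set).
        (\<forall>i\<in>{1..k}.
           group (G i) \<and> (i \<ge> 2 \<longrightarrow> comm_group (G i)) \<and>
           free_action (G i) (points (level F i)) (\<rho> i) \<and>
           orbits (G i) (points (level F i)) (\<rho> i) =
             level_fiber F i ` points (level F (i - 1))) \<and>
        (\<exists>m. equivariant_iso (G 1) (\<rho> 1) m (D1 (G 1)) (level F 1)) \<and>
        (\<forall>i\<in>{2..k}.
           (\<forall>Q\<in>points (level F (i - 1)).
              \<exists>m. equivariant_iso (G i) (\<rho> i) m (Dk i (G i))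
                    (induced (level F i) (level_fiber F i Q))) \<and>
           (\<forall>x\<in>points (level F i). \<forall>x'\<in>points (level F i). \<forall>a\<in>carrier (G i).
              spike i (\<rho> i a x) x \<in> cubes (level F i) i \<and>
              spike i (\<rho> i a x') x' \<in> cubes (level F i) i \<and>
              approx1 (level F i) i (spike i (\<rho> i a x) x) (spike i (\<rho> i a x') x'))))"
proof -
  interpret gspace F
    using assms(2) by unfold_locales (simp add: step_groupspace_def)
  obtain x where x: "x \<in> points F"
    using points_nonempty by blast
  \<comment> \<open>By ergodicity the relation of index 0 is total, and its one class is the whole
    nonempty set.\<close>
  have "points (level F 0) = {points F}"
    using x by (auto simp: points_factor sim_0 quotient_def)
  then have point: "\<exists>p. points (level F 0) = {p}"
    by blast
  have largest: "cube_congruence F (sim F i) \<and> step_groupspace i (level F i) \<and>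
      (\<forall>R. cube_congruence F R \<and> step_groupspace i (factor F R) \<longrightarrow> sim F i \<subseteq> R)" for i
    using equiv_sim groupspace_level step_groupspace_level sim_least
    unfolding cube_congruence_def by blast
  have "\<forall>i\<in>{1..k}. \<exists>G \<rho>. structure_group (level F i) i G \<rho>"
    by (auto intro!: structure_group_exists step_groupspace_level)
  then obtain G \<rho> where G: "\<And>i. i \<in> {1..k} \<Longrightarrow> structure_group (level F i) i (G i) (\<rho> i)"
    by metis
  have act: "group (G i) \<and> (i \<ge> 2 \<longrightarrow> comm_group (G i)) \<and>
      free_action (G i) (points (level F i)) (\<rho> i) \<and>
      orbits (G i) (points (level F i)) (\<rho> i) = level_fiber F i ` points (level F (i - 1))"
    if "i \<in> {1..k}" for i
    using G[OF that] unfolding structure_group_def level_fibers by blast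
  have first: "\<exists>m. equivariant_iso (G 1) (\<rho> 1) m (D1 (G 1)) (level F 1)"
    using G[of 1] assms(1) by (simp add: structure_group_def)
  have higher: "(\<forall>Q\<in>points (level F (i - 1)). \<exists>m. equivariant_iso (G i) (\<rho> i) m (Dk i (G i))
        (induced (level F i) (level_fiber F i Q))) \<and>
      (\<forall>x\<in>points (level F i). \<forall>x'\<in>points (level F i). \<forall>a\<in>carrier (G i).
        spike i (\<rho> i a x) x \<in> cubes (level F i) i \<and> spike i (\<rho> i a x') x' \<in> cubes (level F i) i \<and>
        approx1 (level F i) i (spike i (\<rho> i a x) x) (spike i (\<rho> i a x') x'))"
    if i: "i \<in> {2..k}" for i
  proof -
    have S: "structure_group (level F i) i (G i) (\<rho> i)" "i \<ge> 2"
      using G[of i] i by simp_all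
    have "level_fiber F i Q \<in> points (level F i) // sim (level F i) (i - 1)"
      if "Q \<in> points (level F (i - 1))" for Q
      using that level_fibers[of i] by blast
    then show ?thesis
      using S unfolding structure_group_def approx1_def by blast
  qed
  show ?thesis
  proof (intro conjI)
    show "\<exists>p. points (level F 0) = {p}"
      by (rule point)
    show "sim F k = Id_on (points F)"
      using assms(2) by (rule step_sim_eq)
  qed (use largest in blast,
      rule exI[of _ G], rule exI[of _ \<rho>], rule conjI[OF ballI[OF act] conjI[OF first ballI[OF higher]]])
qed

end
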